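(* Let $\widetilde{H}$ be the affine Hecke algebra of type $C_2$ with $q^2=-1$. Let $t\in T$ be a weight with $t|_Q=t_{1,q^2}$ and let $w_0$ be the longest element of $W_0$. Let $\mathbb{C}_{1,q^2}=\mathbb{C}v_t$ and $\mathbb{C}_{1,q^{-2}}=\mathbb{C}v_{w_0t}$ be the $1$-dimensional $\widetilde{H}_{\{2\}}$-modules given by $T_2v_t=qv_t$, $X^\lambda v_t=t(X^\lambda)v_t$, and $T_2v_{w_0t}=-q^{-1}v_{w_0t}$, $X^\lambda v_{w_0t}=(w_0t)(X^\lambda)v_{w_0t}$, and let $M=\widetilde{H}\otimes_{\widetilde{H}_{\{2\}}}\mathbb{C}_{1,q^2}$ and $N=\widetilde{H}\otimes_{\widetilde{H}_{\{2\}}}\mathbb{C}_{1,q^{-2}}$. Then: (a) $M_{s_1s_2t}$ is a submodule of $M$, and the image of $M_{s_2t}$ in $M/M_{s_1s_2t}$ is a submodule of $M/M_{s_1s_2t}$. The resulting $2$-dimensional quotient of $M$ is irreducible. Also, $N_{s_2t}$ is a submodule of $N$, and the image of $N_{s_1s_2t}$ in $N/N_{s_2t}$ is a submodule of $N/N_{s_2t}$. The resulting $2$-dimensional quotient of $N$ is irreducible. (b) Any composition factor of the principal series module $M(t)=\widetilde{H}\otimes_{\mathbb{C}[X]}\mathbb{C}_t$ is a composition factor of either $M$ or $N$.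
   Context: The type $C_2$ root system has simple roots $\alpha_1,\alpha_2$ with $\langle\alpha_1,\alpha_2^\vee\rangle=-1$, $\langle\alpha_2,\alpha_1^\vee\rangle=-2$; $s_i\lambda=\lambda-\langle\lambda,\alpha_i^\vee\rangle\alpha_i$, and $W_0=\langle s_1,s_2\rangle$ with longest element $w_0=s_1s_2s_1s_2$. Fundamental weights: $\omega_1=\alpha_1+\frac12\alpha_2$, $\omega_2=\alpha_1+\alpha_2$; $P=\mathbb{Z}\omega_1+\mathbb{Z}\omega_2$, $Q=\mathbb{Z}\alpha_1+\mathbb{Z}\alpha_2$. $X=\{X^\lambda\mid\lambda\in P\}$, $X^\lambda X^\mu=X^{\lambda+\mu}$. For $q\in\mathbb{C}^\times$, $\widetilde{H}$ is the $\mathbb{C}$-algebra generated by $T_1,T_2$ and $X^\lambda$ ($\lambda\in P$), with the group algebra $\mathbb{C}[X]$ a subalgebra, subject to $T_i^2=(q-q^{-1})T_i+1$, $T_1T_2T_1T_2=T_2T_1T_2T_1$, and $X^\lambda T_i=T_iX^{s_i\lambda}+(q-q^{-1})\frac{X^\lambda-X^{s_i\lambda}}{1-X^{-\alpha_i}}$. $\widetilde{H}_{\{i\}}$ is the subalgebra generated by $T_i$ and $\mathbb{C}[X]$. Weights are elements of $T=\mathrm{Hom}(X,\mathbb{C}^\times)$, with $W_0$-action $(wt)(X^\lambda)=t(X^{w^{-1}\lambda})$. For $t\in T$, $t|_Q$ denotes its restriction to $\{X^\lambda\mid\lambda\in Q\}$, and $t_{z,w}$ is the character of $\{X^\lambda\mid\lambda\in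 Q\}$ with $X^{\alpha_1}\mapsto z$, $X^{\alpha_2}\mapsto w$. $\mathbb{C}_t$ is the $1$-dimensional $\mathbb{C}[X]$-module on which $X^\lambda$ acts by $t(X^\lambda)$. For a finite-dimensional $\widetilde{H}$-module $M$, $M_t=\{m\mid X^\lambda m=t(X^\lambda)m\ \forall\lambda\in P\}$. *)

theory Defs
  imports Complex_Main "HOL-Library.Product_Plus" "HOL-Algebra.Free_Abelian_Groups"
    "HOL-Algebra.Generated_Rings"
begin

section \<open>Modules over a possibly noncommutative ring\<close>

text \<open>The locale \<open>module\<close> of the library demands a commutative base ring. We keep its record type;
  the fields \<open>mult\<close> and \<open>one\<close> of that record play no role for modules.\<close>

locale left_module = R?: ring R + M?: abelian_group M
  for R :: "('a, 'r) ring_scheme" (structure) and M :: "('a, 'b, 'm) module_scheme" (structure) +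
  assumes smult_closed:
      "\<lbrakk> a \<in> carrier R; x \<in> carrier M \<rbrakk> \<Longrightarrow> a \<odot>\<^bsub>M\<^esub> x \<in> carrier M"
    and smult_l_distr:
      "\<lbrakk> a \<in> carrier R; b \<in> carrier R; x \<in> carrier M \<rbrakk> \<Longrightarrow>
        (a \<oplus>\<^bsub>R\<^esub> b) \<odot>\<^bsub>M\<^esub> x = a \<odot>\<^bsub>M\<^esub> x \<oplus>\<^bsub>M\<^esub> b \<odot>\<^bsub>M\<^esub> x"
    and smult_r_distr:
      "\<lbrakk> a \<in> carrier R; x \<in> carrier M; y \<in> carrier M \<rbrakk> \<Longrightarrow>
        a \<odot>\<^bsub>M\<^esub> (x \<oplus>\<^bsub>M\<^esub> y) = a \<odot>\<^bsub>M\<^esub> x \<oplus>\<^bsub>M\<^esub> a \<odot>\<^bsub>M\<^esub> y"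
    and smult_assoc:
      "\<lbrakk> a \<in> carrier R; b \<in> carrier R; x \<in> carrier M \<rbrakk> \<Longrightarrow>
        (a \<otimes>\<^bsub>R\<^esub> b) \<odot>\<^bsub>M\<^esub> x = a \<odot>\<^bsub>M\<^esub> (b \<odot>\<^bsub>M\<^esub> x)"
    and smult_one:
      "x \<in> carrier M \<Longrightarrow> \<one>\<^bsub>R\<^esub> \<odot>\<^bsub>M\<^esub> x = x"

definition irreducible_module :: "('a, 'r) ring_scheme \<Rightarrow> ('a, 'b) module \<Rightarrow> bool" where
  "irreducible_module R M \<longleftrightarrow>
     left_module R M \<and> carrier M \<noteq> {\<zero>\<^bsub>M\<^esub>} \<and>
     (\<forall>N. submodule N R M \<longrightarrow> N = {\<zero>\<^bsub>M\<^esub>} \<or> N = carrier M)"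

definition quotient_module :: "('a, 'b) module \<Rightarrow> 'b set \<Rightarrow> ('a, 'b set) module" where
  "quotient_module M N =
     \<lparr>carrier = a_rcosets\<^bsub>M\<^esub> N, mult = undefined, one = undefined, zero = N, add = set_add M,
      smult = (\<lambda>a C. \<Union>x\<in>C. N +>\<^bsub>M\<^esub> (a \<odot>\<^bsub>M\<^esub> x))\<rparr>"

definition module_isomorphic ::
    "('a, 'r) ring_scheme \<Rightarrow> ('a, 'b) module \<Rightarrow> ('a, 'c) module \<Rightarrow> bool" where
  "module_isomorphic R M N \<longleftrightarrow>
     (\<exists>f. bij_betw f (carrier M) (carrier N) \<and>
          (\<forall>x\<in>carrier M. \<forall>y\<in>carrier M. f (x \<oplus>\<^bsub>M\<^esub> y) = f x \<oplus>\<^bsub>N\<^esub> f y) \<and>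
          (\<forall>a\<in>carrier R. \<forall>x\<in>carrier M. f (a \<odot>\<^bsub>M\<^esub> x) = a \<odot>\<^bsub>N\<^esub> f x))"

definition composition_series ::
    "('a, 'r) ring_scheme \<Rightarrow> ('a, 'b) module \<Rightarrow> 'b set list \<Rightarrow> bool" where
  "composition_series R M Ns \<longleftrightarrow>
     Ns \<noteq> [] \<and> hd Ns = {\<zero>\<^bsub>M\<^esub>} \<and> last Ns = carrier M \<and>
     (\<forall>N\<in>set Ns. submodule N R M) \<and>
     (\<forall>i. Suc i < length Ns \<longrightarrow>
        Ns ! i \<subseteq> Ns ! Suc i \<and>
        irreducible_module R (quotient_module (M\<lparr>carrier := Ns ! Suc i\<rparr>) (Ns ! i)))"

definition composition_factor ::
    "('a, 'r) ring_scheme \<Rightarrow> ('a, 'c) module \<Rightarrow> ('a, 'b) module \<Rightarrow> bool" where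
  "composition_factor R S M \<longleftrightarrow> left_module R S \<and>
     (\<exists>Ns i. composition_series R M Ns \<and> Suc i < length Ns \<and>
        module_isomorphic R S (quotient_module (M\<lparr>carrier := Ns ! Suc i\<rparr>) (Ns ! i)))"

text \<open>The tensor product \<open>H \<otimes>\<^sub>A V\<close> for a subring \<open>A\<close> of \<open>H\<close> and a left \<open>A\<close>-module \<open>V\<close>: the free
  abelian group on pairs \<open>(h, v)\<close> modulo biadditivity and \<open>(h a, v) = (h, a v)\<close>; \<open>H\<close> acts by left
  multiplication on the first component.\<close>

definition balancing_relations ::
    "('a, 'r) ring_scheme \<Rightarrow> ('a, 's) ring_scheme \<Rightarrow> ('a, 'b) module \<Rightarrow> ('a \<times> 'b \<Rightarrow>\<^sub>0 int) set" where
  "balancing_relations H A V =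
     {frag_of (h \<oplus>\<^bsub>H\<^esub> h', v) - frag_of (h, v) - frag_of (h', v) | h h' v.
        h \<in> carrier H \<and> h' \<in> carrier H \<and> v \<in> carrier V} \<union>
     {frag_of (h, v \<oplus>\<^bsub>V\<^esub> v') - frag_of (h, v) - frag_of (h, v') | h v v'.
        h \<in> carrier H \<and> v \<in> carrier V \<and> v' \<in> carrier V} \<union>
     {frag_of (h \<otimes>\<^bsub>H\<^esub> a, v) - frag_of (h, a \<odot>\<^bsub>V\<^esub> v) | h a v.
        h \<in> carrier H \<and> a \<in> carrier A \<and> v \<in> carrier V}"

definition induced_module ::
    "('a, 'r) ring_scheme \<Rightarrow> ('a, 's) ring_scheme \<Rightarrow> ('a, 'b) module
       \<Rightarrow> ('a, ('a \<times> 'b \<Rightarrow>\<^sub>0 int) set) module" where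
  "induced_module H A V =
     (let G = free_Abelian_group (carrier H \<times> carrier V);
          K = generate G (balancing_relations H A V)
      in \<lparr>carrier = rcosets\<^bsub>G\<^esub> K, mult = undefined, one = undefined, zero = K, add = set_mult G,
          smult = (\<lambda>h C. \<Union>c\<in>C.
             K #>\<^bsub>G\<^esub> frag_extend (\<lambda>(x, v). frag_of (h \<otimes>\<^bsub>H\<^esub> x, v)) c)\<rparr>)"


section \<open>The root system of type \<open>C\<^sub>2\<close>\<close>

text \<open>A weight \<open>a \<omega>\<^sub>1 + b \<omega>\<^sub>2\<close> of the lattice \<open>P\<close> is encoded as the pair \<open>(a, b)\<close>.\<close>

type_synonym lattice = "int \<times> int"

datatype node = N1 | N2

fun coroot_pairing :: "lattice \<Rightarrow> node \<Rightarrow> int" where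
  "coroot_pairing \<mu> N1 = fst \<mu>"
| "coroot_pairing \<mu> N2 = snd \<mu>"

fun simple_root :: "node \<Rightarrow> lattice" where
  "simple_root N1 = (2, -1)"
| "simple_root N2 = (-2, 2)"

definition int_scale :: "int \<Rightarrow> lattice \<Rightarrow> lattice" where
  "int_scale n \<mu> = (n * fst \<mu>, n * snd \<mu>)"

lemma cartan_matrix:
  "coroot_pairing (simple_root N1) N1 = 2" "coroot_pairing (simple_root N1) N2 = -1"
  "coroot_pairing (simple_root N2) N1 = -2" "coroot_pairing (simple_root N2) N2 = 2"
  by simp_all

lemma fundamental_weights:
  "int_scale 2 (1, 0) = int_scale 2 (simple_root N1) + simple_root N2"
  "(0, 1) = simple_root N1 + simple_root N2"
  by (simp_all add: int_scale_def)

definition reflection :: "node \<Rightarrow> lattice \<Rightarrow> lattice" where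
  "reflection i \<mu> = \<mu> - int_scale (coroot_pairing \<mu> i) (simple_root i)"

definition longest_element :: "lattice \<Rightarrow> lattice" where
  "longest_element = reflection N1 \<circ> reflection N2 \<circ> reflection N1 \<circ> reflection N2"

text \<open>An element of \<open>T = Hom(X, \<complex>\<^sup>\<times>)\<close> is encoded as the function \<open>\<lambda> \<mapsto> t(X\<^sup>\<lambda>)\<close> on \<open>P\<close>.\<close>

definition torus :: "(lattice \<Rightarrow> complex) set" where
  "torus = {t. (\<forall>\<mu> \<nu>. t (\<mu> + \<nu>) = t \<mu> * t \<nu>) \<and> (\<forall>\<mu>. t \<mu> \<noteq> 0)}"

definition weyl_act :: "(lattice \<Rightarrow> lattice) \<Rightarrow> (lattice \<Rightarrow> complex) \<Rightarrow> lattice \<Rightarrow> complex" where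
  "weyl_act w t = (\<lambda>\<mu>. t (inv_into UNIV w \<mu>))"

text \<open>The restriction of \<open>t\<close> to \<open>Q\<close> is the character \<open>t\<^sub>z\<^sub>,\<^sub>w\<close>.\<close>

definition restricts_to :: "(lattice \<Rightarrow> complex) \<Rightarrow> complex \<Rightarrow> complex \<Rightarrow> bool" where
  "restricts_to t z w \<longleftrightarrow>
     (\<forall>a b. t (int_scale a (simple_root N1) + int_scale b (simple_root N2)) = z powi a * w powi b)"


section \<open>The affine Hecke algebra\<close>

datatype generator = T node | X lattice

text \<open>Words in the generators, written additively so that \<open>word \<Rightarrow>\<^sub>0 complex\<close> carries the
  convolution product and is the free algebra; likewise \<open>lattice \<Rightarrow>\<^sub>0 complex\<close> is \<open>\<complex>[X]\<close>.\<close>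

datatype word = Word "generator list"

instantiation word :: monoid_add
begin
fun plus_word :: "word \<Rightarrow> word \<Rightarrow> word" where
  "Word u + Word v = Word (u @ v)"
definition zero_word :: word where
  "0 = Word []"
instance
proof
  fix a b c :: word
  show "a + b + c = a + (b + c)" by (cases a; cases b; cases c) simp
  show "0 + a = a" "a + 0 = a" by (cases a; simp add: zero_word_def)+
qed
end

type_synonym free_algebra = "word \<Rightarrow>\<^sub>0 complex"
type_synonym group_algebra = "lattice \<Rightarrow>\<^sub>0 complex"

abbreviation free_const :: "complex \<Rightarrow> free_algebra" where
  "free_const c \<equiv> Poly_Mapping.single 0 c"

abbreviation free_T :: "node \<Rightarrow> free_algebra" where
  "free_T i \<equiv> Poly_Mapping.single (Word [T i]) 1"

abbreviation free_X :: "lattice \<Rightarrow> free_algebra" where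
  "free_X \<mu> \<equiv> Poly_Mapping.single (Word [X \<mu>]) 1"

definition free_poly :: "group_algebra \<Rightarrow> free_algebra" where
  "free_poly f = (\<Sum>\<mu>\<in>Poly_Mapping.keys f. free_const (Poly_Mapping.lookup f \<mu>) * free_X \<mu>)"

abbreviation X_pow :: "lattice \<Rightarrow> group_algebra" where
  "X_pow \<mu> \<equiv> Poly_Mapping.single \<mu> 1"

text \<open>In the last family, \<open>f\<close> is the fraction \<open>(X\<^sup>\<lambda> - X\<^sup>s\<^sup>\<lambda>) / (1 - X\<^sup>-\<^sup>\<alpha>)\<close>; it exists in \<open>\<complex>[X]\<close> and is
  unique because \<open>1 - X\<^sup>-\<^sup>\<alpha>\<close> is not a zero divisor.\<close>

definition hecke_relations :: "complex \<Rightarrow> free_algebra set" where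
  "hecke_relations q =
     {free_X 0 - 1} \<union>
     {free_X \<mu> * free_X \<nu> - free_X (\<mu> + \<nu>) | \<mu> \<nu>. True} \<union>
     {free_T i * free_T i - (free_const (q - inverse q) * free_T i + 1) | i. True} \<union>
     {free_T N1 * free_T N2 * free_T N1 * free_T N2 - free_T N2 * free_T N1 * free_T N2 * free_T N1} \<union>
     {free_X \<mu> * free_T i
        - (free_T i * free_X (reflection i \<mu>) + free_const (q - inverse q) * free_poly f) | i \<mu> f.
        f * (1 - X_pow (- simple_root i)) = X_pow \<mu> - X_pow (reflection i \<mu>)}"

definition free_ring :: "free_algebra ring" where
  "free_ring = \<lparr>carrier = UNIV, mult = (*), one = 1, zero = 0, add = (+)\<rparr>"

type_synonym hecke_elt = "free_algebra set"

definition hecke :: "complex \<Rightarrow> hecke_elt ring" where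
  "hecke q = free_ring Quot (Idl\<^bsub>free_ring\<^esub> (hecke_relations q))"

definition hecke_class :: "complex \<Rightarrow> free_algebra \<Rightarrow> hecke_elt" where
  "hecke_class q x = Idl\<^bsub>free_ring\<^esub> (hecke_relations q) +>\<^bsub>free_ring\<^esub> x"

definition hecke_const :: "complex \<Rightarrow> complex \<Rightarrow> hecke_elt" where
  "hecke_const q c = hecke_class q (free_const c)"

definition hecke_T :: "complex \<Rightarrow> node \<Rightarrow> hecke_elt" where
  "hecke_T q i = hecke_class q (free_T i)"

definition hecke_X :: "complex \<Rightarrow> lattice \<Rightarrow> hecke_elt" where
  "hecke_X q \<mu> = hecke_class q (free_X \<mu>)"

definition hecke_poly :: "complex \<Rightarrow> group_algebra \<Rightarrow> hecke_elt" where
  "hecke_poly q f = hecke_class q (free_poly f)"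

text \<open>The subalgebra \<open>\<complex>[X]\<close>, and the one generated by \<open>T\<^sub>i\<close> and \<open>\<complex>[X]\<close>. The latter contains the
  scalars, so generation as a ring and as a \<open>\<complex>\<close>-algebra coincide.\<close>

definition hecke_poly_subring :: "complex \<Rightarrow> hecke_elt ring" where
  "hecke_poly_subring q = (hecke q)\<lparr>carrier := range (hecke_poly q)\<rparr>"

definition hecke_parabolic :: "complex \<Rightarrow> node \<Rightarrow> hecke_elt ring" where
  "hecke_parabolic q i =
     (hecke q)\<lparr>carrier := generate_ring (hecke q) (insert (hecke_T q i) (range (hecke_poly q)))\<rparr>"


section \<open>Complex bases and weight spaces\<close>

text \<open>The complex vector space underlying a module over one of these algebras is obtained by
  restricting the action to the scalars.\<close>

definition complex_basis :: "complex \<Rightarrow> (hecke_elt, 'b) module \<Rightarrow> 'b list \<Rightarrow> bool" where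
  "complex_basis q M bs \<longleftrightarrow> set bs \<subseteq> carrier M \<and>
     (\<forall>x\<in>carrier M. \<exists>!c. c \<in> {..<length bs} \<rightarrow>\<^sub>E UNIV \<and>
        x = (\<Oplus>\<^bsub>M\<^esub>i\<in>{..<length bs}. hecke_const q (c i) \<odot>\<^bsub>M\<^esub> (bs ! i)))"

definition complex_dimension :: "complex \<Rightarrow> (hecke_elt, 'b) module \<Rightarrow> nat \<Rightarrow> bool" where
  "complex_dimension q M n \<longleftrightarrow> (\<exists>bs. length bs = n \<and> complex_basis q M bs)"

definition weight_space ::
    "complex \<Rightarrow> (hecke_elt, 'b) module \<Rightarrow> (lattice \<Rightarrow> complex) \<Rightarrow> 'b set" where
  "weight_space q M t =
     {m \<in> carrier M. \<forall>\<mu>. hecke_X q \<mu> \<odot>\<^bsub>M\<^esub> m = hecke_const q (t \<mu>) \<odot>\<^bsub>M\<^esub> m}"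

end

theory Submission
  imports Defs
begin

text \<open>
  For \<open>q\<^sup>2 = -1\<close> one has \<open>- 1/q = q\<close>, and the quadratic relation becomes \<open>(T\<^sub>i - q)\<^sup>2 = 0\<close>. The orbit of \<open>t\<close>
  consists of \<open>t\<close>, \<open>s\<^sub>2 t\<close>, \<open>s\<^sub>1 s\<^sub>2 t\<close> and \<open>w\<^sub>0 t\<close>, because \<open>s\<^sub>1\<close> fixes \<open>t\<close>. Neighbours in this list are
  connected by the operators \<open>T\<^sub>i - q\<close>, which intertwine the weights and have square zero. So they can
  be crossed in one direction only, and this produces submodules.

  Concretely, let \<open>v\<close> be a vector of weight \<open>t\<close> with \<open>T\<^sub>2 v = q v\<close>, and put \<open>w = T\<^sub>1 v\<close>. The lattice acts
  on the span of \<open>v\<close> and \<open>w\<close> by Jordan blocks. Intertwining operators take \<open>w\<close> to a vector \<open>n\<close> of weight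
  \<open>s\<^sub>2 t\<close>, and \<open>n\<close> to a vector \<open>m\<close> of weight \<open>s\<^sub>1 s\<^sub>2 t\<close>. The relations determine the action of all
  generators on these four vectors (locale \<open>standard_vector\<close>). The line of \<open>m\<close> and the plane of \<open>n\<close> and \<open>m\<close>
  are submodules. In the quotient by the plane every nonzero submodule contains \<open>v\<close>, because of the
  Jordan block, and so the quotient is simple (\<open>irreducible_top\<close>).

  In the induced module \<open>M\<close> the four vectors are a basis. Their independence needs a representation in
  which they are independent: it is written down on \<open>\<complex>\<^sup>4\<close> (\<open>gen4\<close>), its relations are verified
  (\<open>model_relations\<close>), and the universal property of the tensor product maps \<open>M\<close> onto it (\<open>J_inj\<close>).
  Part (a) for \<open>M\<close> is then \<open>weight_filtration\<close>. The module \<open>N\<close> is the same construction for \<open>w\<^sub>0 t\<close> in place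
  of \<open>t\<close>: all hypotheses on \<open>t\<close> hold for \<open>w\<^sub>0 t = t\<^sup>-\<^sup>1\<close>, and the other two weights change places
  (\<open>special_weight_longest\<close>, \<open>longest_weights\<close>).

  For part (b) the principal series is controlled through the centre. Two elements of \<open>\<complex>[X]\<close> that are
  invariant under the Weyl group vanish at \<open>t\<close>. They are central, so they vanish on \<open>M(t)\<close> and on
  every composition factor of it. This forces a weight vector whose weight lies in the orbit of \<open>t\<close>
  (\<open>has_good_vector_if_central_zero\<close>). Intertwining operators then lead to a vector that is annihilated
  by enough of them to determine the simple module. It is the top of \<open>M\<close> or of \<open>N\<close>, or the
  one-dimensional module of weight \<open>s\<^sub>2 t\<close> or \<open>s\<^sub>1 s\<^sub>2 t\<close>; the former occurs in \<open>M\<close> and the latter in \<open>N\<close>, as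
  the line of \<open>n\<close> modulo that of \<open>m\<close> (\<open>composition_factor_if_good_vector\<close>).
\<close>

section \<open>Submodules and quotient modules\<close>

lemma left_moduleI:
  assumes "ring R" and "comm_group (add_monoid M)"
    and "\<And>a x. \<lbrakk>a \<in> carrier R; x \<in> carrier M\<rbrakk> \<Longrightarrow> a \<odot>\<^bsub>M\<^esub> x \<in> carrier M"
    and "\<And>a b x. \<lbrakk>a \<in> carrier R; b \<in> carrier R; x \<in> carrier M\<rbrakk> \<Longrightarrow>
        (a \<oplus>\<^bsub>R\<^esub> b) \<odot>\<^bsub>M\<^esub> x = a \<odot>\<^bsub>M\<^esub> x \<oplus>\<^bsub>M\<^esub> b \<odot>\<^bsub>M\<^esub> x"
    and "\<And>a x y. \<lbrakk>a \<in> carrier R; x \<in> carrier M; y \<in> carrier M\<rbrakk> \<Longrightarrow>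
        a \<odot>\<^bsub>M\<^esub> (x \<oplus>\<^bsub>M\<^esub> y) = a \<odot>\<^bsub>M\<^esub> x \<oplus>\<^bsub>M\<^esub> a \<odot>\<^bsub>M\<^esub> y"
    and "\<And>a b x. \<lbrakk>a \<in> carrier R; b \<in> carrier R; x \<in> carrier M\<rbrakk> \<Longrightarrow>
        (a \<otimes>\<^bsub>R\<^esub> b) \<odot>\<^bsub>M\<^esub> x = a \<odot>\<^bsub>M\<^esub> (b \<odot>\<^bsub>M\<^esub> x)"
    and "\<And>x. x \<in> carrier M \<Longrightarrow> \<one>\<^bsub>R\<^esub> \<odot>\<^bsub>M\<^esub> x = x"
  shows "left_module R M"
proof -
  have "abelian_group M"
    using assms(2)
    by (simp add: abelian_group_def abelian_group_axioms_def abelian_monoid_def comm_group_def)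
  then show ?thesis
    unfolding left_module_def left_module_axioms_def using assms by auto
qed

lemma comm_group_cong:
  assumes "comm_group G" "carrier H = carrier G" "\<one>\<^bsub>H\<^esub> = \<one>\<^bsub>G\<^esub>"
    "\<And>x y. x \<otimes>\<^bsub>H\<^esub> y = x \<otimes>\<^bsub>G\<^esub> y"
  shows "comm_group H"
proof -
  interpret comm_group G by fact
  show ?thesis
  proof (rule comm_groupI)
    show "\<exists>y\<in>carrier H. y \<otimes>\<^bsub>H\<^esub> x = \<one>\<^bsub>H\<^esub>" if "x \<in> carrier H" for x
      using that assms(2-) l_inv_ex by auto
  qed (use assms(2-) m_assoc m_comm in auto)
qed

text \<open>Quotient modules and induced modules have the same shape: the cosets of a subgroup \<open>K\<close> in a
  commutative group, with ring elements acting through endomorphisms \<open>\<phi> a\<close> that preserve \<open>K\<close>. Both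
  are instances of the following locale, so the union in the scalar action has to be computed only
  once, in \<open>smult_coset\<close>.\<close>

locale coset_action = ring R + G: comm_group G
  for R :: "('a, 'r) ring_scheme" (structure) and G :: "('b, 'm) monoid_scheme" +
  fixes K :: "'b set" and \<phi> :: "'a \<Rightarrow> 'b \<Rightarrow> 'b"
  assumes K: "subgroup K G"
    and hom: "a \<in> carrier R \<Longrightarrow> \<phi> a \<in> Group.hom G G"
    and preserves: "\<lbrakk>a \<in> carrier R; x \<in> K\<rbrakk> \<Longrightarrow> \<phi> a x \<in> K"
    and distr: "\<lbrakk>a \<in> carrier R; b \<in> carrier R; x \<in> carrier G\<rbrakk> \<Longrightarrow>
      K #>\<^bsub>G\<^esub> \<phi> (a \<oplus>\<^bsub>R\<^esub> b) x = K #>\<^bsub>G\<^esub> (\<phi> a x \<otimes>\<^bsub>G\<^esub> \<phi> b x)"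
    and assoc: "\<lbrakk>a \<in> carrier R; b \<in> carrier R; x \<in> carrier G\<rbrakk> \<Longrightarrow>
      K #>\<^bsub>G\<^esub> \<phi> (a \<otimes>\<^bsub>R\<^esub> b) x = K #>\<^bsub>G\<^esub> \<phi> a (\<phi> b x)"
    and one: "x \<in> carrier G \<Longrightarrow> K #>\<^bsub>G\<^esub> \<phi> \<one>\<^bsub>R\<^esub> x = K #>\<^bsub>G\<^esub> x"
begin

definition coset_module :: "('a, 'b set) module" where
  "coset_module =
     \<lparr>carrier = rcosets\<^bsub>G\<^esub> K, mult = undefined, one = undefined, zero = K, add = set_mult G,
      smult = (\<lambda>a C. \<Union>x\<in>C. K #>\<^bsub>G\<^esub> \<phi> a x)\<rparr>"

lemma normal: "K \<lhd> G"
  using K G.normal_iff_subgroup by simp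

lemma image_closed: "\<lbrakk>a \<in> carrier R; x \<in> carrier G\<rbrakk> \<Longrightarrow> \<phi> a x \<in> carrier G"
  using hom by (auto simp: Group.hom_def)

lemma smult_coset:
  assumes a: "a \<in> carrier R" and x: "x \<in> carrier G"
  shows "a \<odot>\<^bsub>coset_module\<^esub> (K #>\<^bsub>G\<^esub> x) = K #>\<^bsub>G\<^esub> \<phi> a x"
proof -
  have "K #>\<^bsub>G\<^esub> \<phi> a y = K #>\<^bsub>G\<^esub> \<phi> a x" if y: "y \<in> K #>\<^bsub>G\<^esub> x" for y
  proof -
    obtain k where k: "k \<in> K" "y = k \<otimes>\<^bsub>G\<^esub> x"
      using y by (auto simp: r_coset_def)
    have kG: "k \<in> carrier G"
      using k K subgroup.mem_carrier by metis
    have "\<phi> a y = \<phi> a k \<otimes>\<^bsub>G\<^esub> \<phi> a x"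
      using hom[OF a] kG x k by (auto simp: Group.hom_def)
    then show ?thesis
      using G.coset_mult_assoc[of K "\<phi> a k" "\<phi> a x"] G.coset_join2[of "\<phi> a k" K]
        subgroup.subset[OF K] preserves[OF a] k(1) K image_closed[OF a kG] image_closed[OF a x]
      by simp
  qed
  then have "(\<Union>y\<in>K #>\<^bsub>G\<^esub> x. K #>\<^bsub>G\<^esub> \<phi> a y) = (\<Union>y\<in>K #>\<^bsub>G\<^esub> x. K #>\<^bsub>G\<^esub> \<phi> a x)"
    by (rule SUP_cong[OF refl])
  moreover have "K #>\<^bsub>G\<^esub> x \<noteq> {}"
    using G.rcos_self[OF x K] by blast
  ultimately show ?thesis
    unfolding coset_module_def by simp
qed

lemma add_coset:
  "\<lbrakk>x \<in> carrier G; y \<in> carrier G\<rbrakk> \<Longrightarrow>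
    (K #>\<^bsub>G\<^esub> x) \<oplus>\<^bsub>coset_module\<^esub> (K #>\<^bsub>G\<^esub> y) = K #>\<^bsub>G\<^esub> (x \<otimes>\<^bsub>G\<^esub> y)"
  unfolding coset_module_def using normal.rcos_sum[OF normal] by simp

lemma carrier_coset_module: "carrier coset_module = (\<lambda>x. K #>\<^bsub>G\<^esub> x) ` carrier G"
  unfolding coset_module_def by (auto simp: RCOSETS_def)

lemma zero_coset_module: "\<zero>\<^bsub>coset_module\<^esub> = K"
  unfolding coset_module_def by simp

lemma left_module_coset_module: "left_module R coset_module"
proof (rule left_moduleI)
  show "comm_group (add_monoid coset_module)"
    by (rule comm_group_cong[OF G.abelian_FactGroup[OF K]])
      (simp_all add: coset_module_def FactGroup_def)
qed (use ring_axioms in \<open>auto simp: carrier_coset_module smult_coset add_coset image_closed distr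
      assoc one hom_mult[OF hom]\<close>)

lemma coset_eq_iff:
  assumes "x \<in> carrier G" "y \<in> carrier G"
  shows "K #>\<^bsub>G\<^esub> x = K #>\<^bsub>G\<^esub> y \<longleftrightarrow> x \<otimes>\<^bsub>G\<^esub> inv\<^bsub>G\<^esub> y \<in> K"
proof
  assume "K #>\<^bsub>G\<^esub> x = K #>\<^bsub>G\<^esub> y"
  then show "x \<otimes>\<^bsub>G\<^esub> inv\<^bsub>G\<^esub> y \<in> K"
    using G.rcos_self[OF assms(1) K] subgroup.rcos_module_imp[OF K G.is_group assms(2)] by simp
next
  assume "x \<otimes>\<^bsub>G\<^esub> inv\<^bsub>G\<^esub> y \<in> K"
  then have "x \<in> K #>\<^bsub>G\<^esub> y"
    using subgroup.rcos_module_rev[OF K G.is_group assms(2,1)] by simp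
  then show "K #>\<^bsub>G\<^esub> x = K #>\<^bsub>G\<^esub> y"
    using G.repr_independence[OF _ assms(2) K] by simp
qed

end

context left_module
begin

lemma submodule_memD:
  assumes "submodule N R M"
  shows "N \<subseteq> carrier M" "\<zero>\<^bsub>M\<^esub> \<in> N" "\<And>x y. \<lbrakk>x \<in> N; y \<in> N\<rbrakk> \<Longrightarrow> x \<oplus>\<^bsub>M\<^esub> y \<in> N"
    "\<And>x. x \<in> N \<Longrightarrow> \<ominus>\<^bsub>M\<^esub> x \<in> N" "\<And>a x. \<lbrakk>a \<in> carrier R; x \<in> N\<rbrakk> \<Longrightarrow> a \<odot>\<^bsub>M\<^esub> x \<in> N"
proof -
  interpret N: submodule N R M by fact
  show "N \<subseteq> carrier M" "\<zero>\<^bsub>M\<^esub> \<in> N" "\<And>x y. \<lbrakk>x \<in> N; y \<in> N\<rbrakk> \<Longrightarrow> x \<oplus>\<^bsub>M\<^esub> y \<in> N"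
    using N.subset N.one_closed N.m_closed by simp_all
  show "\<And>x. x \<in> N \<Longrightarrow> \<ominus>\<^bsub>M\<^esub> x \<in> N"
    using N.m_inv_closed unfolding a_inv_def by simp
  show "\<And>a x. \<lbrakk>a \<in> carrier R; x \<in> N\<rbrakk> \<Longrightarrow> a \<odot>\<^bsub>M\<^esub> x \<in> N"
    by (rule N.smult_closed)
qed

lemma smult_zero_right: "a \<in> carrier R \<Longrightarrow> a \<odot>\<^bsub>M\<^esub> \<zero>\<^bsub>M\<^esub> = \<zero>\<^bsub>M\<^esub>"
  using smult_r_distr[of a "\<zero>\<^bsub>M\<^esub>" "\<zero>\<^bsub>M\<^esub>"] smult_closed[of a "\<zero>\<^bsub>M\<^esub>"] M.r_neg1 M.l_neg by force

lemma smult_zero_left: "x \<in> carrier M \<Longrightarrow> \<zero>\<^bsub>R\<^esub> \<odot>\<^bsub>M\<^esub> x = \<zero>\<^bsub>M\<^esub>"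
  using smult_l_distr[of "\<zero>\<^bsub>R\<^esub>" "\<zero>\<^bsub>R\<^esub>" x] smult_closed[of "\<zero>\<^bsub>R\<^esub>" x] M.r_neg1 M.l_neg by force

lemma smult_minus: "\<lbrakk>a \<in> carrier R; x \<in> carrier M\<rbrakk> \<Longrightarrow> a \<odot>\<^bsub>M\<^esub> (\<ominus>\<^bsub>M\<^esub> x) = \<ominus>\<^bsub>M\<^esub> (a \<odot>\<^bsub>M\<^esub> x)"
  using smult_r_distr[of a "\<ominus>\<^bsub>M\<^esub> x" x] smult_closed M.l_neg smult_zero_right M.minus_equality
  by (metis M.a_inv_closed)

lemma neg_one_smult: "x \<in> carrier M \<Longrightarrow> (\<ominus>\<^bsub>R\<^esub> \<one>\<^bsub>R\<^esub>) \<odot>\<^bsub>M\<^esub> x = \<ominus>\<^bsub>M\<^esub> x"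
  using smult_l_distr[of "\<ominus>\<^bsub>R\<^esub> \<one>\<^bsub>R\<^esub>" "\<one>\<^bsub>R\<^esub>" x] smult_closed smult_one R.l_neg smult_zero_left
  by (metis M.minus_equality R.add.inv_closed R.one_closed)

lemma submoduleI:
  assumes "N \<subseteq> carrier M" "\<zero>\<^bsub>M\<^esub> \<in> N" "\<And>x y. \<lbrakk>x \<in> N; y \<in> N\<rbrakk> \<Longrightarrow> x \<oplus>\<^bsub>M\<^esub> y \<in> N"
    "\<And>a x. \<lbrakk>a \<in> carrier R; x \<in> N\<rbrakk> \<Longrightarrow> a \<odot>\<^bsub>M\<^esub> x \<in> N"
  shows "submodule N R M"
proof -
  have "\<ominus>\<^bsub>M\<^esub> x \<in> N" if "x \<in> N" for x
    using assms(4)[of "\<ominus>\<^bsub>R\<^esub> \<one>\<^bsub>R\<^esub>" x] neg_one_smult[of x] assms(1) that by auto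
  then show ?thesis
    using assms by (auto intro!: submodule.intro subgroup.intro simp: submodule_axioms_def a_inv_def)
qed

lemma submodule_zero: "submodule {\<zero>\<^bsub>M\<^esub>} R M"
  by (rule submoduleI) (auto simp: smult_zero_right)

lemma submodule_carrier: "submodule (carrier M) R M"
  by (rule submoduleI) (auto simp: smult_closed)

lemma left_module_submodule:
  assumes "submodule N R M"
  shows "left_module R (M\<lparr>carrier := N\<rparr>)"
proof (rule left_moduleI)
  have "subgroup N (add_monoid M)"
    using assms by (simp add: submodule_def)
  then have "Group.group ((add_monoid M)\<lparr>carrier := N\<rparr>)"
    by (rule subgroup.subgroup_is_group) (rule M.a_group)
  then have "comm_group ((add_monoid M)\<lparr>carrier := N\<rparr>)"
    by (rule group.group_comm_groupI)
      (use submodule_memD(1)[OF assms] in \<open>auto intro: M.a_comm\<close>)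
  then show "comm_group (add_monoid (M\<lparr>carrier := N\<rparr>))"
    by (rule comm_group_cong) simp_all
qed (use R.ring_axioms submodule_memD[OF assms] in
    \<open>auto simp: smult_l_distr smult_r_distr smult_assoc smult_one subset_iff\<close>)

lemma submodule_of_submodule:
  assumes N: "submodule N R M" and L: "submodule L R M" and "N \<subseteq> L"
  shows "submodule N R (M\<lparr>carrier := L\<rparr>)"
  using assms submodule_memD[OF N] left_module.submoduleI[OF left_module_submodule[OF L], of N]
  by auto

lemma coset_action_quotient:
  assumes "submodule N R M"
  shows "coset_action R (add_monoid M) N (\<lambda>a x. a \<odot>\<^bsub>M\<^esub> x)"
proof -
  interpret N: submodule N R M by fact
  interpret G: comm_group "add_monoid M" by (rule M.a_comm_group)
  show ?thesis
    by unfold_locales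
      (auto simp: Group.hom_def smult_closed smult_l_distr smult_r_distr smult_assoc smult_one
        intro: N.m_closed)
qed

end

text \<open>These rules describe a quotient through the projection \<open>x \<mapsto> N + x\<close>. All later arguments about
  quotients use them instead of the definition by unions of cosets.\<close>

lemma quotient_module:
  fixes M :: "('a, 'b) module"
  assumes M: "left_module R M" and N: "submodule N R M"
  shows left_module_quotient: "left_module R (quotient_module M N)"
    and carrier_quotient: "carrier (quotient_module M N) = (\<lambda>x. N +>\<^bsub>M\<^esub> x) ` carrier M"
    and add_quotient: "\<And>x y. \<lbrakk>x \<in> carrier M; y \<in> carrier M\<rbrakk> \<Longrightarrow>
      (N +>\<^bsub>M\<^esub> x) \<oplus>\<^bsub>quotient_module M N\<^esub> (N +>\<^bsub>M\<^esub> y) = N +>\<^bsub>M\<^esub> (x \<oplus>\<^bsub>M\<^esub> y)"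
    and smult_quotient: "\<And>a x. \<lbrakk>a \<in> carrier R; x \<in> carrier M\<rbrakk> \<Longrightarrow>
      a \<odot>\<^bsub>quotient_module M N\<^esub> (N +>\<^bsub>M\<^esub> x) = N +>\<^bsub>M\<^esub> (a \<odot>\<^bsub>M\<^esub> x)"
    and zero_quotient: "\<zero>\<^bsub>quotient_module M N\<^esub> = N"
    and coset_eq_zero_iff: "\<And>x. x \<in> carrier M \<Longrightarrow> N +>\<^bsub>M\<^esub> x = N \<longleftrightarrow> x \<in> N"
proof -
  interpret left_module R M by (rule M)
  interpret coset_action R "add_monoid M" N "\<lambda>a x. a \<odot>\<^bsub>M\<^esub> x"
    by (rule coset_action_quotient[OF N])
  have eq: "quotient_module M N = coset_module"
    unfolding quotient_module_def coset_module_def a_r_coset_def A_RCOSETS_def set_add_def ..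
  show "left_module R (quotient_module M N)"
    unfolding eq by (rule left_module_coset_module)
  show "carrier (quotient_module M N) = (\<lambda>x. N +>\<^bsub>M\<^esub> x) ` carrier M"
    unfolding eq carrier_coset_module a_r_coset_def by simp
  show "\<zero>\<^bsub>quotient_module M N\<^esub> = N"
    unfolding eq by (rule zero_coset_module)
  show "(N +>\<^bsub>M\<^esub> x) \<oplus>\<^bsub>quotient_module M N\<^esub> (N +>\<^bsub>M\<^esub> y) = N +>\<^bsub>M\<^esub> (x \<oplus>\<^bsub>M\<^esub> y)"
    if "x \<in> carrier M" "y \<in> carrier M" for x y
    unfolding eq a_r_coset_def using add_coset[of x y] that by simp
  show "a \<odot>\<^bsub>quotient_module M N\<^esub> (N +>\<^bsub>M\<^esub> x) = N +>\<^bsub>M\<^esub> (a \<odot>\<^bsub>M\<^esub> x)"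
    if "a \<in> carrier R" "x \<in> carrier M" for a x
    unfolding eq a_r_coset_def using smult_coset[of a x] that by simp
  show "N +>\<^bsub>M\<^esub> x = N \<longleftrightarrow> x \<in> N" if "x \<in> carrier M" for x
    using that K group.coset_join1[OF M.a_group, of N x] group.coset_join2[OF M.a_group, of x N]
    unfolding a_r_coset_def by auto
qed

section \<open>Induced modules\<close>

definition tensor ::
    "('a, 'r) ring_scheme \<Rightarrow> ('a, 's) ring_scheme \<Rightarrow> ('a, 'b) module \<Rightarrow> 'a \<Rightarrow> 'b \<Rightarrow>
      ('a \<times> 'b \<Rightarrow>\<^sub>0 int) set" where
  "tensor H A V h v =
     generate (free_Abelian_group (carrier H \<times> carrier V)) (balancing_relations H A V)
       #>\<^bsub>free_Abelian_group (carrier H \<times> carrier V)\<^esub> frag_of (h, v)"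

locale induced = H: ring H
  for H :: "('a, 'r) ring_scheme" (structure) and A :: "('a, 's) ring_scheme"
    and V :: "('a, 'b) module" +
  assumes A_subset: "carrier A \<subseteq> carrier H"
    and V_add_closed: "\<lbrakk>x \<in> carrier V; y \<in> carrier V\<rbrakk> \<Longrightarrow> x \<oplus>\<^bsub>V\<^esub> y \<in> carrier V"
    and V_smult_closed: "\<lbrakk>a \<in> carrier A; x \<in> carrier V\<rbrakk> \<Longrightarrow> a \<odot>\<^bsub>V\<^esub> x \<in> carrier V"
begin

abbreviation "F \<equiv> free_Abelian_group (carrier H \<times> carrier V)"
abbreviation "Rel \<equiv> balancing_relations H A V"
abbreviation "K \<equiv> generate F Rel"
abbreviation "\<phi> h \<equiv> frag_extend (\<lambda>(x, v). frag_of (h \<otimes> x, v))"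
abbreviation "I \<equiv> induced_module H A V"

sublocale F: comm_group F
  by (rule abelian_free_Abelian_group)

lemma Rel_subset: "Rel \<subseteq> carrier F"
proof
  fix x assume "x \<in> Rel"
  then show "x \<in> carrier F"
    unfolding balancing_relations_def
    using A_subset V_add_closed V_smult_closed
    by (auto dest!: subsetD[OF keys_diff] split: if_splits)
qed

lemma subgroup_K: "subgroup K F"
  by (rule F.generate_is_subgroup[OF Rel_subset])

lemma frag_hom: "h \<in> carrier H \<Longrightarrow> \<phi> h \<in> Group.hom F F"
  by (rule homI) (auto simp: frag_extend_add dest!: subsetD[OF keys_frag_extend] split: if_splits)

text \<open>Homomorphisms on a free group are compared on its generators. The module axioms of the induced
  module all reduce to this.\<close>

lemma frag_eq_mod_K:
  assumes "x \<in> carrier F" "f \<in> Group.hom F F" "g \<in> Group.hom F F"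
    and gen: "\<And>h v. \<lbrakk>h \<in> carrier H; v \<in> carrier V\<rbrakk> \<Longrightarrow> f (frag_of (h, v)) - g (frag_of (h, v)) \<in> K"
  shows "K #>\<^bsub>F\<^esub> f x = K #>\<^bsub>F\<^esub> g x"
proof -
  have closed: "f y \<in> carrier F" "g y \<in> carrier F" if "y \<in> carrier F" for y
    using hom_in_carrier[OF assms(2) that] hom_in_carrier[OF assms(3) that] by simp_all
  have diff: "f (y - z) = f y - f z" "g (y - z) = g y - g z"
    if "y \<in> carrier F" "z \<in> carrier F" for y z
    using hom_frag_diff[OF assms(2)] hom_frag_diff[OF assms(3)] that by auto
  have "x \<in> carrier F \<and> f x - g x \<in> K"
  proof (rule frag_induction[of x "carrier H \<times> carrier V"])
    show "Poly_Mapping.keys x \<subseteq> carrier H \<times> carrier V"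
      using assms(1) by simp
    have "0 \<in> carrier F" by simp
    from diff[OF this this] show "0 \<in> carrier F \<and> f 0 - g 0 \<in> K"
      using subgroup.one_closed[OF subgroup_K] by simp
    show "frag_of y \<in> carrier F \<and> f (frag_of y) - g (frag_of y) \<in> K"
      if "y \<in> carrier H \<times> carrier V" for y
      using that gen by (cases y) auto
    show "y - z \<in> carrier F \<and> f (y - z) - g (y - z) \<in> K"
      if "y \<in> carrier F \<and> f y - g y \<in> K" "z \<in> carrier F \<and> f z - g z \<in> K" for y z
    proof -
      have yz: "y - z \<in> carrier F"
        using that by (auto dest!: subsetD[OF keys_diff])
      have "inv\<^bsub>F\<^esub> (f z - g z) = - (f z - g z)"
        using that subgroup.mem_carrier[OF subgroup_K] by (intro inv_free_Abelian_group) force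
      then have "(f y - g y) - (f z - g z) \<in> K"
        using subgroup.m_closed[OF subgroup_K, of "f y - g y" "- (f z - g z)"]
          subgroup.m_inv_closed[OF subgroup_K, of "f z - g z"] that by (simp del: minus_diff_eq)
      moreover have "f (y - z) - g (y - z) = (f y - g y) - (f z - g z)"
        using diff that by simp
      ultimately show ?thesis
        using yz by simp
    qed
  qed
  then have "f x \<otimes>\<^bsub>F\<^esub> inv\<^bsub>F\<^esub> (g x) \<in> K"
    using closed[OF assms(1)] by (simp add: inv_free_Abelian_group)
  then have "f x \<in> K #>\<^bsub>F\<^esub> g x"
    using subgroup.rcos_module_rev[OF subgroup_K F.is_group] closed[OF assms(1)] by simp
  then show ?thesis
    using F.repr_independence[OF _ _ subgroup_K] closed[OF assms(1)] by simp
qed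

lemma zero_in_K: "0 \<in> K"
  using subgroup.one_closed[OF subgroup_K] by simp

lemma rel_in_K: "x \<in> Rel \<Longrightarrow> x \<in> K"
  by (rule generate.incl)

lemma preserves_K:
  assumes h: "h \<in> carrier H" and x: "x \<in> K"
  shows "\<phi> h x \<in> K"
proof -
  have "\<phi> h y \<in> Rel" if "y \<in> Rel" for y
  proof -
    from that consider
      (1) a b v where "y = frag_of (a \<oplus> b, v) - frag_of (a, v) - frag_of (b, v)"
        "a \<in> carrier H" "b \<in> carrier H" "v \<in> carrier V"
      | (2) a v w where "y = frag_of (a, v \<oplus>\<^bsub>V\<^esub> w) - frag_of (a, v) - frag_of (a, w)"
        "a \<in> carrier H" "v \<in> carrier V" "w \<in> carrier V"
      | (3) a b v where "y = frag_of (a \<otimes> b, v) - frag_of (a, b \<odot>\<^bsub>V\<^esub> v)"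
        "a \<in> carrier H" "b \<in> carrier A" "v \<in> carrier V"
      unfolding balancing_relations_def by blast
    then show ?thesis
    proof cases
      case 1
      then have "\<phi> h y = frag_of (h \<otimes> a \<oplus> h \<otimes> b, v) - frag_of (h \<otimes> a, v) - frag_of (h \<otimes> b, v)"
        using h by (simp add: frag_extend_diff H.r_distr)
      then show ?thesis
        unfolding balancing_relations_def using h 1 by blast
    next
      case 2
      then have "\<phi> h y = frag_of (h \<otimes> a, v \<oplus>\<^bsub>V\<^esub> w) - frag_of (h \<otimes> a, v) - frag_of (h \<otimes> a, w)"
        by (simp add: frag_extend_diff)
      then show ?thesis
        unfolding balancing_relations_def using h 2 by blast
    next
      case 3
      then have "\<phi> h y = frag_of ((h \<otimes> a) \<otimes> b, v) - frag_of (h \<otimes> a, b \<odot>\<^bsub>V\<^esub> v)"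
        using h A_subset by (simp add: frag_extend_diff H.m_assoc subset_iff)
      then show ?thesis
        unfolding balancing_relations_def using h 3 by blast
    qed
  qed
  then have "\<phi> h ` Rel \<subseteq> K"
    using rel_in_K by blast
  moreover have "\<phi> h ` K = generate F (\<phi> h ` Rel)"
  proof -
    interpret group_hom F F "\<phi> h"
      by unfold_locales (rule frag_hom[OF h])
    show ?thesis
      by (rule generate_img[OF Rel_subset, symmetric])
  qed
  ultimately show ?thesis
    using F.generate_subgroup_incl[OF _ subgroup_K] x by blast
qed

sublocale coset_action H F K \<phi>
proof (intro coset_action.intro coset_action_axioms.intro)
  show "ring H" "comm_group F" "subgroup K F"
    by (rule H.ring_axioms F.comm_group_axioms subgroup_K)+
  show hom: "\<phi> a \<in> Group.hom F F" if "a \<in> carrier H" for a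
    by (rule frag_hom[OF that])
  show "\<phi> a x \<in> K" if "a \<in> carrier H" "x \<in> K" for a x
    by (rule preserves_K[OF that])
  show "K #>\<^bsub>F\<^esub> \<phi> (a \<oplus> b) x = K #>\<^bsub>F\<^esub> (\<phi> a x \<otimes>\<^bsub>F\<^esub> \<phi> b x)"
    if ab: "a \<in> carrier H" "b \<in> carrier H" and x: "x \<in> carrier F" for a b x
  proof (rule frag_eq_mod_K[OF x, where g = "\<lambda>x. \<phi> a x \<otimes>\<^bsub>F\<^esub> \<phi> b x"])
    show "(\<lambda>x. \<phi> a x \<otimes>\<^bsub>F\<^esub> \<phi> b x) \<in> Group.hom F F"
      using F.hom_group_mult[OF hom[OF ab(1)] hom[OF ab(2)]] by simp
    show "\<phi> (a \<oplus> b) (frag_of (h, v)) - \<phi> a (frag_of (h, v)) \<otimes>\<^bsub>F\<^esub> \<phi> b (frag_of (h, v)) \<in> K"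
      if "h \<in> carrier H" "v \<in> carrier V" for h v
    proof -
      have "frag_of (a \<otimes> h \<oplus> b \<otimes> h, v) - frag_of (a \<otimes> h, v) - frag_of (b \<otimes> h, v) \<in> Rel"
        unfolding balancing_relations_def using that ab by blast
      then show ?thesis
        using that ab rel_in_K by (simp add: H.l_distr diff_diff_eq)
    qed
  qed (use hom ab in simp)
  show "K #>\<^bsub>F\<^esub> \<phi> (a \<otimes> b) x = K #>\<^bsub>F\<^esub> \<phi> a (\<phi> b x)"
    if ab: "a \<in> carrier H" "b \<in> carrier H" and x: "x \<in> carrier F" for a b x
  proof (rule frag_eq_mod_K[OF x, where g = "\<lambda>x. \<phi> a (\<phi> b x)"])
    show "(\<lambda>x. \<phi> a (\<phi> b x)) \<in> Group.hom F F"
      using hom_compose[OF hom[OF ab(2)] hom[OF ab(1)]] by (simp add: comp_def)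
  qed (use hom ab in \<open>simp_all add: H.m_assoc zero_in_K\<close>)
  show "K #>\<^bsub>F\<^esub> \<phi> \<one> x = K #>\<^bsub>F\<^esub> x" if "x \<in> carrier F" for x
    by (rule frag_eq_mod_K[OF that, where g = "\<lambda>x. x"])
      (use hom in \<open>simp_all add: zero_in_K Group.hom_def\<close>)
qed

lemma induced_eq_coset_module: "I = coset_module"
  unfolding induced_module_def coset_module_def by (simp add: Let_def)

lemma left_module_induced: "left_module H I"
  unfolding induced_eq_coset_module by (rule left_module_coset_module)

lemma tensor_closed: "\<lbrakk>h \<in> carrier H; v \<in> carrier V\<rbrakk> \<Longrightarrow> tensor H A V h v \<in> carrier I"
  unfolding induced_eq_coset_module carrier_coset_module tensor_def by simp

lemma smult_tensor:
  "\<lbrakk>h \<in> carrier H; k \<in> carrier H; v \<in> carrier V\<rbrakk> \<Longrightarrow>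
    h \<odot>\<^bsub>I\<^esub> tensor H A V k v = tensor H A V (h \<otimes> k) v"
  unfolding induced_eq_coset_module tensor_def by (subst smult_coset) simp_all

lemma tensor_balanced:
  assumes "h \<in> carrier H" "a \<in> carrier A" "v \<in> carrier V"
  shows "tensor H A V (h \<otimes> a) v = tensor H A V h (a \<odot>\<^bsub>V\<^esub> v)"
proof -
  have "frag_of (h \<otimes> a, v) - frag_of (h, a \<odot>\<^bsub>V\<^esub> v) \<in> K"
    by (rule rel_in_K) (use assms in \<open>auto simp: balancing_relations_def\<close>)
  then show ?thesis
    unfolding tensor_def using assms A_subset V_smult_closed
    by (subst coset_eq_iff) (auto simp: inv_free_Abelian_group)
qed

lemma induced_induct [consumes 1, case_names zero tensor diff]:
  assumes x: "x \<in> carrier I" and zero: "P \<zero>\<^bsub>I\<^esub>"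
    and tensor: "\<And>h v. \<lbrakk>h \<in> carrier H; v \<in> carrier V\<rbrakk> \<Longrightarrow> P (tensor H A V h v)"
    and diff: "\<And>x y. \<lbrakk>x \<in> carrier I; y \<in> carrier I; P x; P y\<rbrakk> \<Longrightarrow> P (x \<ominus>\<^bsub>I\<^esub> y)"
  shows "P x"
proof -
  interpret I: left_module H I by (rule left_module_induced)
  obtain c where c: "c \<in> carrier F" "x = K #>\<^bsub>F\<^esub> c"
    using x unfolding induced_eq_coset_module carrier_coset_module by blast
  have "c \<in> carrier F \<and> P (K #>\<^bsub>F\<^esub> c)"
  proof (rule frag_induction[of c "carrier H \<times> carrier V"])
    show "0 \<in> carrier F \<and> P (K #>\<^bsub>F\<^esub> 0)"
      using zero F.coset_mult_one[of K] subgroup.subset[OF subgroup_K]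
      by (simp add: induced_eq_coset_module zero_coset_module)
    show "frag_of y \<in> carrier F \<and> P (K #>\<^bsub>F\<^esub> frag_of y)" if "y \<in> carrier H \<times> carrier V" for y
      using that tensor unfolding tensor_def by (cases y) simp
    show "y - z \<in> carrier F \<and> P (K #>\<^bsub>F\<^esub> (y - z))"
      if y: "y \<in> carrier F \<and> P (K #>\<^bsub>F\<^esub> y)" and z: "z \<in> carrier F \<and> P (K #>\<^bsub>F\<^esub> z)" for y z
    proof -
      have yz: "y - z \<in> carrier F"
        using y z by (auto dest!: subsetD[OF keys_diff])
      have mem: "K #>\<^bsub>F\<^esub> y \<in> carrier I" "K #>\<^bsub>F\<^esub> z \<in> carrier I" "K #>\<^bsub>F\<^esub> (y - z) \<in> carrier I"
        unfolding induced_eq_coset_module carrier_coset_module using y z yz by blast+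
      have "(K #>\<^bsub>F\<^esub> (y - z)) \<oplus>\<^bsub>I\<^esub> (K #>\<^bsub>F\<^esub> z) = K #>\<^bsub>F\<^esub> y"
        unfolding induced_eq_coset_module using add_coset[of "y - z" z] yz z by simp
      then have "K #>\<^bsub>F\<^esub> (y - z) = (K #>\<^bsub>F\<^esub> y) \<ominus>\<^bsub>I\<^esub> (K #>\<^bsub>F\<^esub> z)"
        using mem by (metis I.M.add.inv_solve_right' I.M.minus_eq)
      then show ?thesis
        using diff[OF mem(1,2)] y z yz by simp
    qed
  qed (use c in simp)
  then show ?thesis using c by simp
qed

text \<open>The universal property of the tensor product. It is the source of maps out of an induced
  module, and thus of lower bounds for its size.\<close>

lemma induced_universal:
  fixes f :: "'a \<Rightarrow> 'b \<Rightarrow> 'c::ab_group_add"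
  assumes add1: "\<And>h k v. \<lbrakk>h \<in> carrier H; k \<in> carrier H; v \<in> carrier V\<rbrakk> \<Longrightarrow>
      f (h \<oplus> k) v = f h v + f k v"
    and add2: "\<And>h v w. \<lbrakk>h \<in> carrier H; v \<in> carrier V; w \<in> carrier V\<rbrakk> \<Longrightarrow>
      f h (v \<oplus>\<^bsub>V\<^esub> w) = f h v + f h w"
    and bal: "\<And>h a v. \<lbrakk>h \<in> carrier H; a \<in> carrier A; v \<in> carrier V\<rbrakk> \<Longrightarrow>
      f (h \<otimes> a) v = f h (a \<odot>\<^bsub>V\<^esub> v)"
  obtains g where "\<And>x y. \<lbrakk>x \<in> carrier I; y \<in> carrier I\<rbrakk> \<Longrightarrow> g (x \<oplus>\<^bsub>I\<^esub> y) = g x + g y"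
    and "\<And>h v. \<lbrakk>h \<in> carrier H; v \<in> carrier V\<rbrakk> \<Longrightarrow> g (tensor H A V h v) = f h v"
proof -
  define C :: "'c monoid" where "C = \<lparr>carrier = (UNIV :: 'c set), mult = (+), one = 0\<rparr>"
  have C: "comm_group C"
    unfolding C_def by (rule comm_groupI) (auto simp: add.assoc add.commute intro: exI[of _ "- _"])
  interpret C: comm_group C by (rule C)
  obtain e where e: "e \<in> Group.hom F C"
    and e_of: "\<And>x. x \<in> carrier H \<times> carrier V \<Longrightarrow> e (frag_of x) = case_prod f x"
    using C.free_Abelian_group_universal[of "case_prod f" "carrier H \<times> carrier V"]
    by (auto simp: C_def)
  have e_add: "e (x + y) = e x + e y" if "x \<in> carrier F" "y \<in> carrier F" for x y
    using hom_mult[OF e that] by (simp add: C_def)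
  interpret e: group_hom F C e
    by unfold_locales (rule e)
  have e_diff: "e (x - y) = e x - e y" if "x \<in> carrier F" "y \<in> carrier F" for x y
  proof -
    have "x - y \<in> carrier F"
      using that by (auto dest!: subsetD[OF keys_diff])
    from e_add[OF this that(2)] show ?thesis by simp
  qed
  have "Rel \<subseteq> kernel F C e"
  proof
    fix x assume x: "x \<in> Rel"
    have split: "e (u - v) = e u - e v \<and> u - v \<in> carrier F" if "u \<in> carrier F" "v \<in> carrier F" for u v
      using e_diff[OF that] that by (auto dest!: subsetD[OF keys_diff])
    have "e x = 0"
      using x unfolding balancing_relations_def
    proof (elim UnE CollectE exE conjE)
      fix h k v assume *: "x = frag_of (h \<oplus> k, v) - frag_of (h, v) - frag_of (k, v)"
        "h \<in> carrier H" "k \<in> carrier H" "v \<in> carrier V"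
      then show ?thesis
        using split[of "frag_of (h \<oplus> k, v)" "frag_of (h, v)"]
          split[of "frag_of (h \<oplus> k, v) - frag_of (h, v)" "frag_of (k, v)"]
        by (simp add: e_of add1)
    next
      fix h v w assume *: "x = frag_of (h, v \<oplus>\<^bsub>V\<^esub> w) - frag_of (h, v) - frag_of (h, w)"
        "h \<in> carrier H" "v \<in> carrier V" "w \<in> carrier V"
      then show ?thesis
        using split[of "frag_of (h, v \<oplus>\<^bsub>V\<^esub> w)" "frag_of (h, v)"]
          split[of "frag_of (h, v \<oplus>\<^bsub>V\<^esub> w) - frag_of (h, v)" "frag_of (h, w)"] V_add_closed
        by (simp add: e_of add2)
    next
      fix h a v assume *: "x = frag_of (h \<otimes> a, v) - frag_of (h, a \<odot>\<^bsub>V\<^esub> v)"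
        "h \<in> carrier H" "a \<in> carrier A" "v \<in> carrier V"
      then have "a \<in> carrier H" "a \<odot>\<^bsub>V\<^esub> v \<in> carrier V"
        using A_subset V_smult_closed by auto
      then show ?thesis
        using split[of "frag_of (h \<otimes> a, v)" "frag_of (h, a \<odot>\<^bsub>V\<^esub> v)"] * bal[OF *(2-4)]
        by (simp add: e_of)
    qed
    then show "x \<in> kernel F C e"
      using subsetD[OF Rel_subset x] by (simp add: kernel_def C_def)
  qed
  then have ker: "K \<subseteq> kernel F C e"
    by (rule F.generate_subgroup_incl[OF _ e.subgroup_kernel])
  have e_eq: "e x = e y" if "x \<in> carrier F" "y \<in> carrier F" "K #>\<^bsub>F\<^esub> x = K #>\<^bsub>F\<^esub> y" for x y
  proof -
    have "x - y \<in> K"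
      using iffD1[OF coset_eq_iff[OF that(1,2)] that(3)] that(1,2) by simp
    then have "e (x - y) = 0"
      using ker by (auto simp: kernel_def C_def)
    then show ?thesis
      using e_diff that by simp
  qed
  obtain g where g: "g \<in> Group.hom (F Mod K) C" and g_of: "\<And>x. x \<in> carrier F \<Longrightarrow> g (K #>\<^bsub>F\<^esub> x) = e x"
    by (rule FactGroup_universal[OF e normal e_eq]) auto
  show thesis
  proof (rule that[of g])
    show "g (x \<oplus>\<^bsub>I\<^esub> y) = g x + g y" if "x \<in> carrier I" "y \<in> carrier I" for x y
      using hom_mult[OF g, of x y] that
      by (simp add: induced_eq_coset_module coset_module_def FactGroup_def C_def)
    show "g (tensor H A V h v) = f h v" if "h \<in> carrier H" "v \<in> carrier V" for h v
      unfolding tensor_def using g_of[of "frag_of (h, v)"] e_of[of "(h, v)"] that by simp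
  qed
qed

end

text \<open>If \<open>V\<close> is generated by \<open>v\<close>, then the tensors \<open>h \<otimes> (a v) = (h a) \<otimes> v\<close> all lie in the
  submodule generated by \<open>1 \<otimes> v\<close>.\<close>

lemma (in induced) submodule_with_generator:
  assumes v: "v \<in> carrier V" "\<And>x. x \<in> carrier V \<Longrightarrow> \<exists>a\<in>carrier A. x = a \<odot>\<^bsub>V\<^esub> v"
    and N: "submodule N H I" "tensor H A V \<one>\<^bsub>H\<^esub> v \<in> N"
  shows "N = carrier I"
proof -
  interpret I: left_module H I by (rule left_module_induced)
  note closed = I.submodule_memD[OF N(1)]
  have "x \<in> N" if "x \<in> carrier I" for x
    using that
  proof (induction rule: induced_induct)
    case zero
    then show ?case by (rule closed(2))
  next
    case (tensor h y)
    obtain a where a: "a \<in> carrier A" "y = a \<odot>\<^bsub>V\<^esub> v"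
      using v(2) tensor by blast
    then have aH: "a \<in> carrier H" using A_subset by blast
    have "tensor H A V h y = tensor H A V (h \<otimes> a) v"
      using tensor_balanced[of h a v] tensor a v by simp
    also have "\<dots> = (h \<otimes> a) \<odot>\<^bsub>I\<^esub> tensor H A V \<one> v"
      using smult_tensor[of "h \<otimes> a" \<one> v] tensor aH v by simp
    finally show ?case
      using closed(5)[OF _ N(2)] tensor aH by simp
  next
    case (diff x y)
    then show ?case
      using closed(3,4) by (simp add: I.M.minus_eq)
  qed
  then show ?thesis using closed(1) by blast
qed

section \<open>The Hecke algebra as a quotient of the free algebra\<close>

lemma ring_free_ring: "ring free_ring"
proof (rule ringI)
  show "abelian_group free_ring"
    by (rule abelian_groupI) (auto simp: free_ring_def add.assoc add.commute intro: exI[of _ "- _"])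
  show "monoid free_ring"
    by (rule monoidI) (simp_all add: free_ring_def mult.assoc)
qed (simp_all add: free_ring_def distrib_left distrib_right)

lemma a_inv_free_ring: "\<ominus>\<^bsub>free_ring\<^esub> x = - x"
proof -
  interpret ring free_ring by (rule ring_free_ring)
  have "- x \<oplus>\<^bsub>free_ring\<^esub> x = \<zero>\<^bsub>free_ring\<^esub>" "x \<in> carrier free_ring" "- x \<in> carrier free_ring"
    by (simp_all add: free_ring_def)
  then show ?thesis by (metis minus_equality)
qed

abbreviation hecke_ideal :: "complex \<Rightarrow> free_algebra set" where
  "hecke_ideal q \<equiv> Idl\<^bsub>free_ring\<^esub> (hecke_relations q)"

lemma ideal_hecke_ideal: "ideal (hecke_ideal q) free_ring"
  by (rule ring.genideal_ideal[OF ring_free_ring]) (simp add: free_ring_def)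

lemma ring_hecke: "ring (hecke q)"
  unfolding hecke_def by (rule ideal.quotient_is_ring[OF ideal_hecke_ideal])

lemma hecke_class_hom: "hecke_class q \<in> ring_hom free_ring (hecke q)"
  using ideal.rcos_ring_hom[OF ideal_hecke_ideal] unfolding hecke_class_def hecke_def by simp

lemma carrier_hecke: "carrier (hecke q) = range (hecke_class q)"
  unfolding hecke_def hecke_class_def FactRing_def A_RCOSETS_def'
  by (auto simp: A_RCOSETS_def' free_ring_def)

lemma hecke_class_closed [simp, intro]: "hecke_class q x \<in> carrier (hecke q)"
  by (simp add: carrier_hecke)

lemma hecke_class_add: "hecke_class q (x + y) = hecke_class q x \<oplus>\<^bsub>hecke q\<^esub> hecke_class q y"
  using ring_hom_add[OF hecke_class_hom, of x y] by (simp add: free_ring_def)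

lemma hecke_class_mult: "hecke_class q (x * y) = hecke_class q x \<otimes>\<^bsub>hecke q\<^esub> hecke_class q y"
  using ring_hom_mult[OF hecke_class_hom, of x y] by (simp add: free_ring_def)

lemma hecke_class_one: "hecke_class q 1 = \<one>\<^bsub>hecke q\<^esub>"
  using ring_hom_one[OF hecke_class_hom] by (simp add: free_ring_def)

lemma hecke_class_zero: "hecke_class q 0 = \<zero>\<^bsub>hecke q\<^esub>"
  using ring_hom_zero[OF hecke_class_hom ring_free_ring ring_hecke] by (simp add: free_ring_def)

lemma hecke_class_minus: "hecke_class q (- x) = \<ominus>\<^bsub>hecke q\<^esub> hecke_class q x"
proof -
  interpret ring "hecke q" by (rule ring_hecke)
  have "hecke_class q (- x) \<oplus>\<^bsub>hecke q\<^esub> hecke_class q x = \<zero>\<^bsub>hecke q\<^esub>"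
    by (simp add: hecke_class_add[symmetric] hecke_class_zero)
  then show ?thesis
    by (metis hecke_class_closed minus_equality)
qed

lemma hecke_class_eqI:
  assumes "x - y \<in> hecke_relations q"
  shows "hecke_class q x = hecke_class q y"
proof -
  interpret ideal "hecke_ideal q" free_ring by (rule ideal_hecke_ideal)
  have "x - y \<in> hecke_ideal q"
    using ring.genideal_self[OF ring_free_ring, of "hecke_relations q"] assms
    by (auto simp: free_ring_def)
  then have "x \<in> hecke_ideal q +>\<^bsub>free_ring\<^esub> y"
    using a_rcos_module_rev[of y x] by (simp add: a_inv_free_ring) (simp add: free_ring_def)
  then show ?thesis
    unfolding hecke_class_def using a_repr_independence' by (simp add: free_ring_def)
qed

text \<open>The hypotheses on \<open>I\<close> hold for the annihilator of a representation of the free algebra that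
  satisfies the relations; this is how elements of the Hecke algebra are seen to differ.\<close>

lemma hecke_class_eqD:
  assumes "hecke_class q x = hecke_class q y" and "ideal I free_ring" and "hecke_relations q \<subseteq> I"
  shows "x - y \<in> I"
proof -
  interpret ideal "hecke_ideal q" free_ring by (rule ideal_hecke_ideal)
  have "x \<in> hecke_ideal q +>\<^bsub>free_ring\<^esub> y"
    using a_rcos_self[of x] assms(1) by (simp add: hecke_class_def free_ring_def)
  then have "x - y \<in> hecke_ideal q"
    using a_rcos_module_imp[of y x] by (simp add: a_inv_free_ring) (simp add: free_ring_def)
  then show ?thesis
    using ring.genideal_minimal[OF ring_free_ring assms(2,3)] by blast
qed

subsection \<open>Induction over the free algebra\<close>

lemma poly_mapping_expand: "x = (\<Sum>k\<in>Poly_Mapping.keys x. Poly_Mapping.single k (Poly_Mapping.lookup x k))"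
  by (rule poly_mapping_eqI)
    (simp add: lookup_sum lookup_single when_def in_keys_iff)

lemma poly_mapping_induct_add [case_names zero single add]:
  fixes x :: "'k \<Rightarrow>\<^sub>0 'v::comm_monoid_add"
  assumes "P 0" "\<And>k v. P (Poly_Mapping.single k v)" "\<And>x y. P x \<Longrightarrow> P y \<Longrightarrow> P (x + y)"
  shows "P x"
proof -
  have "P (\<Sum>k\<in>A. Poly_Mapping.single k (Poly_Mapping.lookup x k))" if "finite A" for A
    using that by (induction A) (simp_all add: assms)
  then show ?thesis
    by (subst poly_mapping_expand) simp
qed

lemma single_word:
  "Poly_Mapping.single (Word gs) a =
     free_const a * foldr (\<lambda>s x. Poly_Mapping.single (Word [s]) 1 * x) gs 1"
proof -
  have "foldr (\<lambda>s x. Poly_Mapping.single (Word [s]) 1 * x) gs 1 = Poly_Mapping.single (Word gs) (1::complex)"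
    by (induction gs) (simp_all add: mult_single zero_word_def[symmetric])
  then show ?thesis
    by (simp add: mult_single)
qed

lemma free_algebra_induct [case_names const generator add mult]:
  fixes x :: free_algebra
  assumes const: "\<And>a. P (free_const a)" and gen: "\<And>s. P (Poly_Mapping.single (Word [s]) 1)"
    and add: "\<And>x y. P x \<Longrightarrow> P y \<Longrightarrow> P (x + y)" and mult: "\<And>x y. P x \<Longrightarrow> P y \<Longrightarrow> P (x * y)"
  shows "P x"
proof (induction x rule: poly_mapping_induct_add)
  case zero
  then show ?case using const[of 0] by simp
next
  case (single w a)
  obtain gs where w: "w = Word gs" by (cases w)
  have "P (foldr (\<lambda>s x. Poly_Mapping.single (Word [s]) 1 * x) gs 1)"
    by (induction gs) (use const[of 1] gen mult in simp_all)
  then show ?case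
    by (subst w, subst single_word) (rule mult[OF const])
qed (rule add)

lemma free_const_commute: "free_const a * x = x * free_const a"
  by (induction x rule: poly_mapping_induct_add)
    (simp_all add: mult_single mult.commute distrib_left distrib_right)

lemma free_poly_superset:
  assumes "finite A" "Poly_Mapping.keys f \<subseteq> A"
  shows "free_poly f = (\<Sum>\<mu>\<in>A. free_const (Poly_Mapping.lookup f \<mu>) * free_X \<mu>)"
  unfolding free_poly_def by (rule sum.mono_neutral_left) (use assms in \<open>auto simp: in_keys_iff\<close>)

lemma free_poly_add: "free_poly (f + h) = free_poly f + free_poly h"
proof -
  let ?A = "Poly_Mapping.keys f \<union> Poly_Mapping.keys h"
  have "Poly_Mapping.keys (f + h) \<subseteq> ?A"
    by (rule keys_add)
  then show ?thesis
    using free_poly_superset[of ?A f] free_poly_superset[of ?A h] free_poly_superset[of ?A "f + h"]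
    by (simp add: lookup_add single_add distrib_right sum.distrib)
qed

lemma free_poly_single: "free_poly (Poly_Mapping.single \<mu> a) = free_const a * free_X \<mu>"
  by (cases "a = 0") (simp_all add: free_poly_def)

section \<open>Modules over the Hecke algebra\<close>

locale hecke_module = left_module "hecke q" L for q :: complex and L :: "(hecke_elt, 'b) module"
begin

abbreviation scal :: "complex \<Rightarrow> 'b \<Rightarrow> 'b" where "scal a x \<equiv> hecke_const q a \<odot>\<^bsub>L\<^esub> x"
abbreviation TT :: "node \<Rightarrow> 'b \<Rightarrow> 'b" where "TT i x \<equiv> hecke_T q i \<odot>\<^bsub>L\<^esub> x"
abbreviation XX :: "lattice \<Rightarrow> 'b \<Rightarrow> 'b" where "XX \<mu> x \<equiv> hecke_X q \<mu> \<odot>\<^bsub>L\<^esub> x"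

lemmas class_defs = hecke_const_def hecke_T_def hecke_X_def

lemma class_smult_closed [simp, intro]: "x \<in> carrier L \<Longrightarrow> hecke_class q h \<odot>\<^bsub>L\<^esub> x \<in> carrier L"
  by (rule smult_closed[OF hecke_class_closed])

lemma op_closed [simp, intro]:
  assumes "x \<in> carrier L"
  shows "scal a x \<in> carrier L" "TT i x \<in> carrier L" "XX \<mu> x \<in> carrier L"
  using assms by (simp_all add: class_defs)

lemma op_add:
  assumes "x \<in> carrier L" "y \<in> carrier L"
  shows "scal a (x \<oplus>\<^bsub>L\<^esub> y) = scal a x \<oplus>\<^bsub>L\<^esub> scal a y"
    "TT i (x \<oplus>\<^bsub>L\<^esub> y) = TT i x \<oplus>\<^bsub>L\<^esub> TT i y" "XX \<mu> (x \<oplus>\<^bsub>L\<^esub> y) = XX \<mu> x \<oplus>\<^bsub>L\<^esub> XX \<mu> y"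
  using assms by (simp_all add: class_defs smult_r_distr)

lemma class_scal:
  "x \<in> carrier L \<Longrightarrow> hecke_class q h \<odot>\<^bsub>L\<^esub> scal a x = scal a (hecke_class q h \<odot>\<^bsub>L\<^esub> x)"
  by (simp add: hecke_const_def smult_assoc[symmetric] hecke_class_mult[symmetric] free_const_commute)

lemma op_scal:
  assumes "x \<in> carrier L"
  shows "TT i (scal a x) = scal a (TT i x)" "XX \<mu> (scal a x) = scal a (XX \<mu> x)"
  using assms by (simp_all add: class_scal hecke_T_def hecke_X_def)

lemma scal_scal: "x \<in> carrier L \<Longrightarrow> scal a (scal b x) = scal (a * b) x"
  by (simp add: class_defs smult_assoc[symmetric] hecke_class_mult[symmetric] mult_single)

lemma scal_add: "x \<in> carrier L \<Longrightarrow> scal (a + b) x = scal a x \<oplus>\<^bsub>L\<^esub> scal b x"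
  by (simp add: class_defs smult_l_distr[symmetric] hecke_class_add[symmetric] single_add)

lemma scal_zero [simp]: "x \<in> carrier L \<Longrightarrow> scal 0 x = \<zero>\<^bsub>L\<^esub>"
  by (simp add: hecke_const_def hecke_class_zero smult_zero_left)

lemma scal_one [simp]: "x \<in> carrier L \<Longrightarrow> scal 1 x = x"
  by (simp add: hecke_const_def hecke_class_one smult_one)

lemma op_zero [simp]: "scal a \<zero>\<^bsub>L\<^esub> = \<zero>\<^bsub>L\<^esub>" "TT i \<zero>\<^bsub>L\<^esub> = \<zero>\<^bsub>L\<^esub>" "XX \<mu> \<zero>\<^bsub>L\<^esub> = \<zero>\<^bsub>L\<^esub>"
  by (simp_all add: class_defs smult_zero_right)

lemma scal_minus_one: "x \<in> carrier L \<Longrightarrow> scal (- 1) x = \<ominus>\<^bsub>L\<^esub> x"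
  using neg_one_smult[of x] unfolding hecke_const_def
  by (simp add: single_uminus hecke_class_minus hecke_class_one)

lemma scal_eq_zero_iff:
  assumes "x \<in> carrier L"
  shows "scal a x = \<zero>\<^bsub>L\<^esub> \<longleftrightarrow> a = 0 \<or> x = \<zero>\<^bsub>L\<^esub>"
proof -
  have "x = scal (inverse a) (scal a x)" if "a \<noteq> 0"
    using that assms by (simp add: scal_scal)
  then show ?thesis using assms by (metis op_zero(1) scal_zero)
qed

lemma smult_eqI:
  "\<lbrakk>h - k \<in> hecke_relations q; x \<in> carrier L\<rbrakk> \<Longrightarrow> hecke_class q h \<odot>\<^bsub>L\<^esub> x = hecke_class q k \<odot>\<^bsub>L\<^esub> x"
  by (simp add: hecke_class_eqI)

lemma class_smult_add:
  "x \<in> carrier L \<Longrightarrow> hecke_class q (h + k) \<odot>\<^bsub>L\<^esub> x = hecke_class q h \<odot>\<^bsub>L\<^esub> x \<oplus>\<^bsub>L\<^esub> hecke_class q k \<odot>\<^bsub>L\<^esub> x"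
  by (simp add: hecke_class_add smult_l_distr)

lemma class_smult_mult:
  "x \<in> carrier L \<Longrightarrow> hecke_class q (h * k) \<odot>\<^bsub>L\<^esub> x = hecke_class q h \<odot>\<^bsub>L\<^esub> (hecke_class q k \<odot>\<^bsub>L\<^esub> x)"
  by (simp add: hecke_class_mult smult_assoc)

lemma XX_zero: "x \<in> carrier L \<Longrightarrow> XX 0 x = x"
  using smult_eqI[of "free_X 0" 1 x]
  by (simp add: hecke_X_def hecke_relations_def hecke_class_one smult_one)

lemma XX_XX:
  assumes "x \<in> carrier L"
  shows "XX \<mu> (XX \<nu> x) = XX (\<mu> + \<nu>) x"
proof -
  have "free_X \<mu> * free_X \<nu> - free_X (\<mu> + \<nu>) \<in> hecke_relations q"
    unfolding hecke_relations_def by blast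
  from smult_eqI[OF this assms] assms show ?thesis
    by (simp only: hecke_X_def class_smult_mult)
qed

lemma TT_TT: "x \<in> carrier L \<Longrightarrow> TT i (TT i x) = scal (q - inverse q) (TT i x) \<oplus>\<^bsub>L\<^esub> x"
  using smult_eqI[of "free_T i * free_T i" "free_const (q - inverse q) * free_T i + 1" x]
  by (auto simp: hecke_T_def hecke_const_def hecke_relations_def class_smult_mult class_smult_add
      hecke_class_one smult_one)

lemma braid: "x \<in> carrier L \<Longrightarrow> TT N1 (TT N2 (TT N1 (TT N2 x))) = TT N2 (TT N1 (TT N2 (TT N1 x)))"
  using smult_eqI[of "free_T N1 * free_T N2 * free_T N1 * free_T N2"
      "free_T N2 * free_T N1 * free_T N2 * free_T N1" x]
  by (auto simp: hecke_T_def hecke_relations_def class_smult_mult mult.assoc)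

lemma bernstein:
  assumes "f * (1 - X_pow (- simple_root i)) = X_pow \<mu> - X_pow (reflection i \<mu>)" "x \<in> carrier L"
  shows "XX \<mu> (TT i x) =
    TT i (XX (reflection i \<mu>) x) \<oplus>\<^bsub>L\<^esub> scal (q - inverse q) (hecke_poly q f \<odot>\<^bsub>L\<^esub> x)"
proof -
  have "free_X \<mu> * free_T i - (free_T i * free_X (reflection i \<mu>) +
      free_const (q - inverse q) * free_poly f) \<in> hecke_relations q"
    unfolding hecke_relations_def using assms(1) by blast
  from smult_eqI[OF this assms(2)] assms(2) show ?thesis
    by (simp only: hecke_T_def hecke_X_def hecke_const_def hecke_poly_def class_smult_mult
        class_smult_add)
qed

lemma hecke_poly_single: "x \<in> carrier L \<Longrightarrow> hecke_poly q (Poly_Mapping.single \<nu> a) \<odot>\<^bsub>L\<^esub> x = scal a (XX \<nu> x)"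
  by (cases "a = 0") (simp_all add: hecke_poly_def free_poly_def hecke_const_def hecke_X_def
      class_smult_mult[symmetric] hecke_class_zero smult_zero_left)

text \<open>On the basis \<open>\<omega>\<^sub>1\<close>, \<open>s\<^sub>1 \<omega>\<^sub>1\<close> of the lattice and its negative, the fraction is a scalar
  multiple of a monomial, and these cases suffice for computations inside a module.\<close>

lemma bernstein_single:
  assumes "Poly_Mapping.single \<nu> a * (1 - X_pow (- simple_root i)) = X_pow \<mu> - X_pow (reflection i \<mu>)"
    and "x \<in> carrier L"
  shows "XX \<mu> (TT i x) = TT i (XX (reflection i \<mu>) x) \<oplus>\<^bsub>L\<^esub> scal ((q - inverse q) * a) (XX \<nu> x)"
  using bernstein[OF assms] assms(2) by (simp add: hecke_poly_single scal_scal)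

lemma submodule_hecke:
  assumes "N \<subseteq> carrier L" "\<zero>\<^bsub>L\<^esub> \<in> N" "\<And>x y. \<lbrakk>x \<in> N; y \<in> N\<rbrakk> \<Longrightarrow> x \<oplus>\<^bsub>L\<^esub> y \<in> N"
    and "\<And>a x. x \<in> N \<Longrightarrow> scal a x \<in> N" "\<And>i x. x \<in> N \<Longrightarrow> TT i x \<in> N" "\<And>\<mu> x. x \<in> N \<Longrightarrow> XX \<mu> x \<in> N"
  shows "submodule N (hecke q) L"
proof (rule submoduleI)
  have "hecke_class q h \<odot>\<^bsub>L\<^esub> x \<in> N" if "x \<in> N" for h x
    using that
  proof (induction h arbitrary: x rule: free_algebra_induct)
    case (const a)
    then show ?case using assms(4) by (simp add: hecke_const_def)
  next
    case (generator s)
    then show ?case using assms(5,6) by (cases s) (simp_all add: hecke_T_def hecke_X_def)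
  next
    case (add h k)
    have "x \<in> carrier L" using assms(1) add.prems by blast
    then show ?case
      using assms(3) add by (simp add: class_smult_add)
  next
    case (mult h k)
    have "x \<in> carrier L" using assms(1) mult.prems by blast
    then show ?case
      using mult by (simp add: class_smult_mult)
  qed
  then show "\<And>a x. \<lbrakk>a \<in> carrier (hecke q); x \<in> N\<rbrakk> \<Longrightarrow> a \<odot>\<^bsub>L\<^esub> x \<in> N"
    by (auto simp: carrier_hecke)
qed (use assms in auto)

end

lemma hecke_module_iff: "hecke_module q L \<longleftrightarrow> left_module (hecke q) L"
  by (simp add: hecke_module_def)

section \<open>Coordinates on modules\<close>

text \<open>Linear operators for the generators extend uniquely to the free algebra. Working with the free
  algebra first makes \<open>act\<close> available before any relation has been checked; once the relations hold,
  \<open>act_factors\<close> says that it depends only on the class in the Hecke algebra.\<close>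

locale generator_action = vector_space scale
  for scale :: "complex \<Rightarrow> 'c::ab_group_add \<Rightarrow> 'c" +
  fixes g :: "generator \<Rightarrow> 'c \<Rightarrow> 'c"
  assumes g_add: "g s (c + d) = g s c + g s d"
    and g_scale: "g s (scale a c) = scale a (g s c)"
begin

fun word_act :: "word \<Rightarrow> 'c \<Rightarrow> 'c" where
  "word_act (Word gs) c = foldr g gs c"

definition act :: "free_algebra \<Rightarrow> 'c \<Rightarrow> 'c" where
  "act x c = (\<Sum>w\<in>Poly_Mapping.keys x. scale (Poly_Mapping.lookup x w) (word_act w c))"

lemma word_act_add: "word_act w (c + d) = word_act w c + word_act w d"
proof (cases w)
  case (Word gs)
  show ?thesis unfolding Word by (induction gs) (simp_all add: g_add)
qed

lemma word_act_scale: "word_act w (scale a c) = scale a (word_act w c)"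
proof (cases w)
  case (Word gs)
  show ?thesis unfolding Word by (induction gs) (simp_all add: g_scale)
qed

lemma word_act_plus: "word_act (v + w) c = word_act v (word_act w c)"
  by (cases v; cases w) simp

lemma act_superset:
  assumes "finite A" "Poly_Mapping.keys x \<subseteq> A"
  shows "act x c = (\<Sum>w\<in>A. scale (Poly_Mapping.lookup x w) (word_act w c))"
  unfolding act_def by (rule sum.mono_neutral_left) (use assms in \<open>auto simp: in_keys_iff\<close>)

lemma act_add: "act (x + y) c = act x c + act y c"
proof -
  let ?A = "Poly_Mapping.keys x \<union> Poly_Mapping.keys y"
  have "Poly_Mapping.keys (x + y) \<subseteq> ?A"
    by (rule keys_add)
  then show ?thesis
    using act_superset[of ?A x c] act_superset[of ?A y c] act_superset[of ?A "x + y" c]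
    by (simp add: lookup_add scale_left_distrib sum.distrib)
qed

lemma act_single: "act (Poly_Mapping.single w a) c = scale a (word_act w c)"
  unfolding act_def by simp

lemma act_zero: "act 0 c = 0"
  unfolding act_def by simp

lemma act_minus: "act (- x) c = - act x c"
  using act_add[of x "- x" c] by (simp add: act_zero minus_unique)

lemma act_diff: "act (x - y) c = act x c - act y c"
  using act_add[of x "- y" c] by (simp add: act_minus)

lemma act_right_add: "act x (c + d) = act x c + act x d"
  unfolding act_def by (simp add: word_act_add scale_right_distrib sum.distrib)

lemma act_right_scale: "act x (scale a c) = scale a (act x c)"
  unfolding act_def by (simp add: word_act_scale scale_sum_right mult.commute)

lemma act_right_zero: "act x 0 = 0"
  using act_right_scale[of x 0 0] by simp

lemma act_mult: "act (x * y) c = act x (act y c)"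
proof (induction x rule: poly_mapping_induct_add)
  case zero
  then show ?case by (simp add: act_zero)
next
  case (single v a)
  show ?case
  proof (induction y rule: poly_mapping_induct_add)
    case zero
    then show ?case by (simp add: act_zero act_right_zero)
  next
    case (single w b)
    then show ?case by (simp add: mult_single act_single word_act_plus word_act_scale)
  next
    case (add y z)
    then show ?case by (simp add: distrib_left act_add act_right_add)
  qed
next
  case (add x y)
  then show ?case by (simp add: distrib_right act_add)
qed

lemma act_generator: "act (Poly_Mapping.single (Word [s]) 1) c = g s c"
  by (simp add: act_single)

lemma act_const: "act (free_const a) c = scale a c"
  by (simp add: act_single zero_word_def)

lemma ideal_annihilator: "ideal {x. \<forall>c. act x c = 0} free_ring"
proof (rule idealI[OF ring_free_ring])
  show "subgroup {x. \<forall>c. act x c = 0} (add_monoid free_ring)"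
  proof (rule subgroup.intro)
    show "inv\<^bsub>add_monoid free_ring\<^esub> x \<in> {x. \<forall>c. act x c = 0}" if "x \<in> {x. \<forall>c. act x c = 0}" for x
      using that a_inv_free_ring[of x] by (simp add: a_inv_def act_minus)
  qed (simp_all add: free_ring_def act_add act_zero)
  show "x \<otimes>\<^bsub>free_ring\<^esub> a \<in> {x. \<forall>c. act x c = 0}" "a \<otimes>\<^bsub>free_ring\<^esub> x \<in> {x. \<forall>c. act x c = 0}"
    if "a \<in> {x. \<forall>c. act x c = 0}" "x \<in> carrier free_ring" for a x
    using that by (auto simp: free_ring_def act_mult act_right_zero)
qed

lemma act_factors:
  assumes "\<And>r c. r \<in> hecke_relations q \<Longrightarrow> act r c = 0" and "hecke_class q x = hecke_class q y"
  shows "act x c = act y c"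
  using hecke_class_eqD[OF assms(2) ideal_annihilator] assms(1) by (auto simp: act_diff)

lemma act_in_subspace:
  assumes "subspace U" "\<And>s c. c \<in> U \<Longrightarrow> g s c \<in> U" "c \<in> U"
  shows "act x c \<in> U"
  using assms(3)
proof (induction x arbitrary: c rule: free_algebra_induct)
  case (const a)
  then show ?case using subspace_scale[OF assms(1)] by (simp add: act_const)
next
  case (generator s)
  then show ?case using assms(2) by (simp add: act_generator)
next
  case (add x y)
  then show ?case using subspace_add[OF assms(1)] by (simp add: act_add)
next
  case (mult x y)
  then show ?case by (simp add: act_mult)
qed

end

text \<open>A module lives on a carrier set, where computations are laborious. An equivariant map \<open>J\<close> from a
  vector space \<open>'c\<close> that is a type moves them to \<open>'c\<close>. The map may have a kernel: the same coordinates
  serve for a module and for its quotients.\<close>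

locale coordinates = generator_action scale g + L: hecke_module q L
  for scale :: "complex \<Rightarrow> 'c::ab_group_add \<Rightarrow> 'c" and g and q :: complex and L :: "(hecke_elt, 'b) module" +
  fixes J :: "'c \<Rightarrow> 'b"
  assumes J_closed [simp, intro]: "J c \<in> carrier L"
    and J_add: "J (c + d) = J c \<oplus>\<^bsub>L\<^esub> J d"
    and J_scale: "J (scale a c) = hecke_const q a \<odot>\<^bsub>L\<^esub> J c"
    and J_T: "J (g (T i) c) = hecke_T q i \<odot>\<^bsub>L\<^esub> J c"
    and J_X: "J (g (X \<mu>) c) = hecke_X q \<mu> \<odot>\<^bsub>L\<^esub> J c"
begin

lemma J_zero: "J 0 = \<zero>\<^bsub>L\<^esub>"
  using J_scale[of 0 0] by simp

lemma J_minus: "J (- c) = \<ominus>\<^bsub>L\<^esub> J c"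
  using J_add[of "- c" c] by (simp add: J_zero) (metis J_closed L.M.minus_equality)

lemma J_diff: "J (c - d) = J c \<ominus>\<^bsub>L\<^esub> J d"
  using J_add[of c "- d"] by (simp add: J_minus L.M.minus_eq)

lemma J_eq_iff: "J c = J d \<longleftrightarrow> J (c - d) = \<zero>\<^bsub>L\<^esub>"
proof
  assume "J (c - d) = \<zero>\<^bsub>L\<^esub>"
  then show "J c = J d"
    using J_add[of "c - d" d] by simp
qed (simp add: J_diff L.M.minus_eq L.M.r_neg)

lemma J_act: "J (act x c) = hecke_class q x \<odot>\<^bsub>L\<^esub> J c"
proof (induction x arbitrary: c rule: free_algebra_induct)
  case (const a)
  then show ?case by (simp add: act_const J_scale hecke_const_def)
next
  case (generator s)
  then show ?case
    by (cases s) (simp_all add: act_generator J_T J_X hecke_T_def hecke_X_def del: act_single)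
next
  case (add x y)
  then show ?case by (simp add: act_add J_add L.class_smult_add)
next
  case (mult x y)
  then show ?case by (simp add: act_mult L.class_smult_mult)
qed

lemma submodule_image:
  assumes "subspace U" "\<And>s c. c \<in> U \<Longrightarrow> g s c \<in> U"
  shows "submodule (J ` U) (hecke q) L"
proof (rule L.submoduleI)
  show "J ` U \<subseteq> carrier L" by auto
  show "\<zero>\<^bsub>L\<^esub> \<in> J ` U"
    using subspace_0[OF assms(1)] J_zero by (metis imageI)
  show "x \<oplus>\<^bsub>L\<^esub> y \<in> J ` U" if "x \<in> J ` U" "y \<in> J ` U" for x y
    using that subspace_add[OF assms(1)] by (auto simp: J_add[symmetric])
  show "a \<odot>\<^bsub>L\<^esub> x \<in> J ` U" if "a \<in> carrier (hecke q)" "x \<in> J ` U" for a x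
    using that act_in_subspace[OF assms] by (auto simp: carrier_hecke J_act[symmetric])
qed

lemma submodule_range: "submodule (range J) (hecke q) L"
  by (rule submodule_image) simp_all

lemma coordinates_quotient:
  assumes "submodule N (hecke q) L"
  shows "coordinates scale g q (quotient_module L N) (\<lambda>c. N +>\<^bsub>L\<^esub> J c)"
proof -
  note quot = quotient_module[OF L.left_module_axioms assms]
  interpret Q: hecke_module q "quotient_module L N"
    unfolding hecke_module_iff by (rule quot(1))
  show ?thesis
    by unfold_locales
      (simp_all add: quot(2-5) J_add J_scale J_T J_X hecke_const_def hecke_T_def hecke_X_def)
qed

text \<open>Both modules are the quotient of \<open>'c\<close> by the common kernel, so the isomorphism is \<open>J c \<mapsto> J' c\<close>.\<close>

lemma isomorphic_if_same_kernel:
  assumes "coordinates scale g q L' J'"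
    and surj: "range J = carrier L" "range J' = carrier L'"
    and ker: "\<And>c. J c = \<zero>\<^bsub>L\<^esub> \<longleftrightarrow> J' c = \<zero>\<^bsub>L'\<^esub>"
  shows "module_isomorphic (hecke q) L L'"
proof -
  interpret J': coordinates scale g q L' J' by fact
  have eq: "J c = J d \<longleftrightarrow> J' c = J' d" for c d
    using J_eq_iff[of c d] J'.J_eq_iff[of c d] ker by simp
  define f where "f x = J' (SOME c. J c = x)" for x
  have f_J: "f (J c) = J' c" for c
    unfolding f_def using eq someI[of "\<lambda>d. J d = J c" c] by simp
  have "bij_betw f (carrier L) (carrier L')"
    unfolding bij_betw_def
  proof
    show "inj_on f (carrier L)"
      by (rule inj_onI) (auto simp: surj(1)[symmetric] f_J eq)
    show "f ` carrier L = carrier L'"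
      by (auto simp: surj(1)[symmetric] surj(2)[symmetric] f_J image_image)
  qed
  moreover have "f (x \<oplus>\<^bsub>L\<^esub> y) = f x \<oplus>\<^bsub>L'\<^esub> f y" if "x \<in> carrier L" "y \<in> carrier L" for x y
    using that by (auto simp: surj(1)[symmetric] f_J J_add[symmetric] J'.J_add[symmetric])
  moreover have "f (a \<odot>\<^bsub>L\<^esub> x) = a \<odot>\<^bsub>L'\<^esub> f x" if "a \<in> carrier (hecke q)" "x \<in> carrier L" for a x
    using that by (auto simp: carrier_hecke surj(1)[symmetric] f_J J_act[symmetric] J'.J_act[symmetric])
  ultimately show ?thesis
    unfolding module_isomorphic_def by blast
qed

end

section \<open>Characters of the weight lattice\<close>

lemma reflection_simps [simp]:
  "reflection N1 (a, b) = (- a, a + b)" "reflection N2 (a, b) = (a + 2 * b, - b)"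
  by (simp_all add: reflection_def int_scale_def)

lemma fst_reflection [simp]:
  "fst (reflection N1 \<mu>) = - fst \<mu>" "fst (reflection N2 \<mu>) = fst \<mu> + 2 * snd \<mu>"
  by (cases \<mu>; simp)+

lemma reflection_involution [simp]: "reflection i (reflection i \<mu>) = \<mu>"
  by (cases i; cases \<mu>) simp_all

lemma reflection_add: "reflection i (\<mu> + \<nu>) = reflection i \<mu> + reflection i \<nu>"
  by (cases i; cases \<mu>; cases \<nu>) simp_all

lemma longest_element_eq: "longest_element \<mu> = - \<mu>"
  by (cases \<mu>) (simp add: longest_element_def)

lemma weyl_act_reflection: "weyl_act (reflection i) t = (\<lambda>\<mu>. t (reflection i \<mu>))"
proof -
  have "inv_into UNIV (reflection i) = reflection i"
    by (rule inv_equality) simp_all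
  then show ?thesis by (simp add: weyl_act_def)
qed

lemma weyl_act_reflection2:
  "weyl_act (reflection i \<circ> reflection j) t = (\<lambda>\<mu>. t (reflection j (reflection i \<mu>)))"
proof -
  have "inv_into UNIV (reflection i \<circ> reflection j) = reflection j \<circ> reflection i"
    by (rule inv_equality) simp_all
  then show ?thesis by (simp add: weyl_act_def)
qed

lemma weyl_act_longest: "weyl_act longest_element t = (\<lambda>\<mu>. t (- \<mu>))"
proof -
  have "inv_into UNIV longest_element = uminus"
    by (rule inv_equality) (simp_all add: longest_element_eq)
  then show ?thesis by (simp add: weyl_act_def)
qed

text \<open>The lattice is generated by \<open>\<omega>\<^sub>1\<close> and \<open>s\<^sub>1 \<omega>\<^sub>1\<close>. This basis is adapted to the Weyl group:
  \<open>s\<^sub>1\<close> exchanges its members, and \<open>s\<^sub>2\<close> changes the sign of the second one.\<close>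

lemma lattice_induct [case_names fst_basis snd_basis add uminus]:
  fixes \<mu> :: lattice
  assumes a: "P (1, 0)" and b: "P (- 1, 1)"
    and add: "\<And>\<mu> \<nu>. P \<mu> \<Longrightarrow> P \<nu> \<Longrightarrow> P (\<mu> + \<nu>)" and uminus: "\<And>\<mu>. P \<mu> \<Longrightarrow> P (- \<mu>)"
  shows "P \<mu>"
proof -
  have zero: "P (0, 0)"
    using add[OF a uminus[OF a]] by simp
  have mult: "P (n * x, n * y)" if "P (x, y)" for n x y :: int
  proof (induction n rule: int_induct[where k = 0])
    case base
    then show ?case using zero by simp
  next
    case (step1 i)
    then show ?case using add[OF step1(2) that] by (simp add: algebra_simps)
  next
    case (step2 i)
    then show ?case using add[OF step2(2) uminus[OF that]] by (simp add: algebra_simps)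
  qed
  obtain m n where \<mu>: "\<mu> = (m, n)" by (cases \<mu>)
  have "P (((m + n) * 1, (m + n) * 0) + (n * - 1, n * 1))"
    by (rule add[OF mult[OF a] mult[OF b]])
  then show ?thesis unfolding \<mu> by simp
qed

lemma torus_zero: "t \<in> torus \<Longrightarrow> t 0 = 1"
  unfolding torus_def by (metis (mono_tags, lifting) add.left_neutral mem_Collect_eq mult_cancel_right1)

lemma torus_add: "t \<in> torus \<Longrightarrow> t (\<mu> + \<nu>) = t \<mu> * t \<nu>"
  unfolding torus_def by blast

lemma torus_nonzero: "t \<in> torus \<Longrightarrow> t \<mu> \<noteq> 0"
  unfolding torus_def by blast

lemma torus_uminus: "t \<in> torus \<Longrightarrow> t (- \<mu>) = inverse (t \<mu>)"
  using torus_add[of t "- \<mu>" \<mu>] torus_zero[of t] torus_nonzero[of t \<mu>] by (simp add: field_simps)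

lemma torus_diff: "t \<in> torus \<Longrightarrow> t (\<mu> - \<nu>) = t \<mu> / t \<nu>"
  using torus_add[of t \<mu> "- \<nu>"] torus_uminus[of t \<nu>] by (simp add: field_simps)

lemma torus_eqI:
  assumes "s \<in> torus" "t \<in> torus" "s (1, 0) = t (1, 0)" "s (- 1, 1) = t (- 1, 1)"
  shows "s = t"
proof
  fix \<mu> show "s \<mu> = t \<mu>"
    by (induction \<mu> rule: lattice_induct) (simp_all add: assms torus_add torus_uminus)
qed

lemma torus_reflection: "t \<in> torus \<Longrightarrow> (\<lambda>\<mu>. t (reflection i \<mu>)) \<in> torus"
  by (simp add: torus_def reflection_add del: split_paired_All)

lemma torus_minus: "t \<in> torus \<Longrightarrow> (\<lambda>\<mu>. t (- \<mu>)) \<in> torus"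
  by (simp only: torus_def mem_Collect_eq minus_add_distrib simp_thms)

text \<open>The weights of the theorem. With \<open>a = t(X\<^sup>\<omega>\<^sup>1)\<close>, a square root of \<open>-1\<close>, the orbit of \<open>t\<close> has
  the four values \<open>(\<plusminus>a, \<plusminus>a)\<close> on the basis \<open>\<omega>\<^sub>1\<close>, \<open>s\<^sub>1 \<omega>\<^sub>1\<close>.\<close>

locale special_weight =
  fixes q :: complex and t :: "lattice \<Rightarrow> complex"
  assumes q: "q ^ 2 = -1" and t_torus: "t \<in> torus" and t_restricts: "restricts_to t 1 (q ^ 2)"
begin

definition t2 :: "lattice \<Rightarrow> complex" where "t2 \<mu> = t (reflection N2 \<mu>)"
definition t12 :: "lattice \<Rightarrow> complex" where "t12 \<mu> = t (reflection N2 (reflection N1 \<mu>))"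

lemma torus [simp]: "t \<in> torus" "t2 \<in> torus" "t12 \<in> torus"
proof -
  show t: "t \<in> torus" by (rule t_torus)
  show "t2 \<in> torus" unfolding t2_def by (rule torus_reflection[OF t])
  show "t12 \<in> torus"
    unfolding t12_def by (rule torus_reflection[OF torus_reflection[OF t]])
qed

lemma qq [simp]: "q * q = -1" "q * (q * x) = - x"
  using q by (simp_all add: power2_eq_square mult.assoc[symmetric])

lemma q_nonzero [simp]: "q \<noteq> 0"
  using q by auto

lemma inverse_q: "inverse q = - q"
  by (rule inverse_unique) simp

lemma q_diff: "q - inverse q = 2 * q"
  by (simp add: inverse_q)

lemma t_roots [simp]: "t (2, - 1) = 1" "t (- 2, 2) = - 1"
proof -
  have "t (int_scale 1 (simple_root N1) + int_scale 0 (simple_root N2)) = 1"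
    "t (int_scale 0 (simple_root N1) + int_scale 1 (simple_root N2)) = - 1"
    using t_restricts unfolding restricts_to_def by (simp_all add: q)
  then show "t (2, - 1) = 1" "t (- 2, 2) = - 1"
    by (simp_all add: int_scale_def)
qed

abbreviation \<iota> :: complex where "\<iota> \<equiv> t (1, 0)"

lemma t_omega2: "t (0, 1) = - 1"
  using torus_add[OF t_torus, of "(2, -1)" "(-2, 2)"] by simp

lemma \<iota>\<iota> [simp]: "\<iota> * \<iota> = - 1" "\<iota> * (\<iota> * x) = - x"
proof -
  show "\<iota> * \<iota> = - 1"
    using torus_add[OF t_torus, of "(1, 0)" "(1, 0)"] torus_add[OF t_torus, of "(2, -1)" "(0, 1)"]
    by (simp add: t_omega2)
  then show "\<iota> * (\<iota> * x) = - x"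
    by (simp add: mult.assoc[symmetric])
qed

lemma \<iota>_nonzero [simp]: "\<iota> \<noteq> 0"
  by (simp add: torus_nonzero)

lemma inverse_\<iota>: "inverse \<iota> = - \<iota>"
  by (rule inverse_unique) simp

lemma basis_values [simp]:
  "t (- 1, 1) = \<iota>" "t (- 1, 0) = - \<iota>" "t (1, - 1) = - \<iota>"
  "t2 (1, 0) = \<iota>" "t2 (- 1, 1) = - \<iota>" "t12 (1, 0) = - \<iota>" "t12 (- 1, 1) = \<iota>"
proof -
  show minus: "t (- 1, 0) = - \<iota>"
    using torus_uminus[OF t_torus, of "(1, 0)"] by (simp add: inverse_\<iota>)
  show b: "t (- 1, 1) = \<iota>"
    using torus_add[OF t_torus, of "(-1, 0)" "(0, 1)"] by (simp add: t_omega2 minus)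
  show b': "t (1, - 1) = - \<iota>"
    using torus_uminus[OF t_torus, of "(-1, 1)"] by (simp add: inverse_\<iota> b)
  show "t2 (1, 0) = \<iota>" "t2 (- 1, 1) = - \<iota>" "t12 (1, 0) = - \<iota>" "t12 (- 1, 1) = \<iota>"
    by (simp_all add: t2_def t12_def b b')
qed

lemma basis_values_neg [simp]:
  "t2 (- 1, 0) = - \<iota>" "t2 (1, - 1) = \<iota>" "t12 (- 1, 0) = \<iota>" "t12 (1, - 1) = - \<iota>"
  by (simp_all add: t2_def t12_def)

lemma weights_reflected [simp]:
  "t (reflection N1 \<mu>) = t \<mu>" "t (reflection N2 \<mu>) = t2 \<mu>"
  "t2 (reflection N1 \<mu>) = t12 \<mu>" "t2 (reflection N2 \<mu>) = t \<mu>"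
  "t12 (reflection N1 \<mu>) = t2 \<mu>" "t12 (reflection N2 \<mu>) = t (- \<mu>)"
proof -
  have "(\<lambda>\<mu>. t (reflection N1 \<mu>)) = t"
    by (rule torus_eqI) (simp_all add: torus_reflection)
  then show "t (reflection N1 \<mu>) = t \<mu>" by (rule fun_cong[where x = \<mu>])
  have "(\<lambda>\<mu>. t12 (reflection N2 \<mu>)) = (\<lambda>\<mu>. t (- \<mu>))"
    by (rule torus_eqI) (simp_all add: torus_reflection torus_minus)
  then show "t12 (reflection N2 \<mu>) = t (- \<mu>)" by (rule fun_cong[where x = \<mu>])
qed (simp_all add: t2_def t12_def)

lemma weights_root:
  "t2 (simple_root N1) = - 1" "t12 (simple_root N1) = - 1" "t (simple_root N2) = - 1"
  "t2 (simple_root N2) = - 1" "t12 (simple_root N2) = - 1"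
proof -
  have split: "simple_root N1 = (1, 0) - (-1, 1)" "simple_root N2 = (-1, 1) - (1, -1)"
    by simp_all
  show "t2 (simple_root N1) = - 1" "t12 (simple_root N1) = - 1" "t (simple_root N2) = - 1"
    "t2 (simple_root N2) = - 1" "t12 (simple_root N2) = - 1"
    unfolding split by (simp_all only: torus_diff[OF torus(1)] torus_diff[OF torus(2)]
        torus_diff[OF torus(3)] basis_values basis_values_neg) simp_all
qed

text \<open>Since \<open>w\<^sub>0 = -1\<close>, the weight \<open>w\<^sub>0 t\<close> is the inverse of \<open>t\<close>, and the values \<open>1\<close> and \<open>-1\<close> at the simple
  roots are their own inverses. On the basis \<open>\<omega>\<^sub>1\<close>, \<open>s\<^sub>1 \<omega>\<^sub>1\<close> both signs change.\<close>

lemma special_weight_longest: "special_weight q (\<lambda>\<mu>. t (- \<mu>))"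
proof
  show "restricts_to (\<lambda>\<mu>. t (- \<mu>)) 1 (q ^ 2)"
    unfolding restricts_to_def
  proof (intro allI)
    fix a b :: int
    have "t (- (int_scale a (simple_root N1) + int_scale b (simple_root N2))) =
        inverse (t (int_scale a (simple_root N1) + int_scale b (simple_root N2)))"
      by (simp only: torus_uminus[OF t_torus])
    also have "\<dots> = inverse (1 powi a * (q ^ 2) powi b)"
      using t_restricts unfolding restricts_to_def by metis
    also have "\<dots> = 1 powi a * (q ^ 2) powi b"
      by (simp add: q power_int_inverse[symmetric])
    finally show "t (- (int_scale a (simple_root N1) + int_scale b (simple_root N2))) =
        1 powi a * (q ^ 2) powi b" .
  qed
qed (simp_all add: q torus_minus)

lemma longest_weights:
  "special_weight.t2 (\<lambda>\<mu>. t (- \<mu>)) = t12" "special_weight.t12 (\<lambda>\<mu>. t (- \<mu>)) = t2"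
proof -
  interpret neg: special_weight q "\<lambda>\<mu>. t (- \<mu>)" by (rule special_weight_longest)
  show "neg.t2 = t12" "neg.t12 = t2"
    by (rule torus_eqI, simp_all)+
qed

end

section \<open>A four-dimensional representation\<close>

definition extend_linear :: "(lattice \<Rightarrow> complex) \<Rightarrow> group_algebra \<Rightarrow> complex" where
  "extend_linear e f = (\<Sum>\<mu>\<in>Poly_Mapping.keys f. Poly_Mapping.lookup f \<mu> * e \<mu>)"

lemma extend_linear_superset:
  assumes "finite A" "Poly_Mapping.keys f \<subseteq> A"
  shows "extend_linear e f = (\<Sum>\<mu>\<in>A. Poly_Mapping.lookup f \<mu> * e \<mu>)"
  unfolding extend_linear_def by (rule sum.mono_neutral_left) (use assms in \<open>auto simp: in_keys_iff\<close>)

lemma extend_linear_plus: "extend_linear e (f + h) = extend_linear e f + extend_linear e h"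
proof -
  let ?A = "Poly_Mapping.keys f \<union> Poly_Mapping.keys h"
  have "Poly_Mapping.keys (f + h) \<subseteq> ?A"
    by (rule keys_add)
  then show ?thesis
    using extend_linear_superset[of ?A f e] extend_linear_superset[of ?A h e]
      extend_linear_superset[of ?A "f + h" e]
    by (simp add: lookup_add distrib_right sum.distrib)
qed

lemma extend_linear_single: "extend_linear e (Poly_Mapping.single \<mu> a) = a * e \<mu>"
  unfolding extend_linear_def by simp

lemma extend_linear_diff: "extend_linear e (f - h) = extend_linear e f - extend_linear e h"
  using extend_linear_plus[of e "f - h" h] by simp

lemma extend_linear_shift: "extend_linear e (f * X_pow \<nu>) = extend_linear (\<lambda>\<mu>. e (\<mu> + \<nu>)) f"
proof (induction f rule: poly_mapping_induct_add)
  case zero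
  then show ?case by (simp add: extend_linear_def)
next
  case (single \<mu> a)
  then show ?case by (simp add: mult_single extend_linear_single)
next
  case (add f h)
  then show ?case by (simp add: distrib_right extend_linear_plus)
qed

text \<open>The fraction in the last family of relations enters a representation only through such
  functionals. For suitable \<open>e\<close> the following equation determines them, without any explicit formula
  for the fraction.\<close>

lemma extend_linear_fraction:
  assumes "f * (1 - X_pow (- \<alpha>)) = X_pow \<mu> - X_pow \<nu>"
  shows "extend_linear (\<lambda>\<kappa>. e \<kappa> - e (\<kappa> - \<alpha>)) f = e \<mu> - e \<nu>"
proof -
  have "extend_linear e (f * (1 - X_pow (- \<alpha>))) = extend_linear e f - extend_linear (\<lambda>\<kappa>. e (\<kappa> - \<alpha>)) f"
    by (simp add: right_diff_distrib extend_linear_diff extend_linear_shift)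
  also have "\<dots> = extend_linear (\<lambda>\<kappa>. e \<kappa> - e (\<kappa> - \<alpha>)) f"
    by (simp add: extend_linear_def right_diff_distrib sum_subtractf)
  finally show ?thesis
    by (simp add: assms extend_linear_diff extend_linear_single)
qed

type_synonym quad = "complex \<times> complex \<times> complex \<times> complex"

fun scale4 :: "complex \<Rightarrow> quad \<Rightarrow> quad" where
  "scale4 a (\<alpha>, \<beta>, \<gamma>, \<delta>) = (a * \<alpha>, a * \<beta>, a * \<gamma>, a * \<delta>)"

context special_weight
begin

text \<open>The operators of \<open>T\<^sub>1\<close>, \<open>T\<^sub>2\<close> and \<open>X\<^sup>\<mu>\<close> in coordinates with respect to \<open>v\<close>, \<open>w = T\<^sub>1 v\<close>,
  \<open>n = T\<^sub>2 w - q w - 2 v\<close> and \<open>m = T\<^sub>1 n - q n\<close>, where \<open>v\<close> is a vector of weight \<open>t\<close> with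
  \<open>T\<^sub>2 v = q v\<close>. The vectors \<open>n\<close> and \<open>m\<close> arise by applying
  intertwining operators to \<open>w\<close> and to \<open>n\<close>, so they have the weights \<open>s\<^sub>2 t\<close> and \<open>s\<^sub>1 s\<^sub>2 t\<close>. On the span of \<open>v\<close> and
  \<open>w\<close> the lattice acts by Jordan blocks, because \<open>s\<^sub>1\<close> fixes \<open>t\<close>.\<close>

fun gen4 :: "generator \<Rightarrow> quad \<Rightarrow> quad" where
  "gen4 (T N1) (\<alpha>, \<beta>, \<gamma>, \<delta>) = (\<beta>, \<alpha> + 2 * q * \<beta>, q * \<gamma>, \<gamma> + q * \<delta>)"
| "gen4 (T N2) (\<alpha>, \<beta>, \<gamma>, \<delta>) = (q * \<alpha> + 2 * \<beta>, q * \<beta>, \<beta> + q * \<gamma>, q * \<delta>)"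
| "gen4 (X \<mu>) (\<alpha>, \<beta>, \<gamma>, \<delta>) =
     (t \<mu> * \<alpha> + 2 * q * of_int (fst \<mu>) * t \<mu> * \<beta>, t \<mu> * \<beta>, t2 \<mu> * \<gamma>, t12 \<mu> * \<delta>)"

sublocale model: generator_action scale4 gen4
proof
  fix a b :: complex and x y :: quad and s :: generator
  obtain x1 x2 x3 x4 where x: "x = (x1, x2, x3, x4)" by (cases x)
  obtain y1 y2 y3 y4 where y: "y = (y1, y2, y3, y4)" by (cases y)
  show "scale4 a (x + y) = scale4 a x + scale4 a y" "scale4 (a + b) x = scale4 a x + scale4 b x"
    "scale4 a (scale4 b x) = scale4 (a * b) x" "scale4 1 x = x"
    unfolding x y by (simp_all add: algebra_simps)
  consider "s = T N1" | "s = T N2" | \<mu> where "s = X \<mu>"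
    by (metis generator.exhaust node.exhaust)
  then show "gen4 s (x + y) = gen4 s x + gen4 s y" "gen4 s (scale4 a x) = scale4 a (gen4 s x)"
    unfolding x y by (cases; simp add: algebra_simps)+
qed

lemma act_free_poly:
  "model.act (free_poly f) (\<alpha>, \<beta>, \<gamma>, \<delta>) =
    (extend_linear t f * \<alpha> + 2 * q * extend_linear (\<lambda>\<mu>. of_int (fst \<mu>) * t \<mu>) f * \<beta>,
     extend_linear t f * \<beta>, extend_linear t2 f * \<gamma>, extend_linear t12 f * \<delta>)"
proof -
  let ?f = "Poly_Mapping.lookup f"
  have sum: "model.act (\<Sum>\<mu>\<in>A. h \<mu>) c = (\<Sum>\<mu>\<in>A. model.act (h \<mu>) c)" if "finite A"
    for h :: "lattice \<Rightarrow> free_algebra" and A c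
    using that by (induction A) (simp_all add: model.act_zero model.act_add)
  have "model.act (free_poly f) (\<alpha>, \<beta>, \<gamma>, \<delta>) =
    (\<Sum>\<mu>\<in>Poly_Mapping.keys f. (?f \<mu> * (t \<mu> * \<alpha> + 2 * q * of_int (fst \<mu>) * t \<mu> * \<beta>),
      ?f \<mu> * (t \<mu> * \<beta>), ?f \<mu> * (t2 \<mu> * \<gamma>), ?f \<mu> * (t12 \<mu> * \<delta>)))"
    unfolding free_poly_def
    by (simp add: sum model.act_mult model.act_const model.act_generator del: mult_single)
  also have "\<dots> = (extend_linear t f * \<alpha> + 2 * q * extend_linear (\<lambda>\<mu>. of_int (fst \<mu>) * t \<mu>) f * \<beta>,
     extend_linear t f * \<beta>, extend_linear t2 f * \<gamma>, extend_linear t12 f * \<delta>)"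
    by (simp add: sum_prod extend_linear_def sum_distrib_left sum_distrib_right sum.distrib[symmetric]
        algebra_simps)
  finally show ?thesis .
qed

text \<open>The action of the fraction involves \<open>f\<close> through the functionals that extend \<open>t\<close>, \<open>\<mu>\<^sub>1 t(\<mu>)\<close>,
  \<open>s\<^sub>2 t\<close> and \<open>s\<^sub>1 s\<^sub>2 t\<close>. For \<open>i = 1\<close> the first two cannot be found by dividing, since \<open>t(X\<^sup>\<alpha>\<^sup>1) = 1\<close>:
  there the equation for \<open>e = \<mu>\<^sub>1 t(\<mu>)\<close> gives the first functional, and the one for \<open>e = \<mu>\<^sub>1\<^sup>2 t(\<mu>)\<close>
  gives the second.\<close>

lemma model_bernstein:
  assumes f: "f * (1 - X_pow (- simple_root i)) = X_pow \<mu> - X_pow (reflection i \<mu>)"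
  shows "gen4 (X \<mu>) (gen4 (T i) c) =
    gen4 (T i) (gen4 (X (reflection i \<mu>)) c) + scale4 (2 * q) (model.act (free_poly f) c)"
proof -
  obtain \<alpha> \<beta> \<gamma> \<delta> where c: "c = (\<alpha>, \<beta>, \<gamma>, \<delta>)" by (cases c)
  define A where "A = extend_linear t f"
  define B where "B = extend_linear (\<lambda>\<mu>. of_int (fst \<mu>) * t \<mu>) f"
  note frac = extend_linear_fraction[OF f]
  have lin: "extend_linear (\<lambda>\<kappa>. x * e \<kappa> + y * e' \<kappa>) f = x * extend_linear e f + y * extend_linear e' f"
    for x y e e'
    by (simp add: extend_linear_def sum_distrib_left sum.distrib algebra_simps)
  have double: "2 * extend_linear s f = s \<mu> - s (reflection i \<mu>)"
    if "s \<in> torus" "s (simple_root i) = - 1" for s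
    using frac[of s] lin[of 2 s 0 s] that by (simp add: torus_diff)
  have C: "2 * extend_linear t2 f = t2 \<mu> - t2 (reflection i \<mu>)"
    "2 * extend_linear t12 f = t12 \<mu> - t12 (reflection i \<mu>)"
    by (cases i; use double weights_root in simp)+
  show ?thesis
  proof (cases i)
    case N1
    have A: "A = of_int (fst \<mu>) * t \<mu>"
    proof -
      have "extend_linear (\<lambda>\<kappa>. of_int (fst \<kappa>) * t \<kappa> - of_int (fst (\<kappa> - (2, -1))) * t (\<kappa> - (2, -1))) f = 2 * A"
        using lin[of 2 t 0 t] unfolding A_def by (simp add: torus_diff algebra_simps)
      then show ?thesis
        using frac[of "\<lambda>\<kappa>. of_int (fst \<kappa>) * t \<kappa>"] N1 by simp
    qed
    have B: "B = A"
    proof -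
      have "extend_linear (\<lambda>\<kappa>. (of_int (fst \<kappa>))\<^sup>2 * t \<kappa> - (of_int (fst (\<kappa> - (2, -1))))\<^sup>2 * t (\<kappa> - (2, -1))) f
          = 4 * B - 4 * A"
        using lin[of 4 "\<lambda>\<mu>. of_int (fst \<mu>) * t \<mu>" "- 4" t] unfolding A_def B_def
        by (simp add: torus_diff algebra_simps power2_eq_square)
      then show ?thesis
        using frac[of "\<lambda>\<kappa>. (of_int (fst \<kappa>))\<^sup>2 * t \<kappa>"] N1 by simp
    qed
    have E: "extend_linear t2 f = (t2 \<mu> - t12 \<mu>) / 2" "extend_linear t12 f = (t12 \<mu> - t2 \<mu>) / 2"
      using C N1 by (simp_all add: mult.commute[of _ 2])
    show ?thesis
      unfolding c act_free_poly N1 A_def[symmetric] B_def[symmetric] B A E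
      by (simp add: field_simps)
  next
    case N2
    have A: "A = (t \<mu> - t2 \<mu>) / 2"
      using double[of t] N2 weights_root unfolding A_def by (simp add: mult.commute[of _ 2])
    have B: "B = (of_int (fst \<mu>) * t \<mu> - of_int (fst \<mu> + 2 * snd \<mu>) * t2 \<mu> - (t \<mu> - t2 \<mu>)) / 2"
    proof -
      have "extend_linear (\<lambda>\<kappa>. of_int (fst \<kappa>) * t \<kappa> - of_int (fst (\<kappa> - (-2, 2))) * t (\<kappa> - (-2, 2))) f
          = 2 * B + 2 * A"
        using lin[of 2 "\<lambda>\<mu>. of_int (fst \<mu>) * t \<mu>" 2 t] unfolding A_def B_def
        by (simp add: torus_diff algebra_simps)
      then have "2 * B + 2 * A = of_int (fst \<mu>) * t \<mu> - of_int (fst \<mu> + 2 * snd \<mu>) * t2 \<mu>"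
        using frac[of "\<lambda>\<kappa>. of_int (fst \<kappa>) * t \<kappa>"] N2 by simp
      then have "of_int (fst \<mu>) * t \<mu> - of_int (fst \<mu> + 2 * snd \<mu>) * t2 \<mu> - 2 * A = 2 * B"
        by (metis add_diff_cancel_right')
      moreover have "2 * A = t \<mu> - t2 \<mu>"
        unfolding A by simp
      ultimately have B2: "of_int (fst \<mu>) * t \<mu> - of_int (fst \<mu> + 2 * snd \<mu>) * t2 \<mu> - (t \<mu> - t2 \<mu>) = 2 * B"
        by (simp only:)
      show ?thesis
        unfolding B2 by simp
    qed
    have E: "extend_linear t2 f = (t2 \<mu> - t \<mu>) / 2" "extend_linear t12 f = (t12 \<mu> - t (- \<mu>)) / 2"
      using C N2 by (simp_all add: mult.commute[of _ 2])
    show ?thesis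
      unfolding c act_free_poly N2 A_def[symmetric] B_def[symmetric] B A E
      by (simp add: field_simps)
  qed
qed

lemma model_relations:
  assumes "r \<in> hecke_relations q"
  shows "model.act r c = 0"
proof -
  obtain \<alpha> \<beta> \<gamma> \<delta> where c: "c = (\<alpha>, \<beta>, \<gamma>, \<delta>)" by (cases c)
  have one: "model.act 1 c = c" for c
    using model.act_const[of 1 c] by simp
  note simps = model.act_diff model.act_add model.act_mult model.act_generator model.act_const one
  from assms consider (1) "r = free_X 0 - 1"
    | (2) \<mu> \<nu> where "r = free_X \<mu> * free_X \<nu> - free_X (\<mu> + \<nu>)"
    | (3) i where "r = free_T i * free_T i - (free_const (q - inverse q) * free_T i + 1)"
    | (4) "r = free_T N1 * free_T N2 * free_T N1 * free_T N2 - free_T N2 * free_T N1 * free_T N2 * free_T N1"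
    | (5) i \<mu> f where "r = free_X \<mu> * free_T i
        - (free_T i * free_X (reflection i \<mu>) + free_const (q - inverse q) * free_poly f)"
        "f * (1 - X_pow (- simple_root i)) = X_pow \<mu> - X_pow (reflection i \<mu>)"
    unfolding hecke_relations_def by blast
  then show ?thesis
  proof cases
    case 1
    show ?thesis
      unfolding 1 simps c by (simp add: torus_zero[unfolded zero_prod_def] zero_prod_def)
  next
    case 2
    show ?thesis
      unfolding 2 simps c by (simp add: torus_add zero_prod_def algebra_simps)
  next
    case 3
    show ?thesis
      unfolding 3 simps c q_diff by (cases i) (simp_all add: zero_prod_def algebra_simps)
  next
    case 4
    show ?thesis
      unfolding 4 simps c by (simp add: zero_prod_def algebra_simps)
  next
    case 5
    show ?thesis
      unfolding 5(1) simps q_diff using model_bernstein[OF 5(2), of c] by simp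
  qed
qed

lemma act_cong: "hecke_class q x = hecke_class q y \<Longrightarrow> model.act x c = model.act y c"
  by (rule model.act_factors[of q]) (rule model_relations)

end

section \<open>Weight vectors and intertwining operators\<close>

locale special_module = special_weight q t + hecke_module q L
  for q t and L :: "(hecke_elt, 'b) module"
begin

lemma bernstein_N1:
  assumes "x \<in> carrier L"
  shows "XX (1, 0) (TT N1 x) = TT N1 (XX (- 1, 1) x) \<oplus>\<^bsub>L\<^esub> scal (2 * q) (XX (1, 0) x)"
    and "XX (- 1, 1) (TT N1 x) = TT N1 (XX (1, 0) x) \<oplus>\<^bsub>L\<^esub> scal (- 2 * q) (XX (1, 0) x)"
    and "XX (- 1, 0) (TT N1 x) = TT N1 (XX (1, - 1) x) \<oplus>\<^bsub>L\<^esub> scal (- 2 * q) (XX (1, - 1) x)"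
    and "XX (1, - 1) (TT N1 x) = TT N1 (XX (- 1, 0) x) \<oplus>\<^bsub>L\<^esub> scal (2 * q) (XX (1, - 1) x)"
  using bernstein_single[of "(1, 0)" 1 N1 "(1, 0)" x] bernstein_single[of "(1, 0)" "- 1" N1 "(- 1, 1)" x]
    bernstein_single[of "(1, - 1)" "- 1" N1 "(- 1, 0)" x] bernstein_single[of "(1, - 1)" 1 N1 "(1, - 1)" x]
    assms
  by (simp_all add: q_diff right_diff_distrib mult_single single_uminus)

lemma bernstein_N2:
  assumes "x \<in> carrier L"
  shows "XX (1, 0) (TT N2 x) = TT N2 (XX (1, 0) x)"
    and "XX (- 1, 1) (TT N2 x) = TT N2 (XX (1, - 1) x) \<oplus>\<^bsub>L\<^esub> scal (2 * q) (XX (- 1, 1) x)"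
    and "XX (- 1, 0) (TT N2 x) = TT N2 (XX (- 1, 0) x)"
    and "XX (1, - 1) (TT N2 x) = TT N2 (XX (- 1, 1) x) \<oplus>\<^bsub>L\<^esub> scal (- 2 * q) (XX (- 1, 1) x)"
  using bernstein_single[of 0 0 N2 "(1, 0)" x] bernstein_single[of "(- 1, 1)" 1 N2 "(- 1, 1)" x]
    bernstein_single[of 0 0 N2 "(- 1, 0)" x] bernstein_single[of "(- 1, 1)" "- 1" N2 "(1, - 1)" x]
    assms
  by (simp_all add: q_diff right_diff_distrib mult_single single_uminus)

lemma quadratic: "x \<in> carrier L \<Longrightarrow> TT i (TT i x) = scal (2 * q) (TT i x) \<oplus>\<^bsub>L\<^esub> x"
  using TT_TT[of x i] by (simp add: q_diff)

lemma weight_spaceD: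
  assumes "x \<in> weight_space q L s"
  shows "x \<in> carrier L" "XX \<mu> x = scal (s \<mu>) x"
  using assms unfolding weight_space_def by blast+

text \<open>Being a weight vector is a condition on a basis of the lattice only, since \<open>X\<^sup>\<mu>\<close> and \<open>s \<mu>\<close> are
  both multiplicative in \<open>\<mu>\<close>.\<close>

lemma weight_from_basis:
  assumes s: "s \<in> torus" and x: "x \<in> carrier L"
    and "XX (1, 0) x = scal (s (1, 0)) x" "XX (- 1, 1) x = scal (s (- 1, 1)) x"
  shows "x \<in> weight_space q L s"
proof -
  have "XX \<mu> x = scal (s \<mu>) x" for \<mu>
  proof (induction \<mu> rule: lattice_induct)
    case (add \<mu> \<nu>)
    have "XX (\<mu> + \<nu>) x = XX \<mu> (XX \<nu> x)"
      by (simp only: XX_XX[OF x])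
    then show ?case
      using add x by (simp add: op_scal scal_scal torus_add[OF s] mult.commute)
  next
    case (uminus \<mu>)
    have "XX (- \<mu>) x = XX (- \<mu>) (scal (s (- \<mu>)) (scal (s \<mu>) x))"
      using x torus_nonzero[OF s, of \<mu>] by (simp add: scal_scal torus_uminus[OF s])
    also have "\<dots> = scal (s (- \<mu>)) (XX (- \<mu>) (XX \<mu> x))"
      using x uminus by (simp add: op_scal)
    also have "\<dots> = scal (s (- \<mu>)) x"
      using x by (simp add: XX_XX XX_zero)
    finally show ?case .
  qed (use assms in simp_all)
  then show ?thesis using x by (simp add: weight_space_def)
qed

definition lin :: "'b \<Rightarrow> 'b \<Rightarrow> complex \<Rightarrow> complex \<Rightarrow> 'b" where
  "lin x y a b = scal a x \<oplus>\<^bsub>L\<^esub> scal b y"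

lemma lin_closed [simp, intro]: "\<lbrakk>x \<in> carrier L; y \<in> carrier L\<rbrakk> \<Longrightarrow> lin x y a b \<in> carrier L"
  by (simp add: lin_def)

lemma lin_add:
  "\<lbrakk>x \<in> carrier L; y \<in> carrier L\<rbrakk> \<Longrightarrow> lin x y a b \<oplus>\<^bsub>L\<^esub> lin x y c d = lin x y (a + c) (b + d)"
  by (simp add: lin_def scal_add M.a_ac)

lemma scal_lin: "\<lbrakk>x \<in> carrier L; y \<in> carrier L\<rbrakk> \<Longrightarrow> scal c (lin x y a b) = lin x y (c * a) (c * b)"
  by (simp add: lin_def op_add scal_scal)

text \<open>On a weight space with \<open>s(X\<^sup>\<alpha>\<^sup>i) = -1\<close>, the intertwining operator
  \<open>T\<^sub>i - (q - 1/q) / (1 - X\<^sup>-\<^sup>\<alpha>\<^sup>i)\<close> is \<open>T\<^sub>i - q\<close>. For \<open>q\<^sup>2 = -1\<close> the quadratic relation reads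
  \<open>(T\<^sub>i - q)\<^sup>2 = 0\<close>, so \<open>T\<^sub>i\<close> acts on the image by the scalar \<open>q\<close>. The vector \<open>m\<close> and the
  eigenvectors that identify simple modules are obtained in this way.\<close>

lemma intertwiner:
  assumes s: "s \<in> torus" "s (simple_root i) = - 1" and x: "x \<in> weight_space q L s"
  defines "y \<equiv> TT i x \<oplus>\<^bsub>L\<^esub> scal (- q) x"
  shows "y \<in> weight_space q L (\<lambda>\<mu>. s (reflection i \<mu>))" and "TT i y = scal q y"
proof -
  have xL: "x \<in> carrier L" by (rule weight_spaceD(1)[OF x])
  note X = weight_spaceD(2)[OF x]
  have y: "y = lin (TT i x) x 1 (- q)" "y \<in> carrier L"
    using xL by (simp_all add: y_def lin_def)
  have lins: "TT i x = lin (TT i x) x 1 0" "\<And>a. scal a (TT i x) = lin (TT i x) x a 0"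
    "\<And>a. scal a x = lin (TT i x) x 0 a" "x = lin (TT i x) x 0 1"
    using xL by (simp_all add: lin_def)
  have "TT i y = scal (2 * q) (TT i x) \<oplus>\<^bsub>L\<^esub> x \<oplus>\<^bsub>L\<^esub> scal (- q) (TT i x)"
    using xL by (simp add: y_def op_add op_scal quadratic)
  also have "\<dots> = scal q y"
    using xL by (simp add: lins(2) y(1) scal_lin, subst (2) lins(4), simp add: lin_add)
  finally show "TT i y = scal q y" .
  have nz: "s (- 1, 1) \<noteq> 0"
    by (rule torus_nonzero[OF s(1)])
  have X_y: "XX \<mu> y = XX \<mu> (TT i x) \<oplus>\<^bsub>L\<^esub> scal (- q * s \<mu>) x" for \<mu>
    using xL by (simp add: y_def op_add op_scal X scal_scal)
  have goal: "XX \<mu> y = scal c y"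
    if "XX \<mu> (TT i x) = scal c (TT i x) \<oplus>\<^bsub>L\<^esub> scal d x" "d - q * s \<mu> = - c * q" for \<mu> c d
  proof -
    have "XX \<mu> y = lin (TT i x) x c (d - q * s \<mu>)"
      using xL that(1) by (simp add: X_y lins(2,3) lin_add)
    also have "\<dots> = scal c y"
      using xL that(2) by (simp add: y(1) scal_lin)
    finally show ?thesis .
  qed
  show "y \<in> weight_space q L (\<lambda>\<mu>. s (reflection i \<mu>))"
  proof (rule weight_from_basis[OF torus_reflection[OF s(1)] y(2)])
    show "XX (1, 0) y = scal (s (reflection i (1, 0))) y"
    proof (cases i)
      case N1
      have "s (1, 0) = - s (- 1, 1)"
        using s(2) torus_diff[OF s(1), of "(1, 0)" "(-1, 1)"] N1 nz by (simp add: field_simps)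
      then show ?thesis
        unfolding N1 using xL bernstein_N1(1)[OF xL]
        by (intro goal[unfolded N1, where d = "2 * q * s (1, 0)"]) (simp_all add: X op_scal scal_scal)
    next
      case N2
      show ?thesis
        unfolding N2 using xL bernstein_N2(1)[OF xL]
        by (intro goal[unfolded N2, where d = 0]) (simp_all add: X op_scal scal_scal)
    qed
    show "XX (- 1, 1) y = scal (s (reflection i (- 1, 1))) y"
    proof (cases i)
      case N1
      have "s (1, 0) = - s (- 1, 1)"
        using s(2) torus_diff[OF s(1), of "(1, 0)" "(-1, 1)"] N1 nz by (simp add: field_simps)
      then show ?thesis
        unfolding N1 using xL bernstein_N1(2)[OF xL]
        by (intro goal[unfolded N1, where d = "- 2 * q * s (1, 0)"]) (simp_all add: X op_scal scal_scal)
    next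
      case N2
      have minus: "- s (1, - 1) = s (- 1, 1)"
        using s(2) torus_diff[OF s(1), of "(- 1, 1)" "(1, - 1)"] N2 torus_nonzero[OF s(1), of "(1, - 1)"]
        by (simp add: field_simps)
      have "s (1, - 1) = - s (- 1, 1)"
        unfolding minus[symmetric] by simp
      then show ?thesis
        unfolding N2 using xL bernstein_N2(2)[OF xL]
        by (intro goal[unfolded N2, where d = "2 * q * s (- 1, 1)"]) (simp_all add: X op_scal scal_scal)
    qed
  qed
qed

lemma irreducible_line:
  assumes "x \<in> carrier L" "x \<noteq> \<zero>\<^bsub>L\<^esub>" "carrier L = range (\<lambda>a. scal a x)"
  shows "irreducible_module (hecke q) L"
  unfolding irreducible_module_def
proof (intro conjI allI impI)
  show "left_module (hecke q) L" by (rule left_module_axioms)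
  show "carrier L \<noteq> {\<zero>\<^bsub>L\<^esub>}" using assms by blast
  fix N assume N: "submodule N (hecke q) L"
  show "N = {\<zero>\<^bsub>L\<^esub>} \<or> N = carrier L"
  proof (cases "N = {\<zero>\<^bsub>L\<^esub>}")
    case False
    then obtain y where y: "y \<in> N" "y \<noteq> \<zero>\<^bsub>L\<^esub>"
      using submodule_memD(2)[OF N] by blast
    obtain a where a: "y = scal a x"
      using y(1) submodule_memD(1)[OF N] assms(3) by blast
    with y(2) assms(1) have "a \<noteq> 0" by auto
    have "scal b x \<in> N" for b
    proof -
      have "scal b x = scal (b / a) y"
        using \<open>a \<noteq> 0\<close> assms(1) by (simp add: a scal_scal)
      then show ?thesis
        using submodule_memD(5)[OF N _ y(1)] by (simp add: hecke_const_def)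
    qed
    then have "carrier L \<subseteq> N"
      unfolding assms(3) by auto
    then show ?thesis
      using submodule_memD(1)[OF N] by simp
  qed simp
qed

end

section \<open>The module generated by a vector of weight t\<close>

text \<open>A vector \<open>u\<close> as in the definition of \<open>M\<close>. In any module such a vector generates a homomorphic
  image of the four-dimensional representation, and \<open>J\<close> is the corresponding map. The formulas for
  \<open>w\<close>, \<open>n\<close> and \<open>m\<close> are those behind \<open>gen4\<close>.\<close>

locale standard_vector = special_module q t L
  for q t and L :: "(hecke_elt, 'b) module" +
  fixes u :: 'b
  assumes u_weight: "u \<in> weight_space q L t" and T2_u: "TT N2 u = scal q u"
begin

definition "w = TT N1 u"
definition "n = TT N2 w \<oplus>\<^bsub>L\<^esub> lin u w (- 2) (- q)"
definition "m = TT N1 n \<oplus>\<^bsub>L\<^esub> scal (- q) n"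

fun J :: "quad \<Rightarrow> 'b" where
  "J (\<alpha>, \<beta>, \<gamma>, \<delta>) = lin u w \<alpha> \<beta> \<oplus>\<^bsub>L\<^esub> lin n m \<gamma> \<delta>"

declare J.simps [simp del]

lemma basis_closed [simp, intro]: "u \<in> carrier L" "w \<in> carrier L" "n \<in> carrier L" "m \<in> carrier L"
proof -
  show u: "u \<in> carrier L" by (rule weight_spaceD(1)[OF u_weight])
  then show w: "w \<in> carrier L" by (simp add: w_def)
  then show n: "n \<in> carrier L" using u by (simp add: n_def)
  then show "m \<in> carrier L" by (simp add: m_def)
qed

lemma J_closed [simp, intro]: "J c \<in> carrier L"
  by (cases c) (simp add: J.simps)

lemma J_add: "J c \<oplus>\<^bsub>L\<^esub> J d = J (c + d)"
proof -
  obtain c1 c2 c3 c4 d1 d2 d3 d4 where "c = (c1, c2, c3, c4)" "d = (d1, d2, d3, d4)"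
    by (cases c; cases d)
  moreover have "(x \<oplus>\<^bsub>L\<^esub> y) \<oplus>\<^bsub>L\<^esub> (x' \<oplus>\<^bsub>L\<^esub> y') = (x \<oplus>\<^bsub>L\<^esub> x') \<oplus>\<^bsub>L\<^esub> (y \<oplus>\<^bsub>L\<^esub> y')"
    if "x \<in> carrier L" "y \<in> carrier L" "x' \<in> carrier L" "y' \<in> carrier L" for x y x' y'
    using that by (simp add: M.a_ac)
  ultimately show ?thesis by (simp add: J.simps lin_add)
qed

lemma scal_J: "scal a (J c) = J (scale4 a c)"
  by (cases c) (simp add: J.simps op_add scal_lin)

lemma basis_J: "u = J (1, 0, 0, 0)" "w = J (0, 1, 0, 0)" "n = J (0, 0, 1, 0)" "m = J (0, 0, 0, 1)"
  by (simp_all add: J.simps lin_def)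

lemma scal_basis:
  "scal a u = J (a, 0, 0, 0)" "scal a w = J (0, a, 0, 0)" "scal a n = J (0, 0, a, 0)"
  "scal a m = J (0, 0, 0, a)"
  by (simp_all add: J.simps lin_def)

text \<open>Each relation of the algebra, applied to vectors with known images, gives an equation in which
  one image is unknown.\<close>

lemma J_cancel:
  assumes "J c \<oplus>\<^bsub>L\<^esub> x = J d" "x \<in> carrier L"
  shows "x = J (d - c)"
proof -
  have "J c \<oplus>\<^bsub>L\<^esub> J (d - c) = J d"
    by (simp add: J_add)
  with assms show ?thesis
    using M.add.l_cancel_one by (metis J_closed M.add.inv_solve_left M.a_closed)
qed

lemma op_J:
  "TT i (J (\<alpha>, \<beta>, \<gamma>, \<delta>)) =
    (scal \<alpha> (TT i u) \<oplus>\<^bsub>L\<^esub> scal \<beta> (TT i w)) \<oplus>\<^bsub>L\<^esub> (scal \<gamma> (TT i n) \<oplus>\<^bsub>L\<^esub> scal \<delta> (TT i m))"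
  "XX \<mu> (J (\<alpha>, \<beta>, \<gamma>, \<delta>)) =
    (scal \<alpha> (XX \<mu> u) \<oplus>\<^bsub>L\<^esub> scal \<beta> (XX \<mu> w)) \<oplus>\<^bsub>L\<^esub> (scal \<gamma> (XX \<mu> n) \<oplus>\<^bsub>L\<^esub> scal \<delta> (XX \<mu> m))"
  by (simp_all add: J.simps lin_def op_add op_scal)

lemma T1_u: "TT N1 u = J (0, 1, 0, 0)"
  using basis_J(2) by (simp add: w_def)

lemma T2_u_J: "TT N2 u = J (q, 0, 0, 0)"
  by (simp add: T2_u scal_basis)

lemma T1_w: "TT N1 w = J (1, 2 * q, 0, 0)"
proof -
  have "TT N1 w = scal (2 * q) w \<oplus>\<^bsub>L\<^esub> u"
    using quadratic[of u N1] by (simp add: w_def)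
  then show ?thesis
    by (simp add: scal_basis) (subst basis_J(1), simp add: J_add)
qed

lemma T2_w: "TT N2 w = J (2, q, 1, 0)"
proof -
  have "lin u w (- 2) (- q) = J (- 2, - q, 0, 0)"
    by (simp add: J.simps) (simp add: lin_def)
  then have "J (- 2, - q, 0, 0) \<oplus>\<^bsub>L\<^esub> TT N2 w = J (0, 0, 1, 0)"
    using basis_J(3) by (simp add: n_def M.a_comm)
  from J_cancel[OF this] show ?thesis by simp
qed

lemma T1_n: "TT N1 n = J (0, 0, q, 1)"
proof -
  have "J (0, 0, - q, 0) \<oplus>\<^bsub>L\<^esub> TT N1 n = J (0, 0, 0, 1)"
    using basis_J(4) by (simp add: m_def M.a_comm scal_basis)
  from J_cancel[OF this] show ?thesis by simp
qed

lemma T2_n: "TT N2 n = J (0, 0, q, 0)"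
proof -
  have "TT N2 (J (2, q, 1, 0)) = scal (2 * q) (J (2, q, 1, 0)) \<oplus>\<^bsub>L\<^esub> J (0, 1, 0, 0)"
    using quadratic[of w N2] by (simp add: T2_w basis_J(2)[symmetric])
  then have "J (4 * q, - 1, q, 0) \<oplus>\<^bsub>L\<^esub> TT N2 n = J (4 * q, - 1, 2 * q, 0)"
    by (simp add: op_J T2_u_J T2_w scal_J J_add mult.assoc)
  from J_cancel[OF this] show ?thesis by simp
qed

lemma X_u: "XX \<mu> u = J (t \<mu>, 0, 0, 0)"
  by (simp add: weight_spaceD(2)[OF u_weight] scal_basis)

text \<open>The Jordan block: \<open>w\<close> is a generalised weight vector because \<open>s\<^sub>1 t = t\<close>. Up to the factor
  \<open>2 q\<close>, the coefficient of \<open>u\<close> is the derivative of \<open>t\<close> along the coroot of \<open>\<alpha>\<^sub>1\<close>.\<close>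

lemma X_w: "XX \<mu> w = J (2 * q * of_int (fst \<mu>) * t \<mu>, t \<mu>, 0, 0)"
proof (induction \<mu> rule: lattice_induct)
  case fst_basis
  show ?case
    using bernstein_N1(1)[of u, folded w_def] by (simp add: X_u op_J T1_u scal_J J_add)
next
  case snd_basis
  show ?case
    using bernstein_N1(2)[of u, folded w_def] by (simp add: X_u op_J T1_u scal_J J_add)
next
  case (add \<mu> \<nu>)
  have "XX (\<mu> + \<nu>) w = XX \<mu> (XX \<nu> w)"
    by (simp only: XX_XX[OF basis_closed(2)])
  also have "\<dots> = J (2 * q * of_int (fst (\<mu> + \<nu>)) * t (\<mu> + \<nu>), t (\<mu> + \<nu>), 0, 0)"
    by (simp add: add op_J X_u scal_J J_add torus_add algebra_simps)
  finally show ?case .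
next
  case (uminus \<mu>)
  have nz: "t \<mu> \<noteq> 0" by (simp add: torus_nonzero)
  have "XX (- \<mu>) (XX \<mu> w) = J (0, 1, 0, 0)"
    using XX_zero[OF basis_closed(2)] by (simp add: XX_XX basis_J(2)[symmetric])
  then have "J (2 * q * of_int (fst \<mu>), 0, 0, 0) \<oplus>\<^bsub>L\<^esub> scal (t \<mu>) (XX (- \<mu>) w) = J (0, 1, 0, 0)"
    using nz by (simp add: uminus op_J X_u scal_J J_add torus_uminus mult.assoc)
  from J_cancel[OF this] have "scal (t \<mu>) (XX (- \<mu>) w) = J (- 2 * q * of_int (fst \<mu>), 1, 0, 0)"
    by (simp add: zero_prod_def)
  moreover have "XX (- \<mu>) w = scal (t (- \<mu>)) (scal (t \<mu>) (XX (- \<mu>) w))"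
    using nz by (simp add: scal_scal torus_uminus)
  ultimately show ?case
    by (simp add: scal_J algebra_simps)
qed

lemma n_weight: "n \<in> weight_space q L t2"
proof (rule weight_from_basis)
  have "XX (1, 0) (J (2, q, 1, 0)) = TT N2 (XX (1, 0) w)"
    using bernstein_N2(1)[of w] by (simp add: T2_w)
  then have "J (2 * \<iota> - 2 * \<iota>, q * \<iota>, 0, 0) \<oplus>\<^bsub>L\<^esub> XX (1, 0) n = J (0, q * \<iota>, \<iota>, 0)"
    by (simp add: op_J X_u X_w T2_u_J T2_w scal_J J_add algebra_simps)
  from J_cancel[OF this] show "XX (1, 0) n = scal (t2 (1, 0)) n"
    by (simp add: scal_basis)
  have "XX (- 1, 1) (J (2, q, 1, 0)) =
      TT N2 (XX (1, - 1) w) \<oplus>\<^bsub>L\<^esub> scal (2 * q) (XX (- 1, 1) w)"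
    using bernstein_N2(2)[of w] by (simp add: T2_w)
  then have "J (4 * \<iota>, q * \<iota>, 0, 0) \<oplus>\<^bsub>L\<^esub> XX (- 1, 1) n = J (4 * \<iota>, q * \<iota>, - \<iota>, 0)"
    by (simp add: op_J X_u X_w T2_u_J T2_w scal_J J_add algebra_simps)
  from J_cancel[OF this] show "XX (- 1, 1) n = scal (t2 (- 1, 1)) n"
    by (simp add: scal_basis)
qed simp_all

lemma m_weight: "m \<in> weight_space q L t12" and T1_m: "TT N1 m = J (0, 0, 0, q)"
  using intertwiner[OF torus(2) weights_root(1) n_weight, folded m_def] by (simp_all add: scal_basis)

text \<open>The last image is forced by the braid relation on \<open>u\<close>. It closes the span of the four vectors
  under the generators.\<close>

lemma T2_m: "TT N2 m = J (0, 0, 0, q)"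
proof -
  have "TT N1 (TT N2 (TT N1 (TT N2 u))) = J (- 1, 0, - 1, q)"
    by (simp add: op_J T1_u T2_u_J T1_w T2_w T1_n T1_m scal_J J_add algebra_simps)
  moreover have "TT N2 (TT N1 (TT N2 w)) = J (- 1, 0, - 1, 0) \<oplus>\<^bsub>L\<^esub> TT N2 m"
    by (simp add: op_J T1_u T2_u_J T1_w T2_w T1_n T2_n T1_m scal_J J_add M.a_assoc[symmetric] algebra_simps)
  ultimately have "J (- 1, 0, - 1, 0) \<oplus>\<^bsub>L\<^esub> TT N2 m = J (- 1, 0, - 1, q)"
    using braid[of u, folded w_def] by simp
  from J_cancel[OF this] show ?thesis by simp
qed

lemma X_n: "XX \<mu> n = J (0, 0, t2 \<mu>, 0)" and X_m: "XX \<mu> m = J (0, 0, 0, t12 \<mu>)"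
  by (simp_all add: weight_spaceD(2)[OF n_weight] weight_spaceD(2)[OF m_weight] scal_basis)

sublocale co: coordinates scale4 gen4 q L J
proof
  fix i \<mu> and c d :: quad and a :: complex
  obtain \<alpha> \<beta> \<gamma> \<delta> where c: "c = (\<alpha>, \<beta>, \<gamma>, \<delta>)" by (cases c)
  show "J c \<in> carrier L" by simp
  show "J (c + d) = J c \<oplus>\<^bsub>L\<^esub> J d" "J (scale4 a c) = scal a (J c)"
    by (simp_all add: J_add scal_J)
  show "J (gen4 (T i) c) = TT i (J c)"
    by (cases i) (simp_all add: c op_J T1_u T2_u_J T1_w T2_w T1_n T2_n T1_m T2_m scal_J J_add algebra_simps)
  show "J (gen4 (X \<mu>) c) = XX \<mu> (J c)"
    by (simp add: c op_J X_u X_w X_n X_m scal_J J_add algebra_simps)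
qed

text \<open>The line of \<open>m\<close> and the plane of \<open>n\<close> and \<open>m\<close>; the digits are the positions of the free
  coordinates, counted from zero.\<close>

definition low3 :: "quad set" where "low3 = {(0, 0, 0, \<delta>) | \<delta>. True}"
definition low23 :: "quad set" where "low23 = {(0, 0, \<gamma>, \<delta>) | \<gamma> \<delta>. True}"

lemma submodule_low3: "submodule (J ` low3) (hecke q) L"
proof (rule co.submodule_image)
  show "model.subspace low3"
    by (auto simp: model.subspace_def low3_def zero_prod_def)
  show "gen4 s c \<in> low3" if "c \<in> low3" for s c
    using that by (cases "(s, c)" rule: gen4.cases) (auto simp: low3_def)
qed

lemma submodule_low23: "submodule (J ` low23) (hecke q) L"
proof (rule co.submodule_image)
  show "model.subspace low23"
    by (auto simp: model.subspace_def low23_def zero_prod_def)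
  show "gen4 s c \<in> low23" if "c \<in> low23" for s c
    using that by (cases "(s, c)" rule: gen4.cases) (auto simp: low23_def)
qed

end

text \<open>The two-dimensional quotient of the theorem, described intrinsically: \<open>n\<close> and \<open>m\<close> vanish, and
  \<open>u\<close>, \<open>w\<close> are a basis. Independence of \<open>u\<close> and \<open>w\<close> is a consequence of \<open>u \<noteq> 0\<close>.\<close>

locale top_module = standard_vector q t L u
  for q t and L :: "(hecke_elt, 'b) module" and u +
  assumes u_nonzero: "u \<noteq> \<zero>\<^bsub>L\<^esub>" and low_zero: "c \<in> low23 \<Longrightarrow> J c = \<zero>\<^bsub>L\<^esub>"
    and J_surj: "range J = carrier L"
begin

lemma J_reduce: "J (\<alpha>, \<beta>, \<gamma>, \<delta>) = J (\<alpha>, \<beta>, 0, 0)"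
  using J_add[of "(\<alpha>, \<beta>, 0, 0)" "(0, 0, \<gamma>, \<delta>)"] low_zero[of "(0, 0, \<gamma>, \<delta>)"]
  by (simp add: low23_def)

text \<open>\<open>X\<^sup>\<omega>\<^sup>1 - t(X\<^sup>\<omega>\<^sup>1)\<close> maps \<open>w\<close> to a nonzero multiple of \<open>u\<close> and kills \<open>u\<close>.\<close>

lemma X_minus_weight:
  "XX (1, 0) (J (\<alpha>, \<beta>, \<gamma>, \<delta>)) \<oplus>\<^bsub>L\<^esub> scal (- \<iota>) (J (\<alpha>, \<beta>, \<gamma>, \<delta>)) = scal (2 * q * \<iota> * \<beta>) u"
proof -
  have "XX (1, 0) (J (\<alpha>, \<beta>, \<gamma>, \<delta>)) \<oplus>\<^bsub>L\<^esub> scal (- \<iota>) (J (\<alpha>, \<beta>, \<gamma>, \<delta>)) = J (2 * q * \<iota> * \<beta>, 0, 0, - 2 * \<iota> * \<delta>)"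
    by (simp add: co.J_X[symmetric] scal_J J_add algebra_simps)
  then show ?thesis
    by (simp add: J_reduce[of _ _ _ "- (2 * \<iota> * \<delta>)"] scal_basis)
qed

lemma kernel_J: "J (\<alpha>, \<beta>, \<gamma>, \<delta>) = \<zero>\<^bsub>L\<^esub> \<longleftrightarrow> \<alpha> = 0 \<and> \<beta> = 0"
proof
  assume *: "J (\<alpha>, \<beta>, \<gamma>, \<delta>) = \<zero>\<^bsub>L\<^esub>"
  have "scal (2 * q * \<iota> * \<beta>) u = \<zero>\<^bsub>L\<^esub>"
    unfolding X_minus_weight[of \<alpha> \<beta> \<gamma> \<delta>, symmetric] * by simp
  then have "\<beta> = 0"
    using u_nonzero by (simp add: scal_eq_zero_iff)
  moreover from this have "scal \<alpha> u = \<zero>\<^bsub>L\<^esub>"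
    using * J_reduce[of \<alpha> \<beta> \<gamma> \<delta>] by (simp add: scal_basis)
  ultimately show "\<alpha> = 0 \<and> \<beta> = 0"
    using u_nonzero by (simp add: scal_eq_zero_iff)
next
  assume "\<alpha> = 0 \<and> \<beta> = 0"
  then show "J (\<alpha>, \<beta>, \<gamma>, \<delta>) = \<zero>\<^bsub>L\<^esub>"
    using low_zero[of "(0, 0, \<gamma>, \<delta>)"] by (simp add: low23_def)
qed

text \<open>Every nonzero submodule contains \<open>u\<close>, by the Jordan block, and therefore also \<open>w = T\<^sub>1 u\<close>.\<close>

lemma irreducible_top: "irreducible_module (hecke q) L"
  unfolding irreducible_module_def
proof (intro conjI allI impI)
  show "left_module (hecke q) L" by (rule left_module_axioms)
  show "carrier L \<noteq> {\<zero>\<^bsub>L\<^esub>}" using u_nonzero basis_closed(1) by blast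
  fix N assume N: "submodule N (hecke q) L"
  note closed = submodule_memD[OF N]
  have smult: "hecke_class q h \<odot>\<^bsub>L\<^esub> x \<in> N" if "x \<in> N" for h x
    using closed(5) that by simp
  then have op: "scal a x \<in> N" "TT i x \<in> N" "XX \<mu> x \<in> N" if "x \<in> N" for a i \<mu> x
    using that by (simp_all add: class_defs)
  show "N = {\<zero>\<^bsub>L\<^esub>} \<or> N = carrier L"
  proof (cases "N = {\<zero>\<^bsub>L\<^esub>}")
    case False
    then obtain x where x: "x \<in> N" "x \<noteq> \<zero>\<^bsub>L\<^esub>"
      using closed(2) by blast
    obtain \<alpha> \<beta> \<gamma> \<delta> where xJ: "x = J (\<alpha>, \<beta>, \<gamma>, \<delta>)"
      using x(1) closed(1) J_surj by (metis subsetD imageE prod_cases4)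
    have u_in: "u \<in> N" if "scal a u \<in> N" "a \<noteq> 0" for a
    proof -
      have "u = scal (inverse a) (scal a u)"
        using that by (simp add: scal_scal)
      then show ?thesis using op(1)[OF that(1)] by metis
    qed
    have u: "u \<in> N"
    proof (cases "\<beta> = 0")
      case True
      then have "x = scal \<alpha> u" "\<alpha> \<noteq> 0"
        using xJ x(2) J_reduce[of \<alpha> \<beta> \<gamma> \<delta>] by (auto simp: scal_basis kernel_J)
      then show ?thesis using u_in x(1) by blast
    next
      case False
      have "scal (2 * q * \<iota> * \<beta>) u \<in> N"
        using X_minus_weight[of \<alpha> \<beta> \<gamma> \<delta>] closed(3)[OF op(3)[OF x(1)] op(1)[OF x(1)]] xJ by metis
      then show ?thesis using u_in False by simp
    qed
    then have "w \<in> N" unfolding w_def by (rule op(2))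
    then have "J (\<alpha>, \<beta>, \<gamma>, \<delta>) \<in> N" for \<alpha> \<beta> \<gamma> \<delta>
      using closed(3)[OF op(1)[OF u, of \<alpha>] op(1)[of w \<beta>]]
      by (subst J_reduce) (simp add: J.simps lin_def)
    then have "carrier L \<subseteq> N"
      unfolding J_surj[symmetric] by auto
    then show ?thesis using closed(1) by blast
  qed simp
qed

lemma dimension_top: "complex_dimension q L 2"
  unfolding complex_dimension_def complex_basis_def
proof (intro exI[of _ "[u, w]"] conjI ballI)
  show "length [u, w] = 2" "set [u, w] \<subseteq> carrier L" by simp_all
  fix x assume "x \<in> carrier L"
  then obtain \<alpha> \<beta> \<gamma> \<delta> where "x = J (\<alpha>, \<beta>, \<gamma>, \<delta>)"
    unfolding J_surj[symmetric] by (metis imageE prod_cases4)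
  then have x: "x = J (\<alpha>, \<beta>, 0, 0)" using J_reduce[of \<alpha> \<beta> \<gamma> \<delta>] by simp
  have sum: "(\<Oplus>\<^bsub>L\<^esub>i\<in>{..<length [u, w]}. scal (c i) ([u, w] ! i)) = J (c 0, c 1, 0, 0)" for c :: "nat \<Rightarrow> complex"
  proof -
    have "{..<length [u, w]} = {0, 1 :: nat}" by auto
    then show ?thesis by (simp add: J.simps lin_def)
  qed
  have eq: "x = J (a, b, 0, 0) \<longleftrightarrow> a = \<alpha> \<and> b = \<beta>" for a b
    unfolding x using co.J_eq_iff[of "(\<alpha>, \<beta>, 0, 0)" "(a, b, 0, 0)"] kernel_J[of "\<alpha> - a" "\<beta> - b" 0 0]
    by (auto simp: zero_prod_def)
  show "\<exists>!c. c \<in> {..<length [u, w]} \<rightarrow>\<^sub>E UNIV \<and>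
      x = (\<Oplus>\<^bsub>L\<^esub>i\<in>{..<length [u, w]}. scal (c i) ([u, w] ! i))"
    unfolding sum eq
  proof (rule ex1I[of _ "\<lambda>i. if i = 0 then \<alpha> else if i = 1 then \<beta> else undefined"])
    fix c assume c: "c \<in> {..<length [u, w]} \<rightarrow>\<^sub>E UNIV \<and> c 0 = \<alpha> \<and> c 1 = \<beta>"
    show "c = (\<lambda>i. if i = 0 then \<alpha> else if i = 1 then \<beta> else undefined)"
    proof
      fix i show "c i = (if i = 0 then \<alpha> else if i = 1 then \<beta> else undefined)"
        using c PiE_arb[of c "{..<length [u, w]}" "\<lambda>_. UNIV" i] by auto
    qed
  qed (auto simp: PiE_def extensional_def)
qed

end

section \<open>Modules induced from a line\<close>

lemma hecke_X_zero: "hecke_X q 0 = \<one>\<^bsub>hecke q\<^esub>"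
  using hecke_class_eqI[of "free_X 0" 1 q] by (simp add: hecke_X_def hecke_relations_def hecke_class_one)

lemma hecke_const_in_range: "hecke_const q a \<in> range (hecke_poly q)"
proof -
  interpret ring "hecke q" by (rule ring_hecke)
  have "hecke_poly q (Poly_Mapping.single 0 a) = hecke_const q a \<otimes>\<^bsub>hecke q\<^esub> hecke_X q 0"
    by (simp only: hecke_poly_def free_poly_single hecke_class_mult hecke_const_def hecke_X_def)
  also have "\<dots> = hecke_const q a"
    by (simp only: hecke_X_zero) (simp add: hecke_const_def)
  finally show ?thesis by (metis rangeI)
qed

lemma hecke_X_in_range: "hecke_X q \<mu> \<in> range (hecke_poly q)"
proof -
  interpret ring "hecke q" by (rule ring_hecke)
  have "hecke_poly q (Poly_Mapping.single \<mu> 1) = hecke_X q \<mu>"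
    by (simp add: hecke_poly_def free_poly_single hecke_X_def del: mult_single)
  then show ?thesis by (metis rangeI)
qed

lemma carrier_hecke_parabolic:
  "carrier (hecke_parabolic q i) = generate_ring (hecke q) (insert (hecke_T q i) (range (hecke_poly q)))"
  by (simp add: hecke_parabolic_def)

lemma hecke_parabolic_subset: "carrier (hecke_parabolic q i) \<subseteq> carrier (hecke q)"
  unfolding carrier_hecke_parabolic
  by (rule subsetI, rule ring.generate_ring_in_carrier[OF ring_hecke])
    (auto simp: hecke_poly_def hecke_T_def)

lemma hecke_poly_subring_subset: "carrier (hecke_poly_subring q) \<subseteq> carrier (hecke q)"
  by (auto simp: hecke_poly_subring_def hecke_poly_def)

lemma range_hecke_poly_subset: "range (hecke_poly q) \<subseteq> carrier (hecke_parabolic q i)"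
  unfolding carrier_hecke_parabolic by (auto intro: generate_ring.incl)

text \<open>A basis of one vector provides a unique coordinate; the functions on \<open>{..<1}\<close> in the
  definition of a basis are replaced by single scalars.\<close>

lemma complex_basis_single:
  assumes "left_module A V" and const: "\<And>a. hecke_const q a \<in> carrier A" and basis: "complex_basis q V [v]"
  shows "v \<in> carrier V" and "x \<in> carrier V \<Longrightarrow> \<exists>!a. x = hecke_const q a \<odot>\<^bsub>V\<^esub> v"
proof -
  interpret V: left_module A V by fact
  show v: "v \<in> carrier V" using basis by (simp add: complex_basis_def)
  assume x: "x \<in> carrier V"
  have sum: "(\<Oplus>\<^bsub>V\<^esub>i\<in>{..<length [v]}. hecke_const q (c i) \<odot>\<^bsub>V\<^esub> ([v] ! i)) = hecke_const q (c 0) \<odot>\<^bsub>V\<^esub> v"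
    for c :: "nat \<Rightarrow> complex"
  proof -
    have "{..<length [v]} = {0 :: nat}" by auto
    then show ?thesis using V.smult_closed[OF const v] by simp
  qed
  from basis x have ex: "\<exists>!c. c \<in> {..<length [v]} \<rightarrow>\<^sub>E UNIV \<and> x = hecke_const q (c 0) \<odot>\<^bsub>V\<^esub> v"
    unfolding complex_basis_def sum by blast
  from ex1_implies_ex[OF ex] obtain c where c: "x = hecke_const q (c 0) \<odot>\<^bsub>V\<^esub> v" by auto
  show "\<exists>!a. x = hecke_const q a \<odot>\<^bsub>V\<^esub> v"
  proof (rule ex1I[of _ "c 0"])
    fix a assume a: "x = hecke_const q a \<odot>\<^bsub>V\<^esub> v"
    have mem: "(\<lambda>i. if i = 0 then b else undefined) \<in> {..<length [v]} \<rightarrow>\<^sub>E UNIV" for b :: complex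
      by (auto simp: PiE_def extensional_def)
    have "(\<lambda>i. if i = 0 then a else undefined) = (\<lambda>i :: nat. if i = 0 then c 0 else undefined)"
      using ex mem[of a] mem[of "c 0"] a c by (metis (mono_tags, lifting))
    then show "a = c 0" by metis
  qed (rule c)
qed

text \<open>The situation of \<open>M\<close> for a weight \<open>t\<close>. Since \<open>- 1/q = q\<close>, the module \<open>N\<close> is the same situation
  for the weight \<open>w\<^sub>0 t\<close>.\<close>

locale induced_weight_module = special_weight q t
  for q t and V :: "(hecke_elt, 'v) module" and v :: 'v +
  assumes V_module: "left_module (hecke_parabolic q N2) V" and V_basis: "complex_basis q V [v]"
    and V_T: "hecke_T q N2 \<odot>\<^bsub>V\<^esub> v = hecke_const q q \<odot>\<^bsub>V\<^esub> v"
    and V_X: "\<And>\<mu>. hecke_X q \<mu> \<odot>\<^bsub>V\<^esub> v = hecke_const q (t \<mu>) \<odot>\<^bsub>V\<^esub> v"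
begin

abbreviation "A \<equiv> hecke_parabolic q N2"
abbreviation "M \<equiv> induced_module (hecke q) A V"

lemma A_ops [simp]:
  "x \<oplus>\<^bsub>A\<^esub> y = x \<oplus>\<^bsub>hecke q\<^esub> y" "x \<otimes>\<^bsub>A\<^esub> y = x \<otimes>\<^bsub>hecke q\<^esub> y" "\<one>\<^bsub>A\<^esub> = \<one>\<^bsub>hecke q\<^esub>"
  by (simp_all add: hecke_parabolic_def)

lemma A_mem [simp, intro]:
  "hecke_const q a \<in> carrier A" "hecke_X q \<mu> \<in> carrier A" "hecke_T q N2 \<in> carrier A"
proof -
  show "hecke_const q a \<in> carrier A" "hecke_X q \<mu> \<in> carrier A"
    by (rule subsetD[OF range_hecke_poly_subset], rule hecke_const_in_range hecke_X_in_range)+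
  show "hecke_T q N2 \<in> carrier A"
    unfolding carrier_hecke_parabolic by (auto intro: generate_ring.incl)
qed

sublocale V: left_module A V by (rule V_module)

sublocale induced "hecke q" A V
  by (intro induced.intro induced_axioms.intro ring_hecke hecke_parabolic_subset)
    (auto intro: V.smult_closed)

lemma v_closed [simp, intro]: "v \<in> carrier V"
  by (rule complex_basis_single(1)[OF V_module _ V_basis]) simp

lemma V_unique: "x \<in> carrier V \<Longrightarrow> \<exists>!a. x = hecke_const q a \<odot>\<^bsub>V\<^esub> v"
  by (rule complex_basis_single(2)[OF V_module _ V_basis]) simp_all

lemma V_const_closed [simp, intro]: "hecke_const q a \<odot>\<^bsub>V\<^esub> v \<in> carrier V"
  by (rule V.smult_closed) simp_all

definition coef :: "'v \<Rightarrow> complex" where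
  "coef x = (THE a. x = hecke_const q a \<odot>\<^bsub>V\<^esub> v)"

lemma coef: "x \<in> carrier V \<Longrightarrow> x = hecke_const q (coef x) \<odot>\<^bsub>V\<^esub> v"
  unfolding coef_def by (rule theI'[OF V_unique])

lemma coef_const: "coef (hecke_const q a \<odot>\<^bsub>V\<^esub> v) = a"
  unfolding coef_def by (rule the1_equality[OF V_unique]) simp_all

lemma const_mult: "hecke_const q a \<otimes>\<^bsub>hecke q\<^esub> hecke_const q b = hecke_const q (a * b)"
  by (simp add: hecke_const_def hecke_class_mult[symmetric] mult_single)

lemma V_const_const: "hecke_const q a \<odot>\<^bsub>V\<^esub> (hecke_const q b \<odot>\<^bsub>V\<^esub> v) = hecke_const q (a * b) \<odot>\<^bsub>V\<^esub> v"
  using V.smult_assoc[of "hecke_const q a" "hecke_const q b" v] by (simp add: const_mult)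

lemma V_const_add:
  "hecke_const q a \<odot>\<^bsub>V\<^esub> v \<oplus>\<^bsub>V\<^esub> hecke_const q b \<odot>\<^bsub>V\<^esub> v = hecke_const q (a + b) \<odot>\<^bsub>V\<^esub> v"
proof -
  have "hecke_const q (a + b) = hecke_const q a \<oplus>\<^bsub>hecke q\<^esub> hecke_const q b"
    by (simp add: hecke_const_def single_add hecke_class_add)
  then show ?thesis
    using V.smult_l_distr[of "hecke_const q a" "hecke_const q b" v] by simp
qed

lemma coef_add:
  assumes "x \<in> carrier V" "y \<in> carrier V"
  shows "coef (x \<oplus>\<^bsub>V\<^esub> y) = coef x + coef y"
  using coef[OF assms(1)] coef[OF assms(2)] coef_const V_const_add by metis

lemma class_const_commute:
  assumes "hecke_class q z \<in> carrier A"
  shows "hecke_class q z \<odot>\<^bsub>V\<^esub> (hecke_const q a \<odot>\<^bsub>V\<^esub> v) = hecke_const q a \<odot>\<^bsub>V\<^esub> (hecke_class q z \<odot>\<^bsub>V\<^esub> v)"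
proof -
  have "hecke_class q z \<otimes>\<^bsub>hecke q\<^esub> hecke_const q a = hecke_const q a \<otimes>\<^bsub>hecke q\<^esub> hecke_class q z"
    by (simp add: hecke_const_def hecke_class_mult[symmetric] free_const_commute)
  then show ?thesis
    using V.smult_assoc[OF assms A_mem(1) v_closed, of a] V.smult_assoc[OF A_mem(1) assms v_closed, of a]
    by simp
qed

lemma poly_smult: "hecke_poly q f \<odot>\<^bsub>V\<^esub> v = hecke_const q (extend_linear t f) \<odot>\<^bsub>V\<^esub> v"
proof -
  have mem: "hecke_poly q h \<in> carrier A" for h
    using range_hecke_poly_subset by blast
  show ?thesis
  proof (induction f rule: poly_mapping_induct_add)
    case zero
    then show ?case by (simp add: extend_linear_def hecke_poly_def free_poly_def hecke_const_def)
  next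
    case (single \<mu> a)
    have "hecke_poly q (Poly_Mapping.single \<mu> a) = hecke_const q a \<otimes>\<^bsub>hecke q\<^esub> hecke_X q \<mu>"
      by (simp only: hecke_poly_def free_poly_single hecke_class_mult hecke_const_def hecke_X_def)
    then show ?case
      using V.smult_assoc[of "hecke_const q a" "hecke_X q \<mu>" v]
      by (simp add: V_X V_const_const extend_linear_single)
  next
    case (add f h)
    have "hecke_poly q (f + h) = hecke_poly q f \<oplus>\<^bsub>hecke q\<^esub> hecke_poly q h"
      by (simp add: hecke_poly_def free_poly_add hecke_class_add)
    then show ?case
      using V.smult_l_distr[OF mem mem v_closed, of f h] add by (simp add: V_const_add extend_linear_plus)
  qed
qed

text \<open>The parabolic subalgebra acts on the first coordinate of the model as it acts on \<open>V\<close>, so the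
  pairing used below is balanced. The representative \<open>z\<close> in the free algebra is built along with
  the scalar \<open>b\<close>, because the model is a representation of the free algebra.\<close>

lemma parabolic_on_model:
  assumes "a \<in> carrier A"
  shows "\<exists>z b. a = hecke_class q z \<and> a \<odot>\<^bsub>V\<^esub> v = hecke_const q b \<odot>\<^bsub>V\<^esub> v \<and>
    (\<forall>c. model.act z (c, 0, 0, 0) = (b * c, 0, 0, 0))"
  using assms unfolding carrier_hecke_parabolic
proof (induction rule: generate_ring.induct)
  case one
  have "model.act 1 c = c" for c
    using model.act_const[of 1 c] by simp
  moreover have "\<one>\<^bsub>hecke q\<^esub> \<odot>\<^bsub>V\<^esub> v = hecke_const q 1 \<odot>\<^bsub>V\<^esub> v"
    by (simp add: hecke_const_def hecke_class_one)
  ultimately show ?case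
    by (intro exI[of _ 1]) (simp add: hecke_class_one)
next
  case (incl h)
  then consider "h = hecke_T q N2" | f where "h = hecke_poly q f" by blast
  then show ?case
  proof cases
    case 1
    then show ?thesis
      by (intro exI[of _ "free_T N2"] exI[of _ q])
        (simp add: V_T model.act_generator hecke_T_def[symmetric])
  next
    case 2
    then show ?thesis
      by (intro exI[of _ "free_poly f"] exI[of _ "extend_linear t f"])
        (simp add: poly_smult act_free_poly hecke_poly_def[symmetric])
  qed
next
  case (a_inv h)
  then obtain z b where z: "h = hecke_class q z" "h \<odot>\<^bsub>V\<^esub> v = hecke_const q b \<odot>\<^bsub>V\<^esub> v"
    "\<And>c. model.act z (c, 0, 0, 0) = (b * c, 0, 0, 0)"
    by blast
  have h: "h \<in> carrier A" using a_inv(1) by (simp add: carrier_hecke_parabolic)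
  have "free_const (- 1) * z = - z"
    by (simp add: single_uminus)
  then have "\<ominus>\<^bsub>hecke q\<^esub> h = hecke_const q (- 1) \<otimes>\<^bsub>hecke q\<^esub> h"
    by (simp only: z(1) hecke_const_def hecke_class_mult[symmetric] hecke_class_minus)
  then have "(\<ominus>\<^bsub>hecke q\<^esub> h) \<odot>\<^bsub>V\<^esub> v = hecke_const q (- b) \<odot>\<^bsub>V\<^esub> v"
    using V.smult_assoc[OF A_mem(1) h v_closed, of "- 1"] by (simp add: z(2) V_const_const)
  then show ?case
    by (intro exI[of _ "- z"] exI[of _ "- b"]) (simp add: z(1,3) hecke_class_minus model.act_minus)
next
  case (eng_add h k)
  then obtain z b y d where z: "h = hecke_class q z" "h \<odot>\<^bsub>V\<^esub> v = hecke_const q b \<odot>\<^bsub>V\<^esub> v"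
    "\<And>c. model.act z (c, 0, 0, 0) = (b * c, 0, 0, 0)"
    and y: "k = hecke_class q y" "k \<odot>\<^bsub>V\<^esub> v = hecke_const q d \<odot>\<^bsub>V\<^esub> v"
    "\<And>c. model.act y (c, 0, 0, 0) = (d * c, 0, 0, 0)"
    by blast
  have "h \<in> carrier A" "k \<in> carrier A" using eng_add(1,2) by (simp_all add: carrier_hecke_parabolic)
  then have "(h \<oplus>\<^bsub>hecke q\<^esub> k) \<odot>\<^bsub>V\<^esub> v = hecke_const q (b + d) \<odot>\<^bsub>V\<^esub> v"
    using V.smult_l_distr[of h k v] by (simp add: z(2) y(2) V_const_add)
  then show ?case
    by (intro exI[of _ "z + y"] exI[of _ "b + d"])
      (simp add: z(1,3) y(1,3) hecke_class_add model.act_add distrib_right)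
next
  case (eng_mult h k)
  then obtain z b y d where z: "h = hecke_class q z" "h \<odot>\<^bsub>V\<^esub> v = hecke_const q b \<odot>\<^bsub>V\<^esub> v"
    "\<And>c. model.act z (c, 0, 0, 0) = (b * c, 0, 0, 0)"
    and y: "k = hecke_class q y" "k \<odot>\<^bsub>V\<^esub> v = hecke_const q d \<odot>\<^bsub>V\<^esub> v"
    "\<And>c. model.act y (c, 0, 0, 0) = (d * c, 0, 0, 0)"
    by blast
  have mem: "h \<in> carrier A" "k \<in> carrier A" using eng_mult(1,2) by (simp_all add: carrier_hecke_parabolic)
  then have "(h \<otimes>\<^bsub>hecke q\<^esub> k) \<odot>\<^bsub>V\<^esub> v = hecke_const q (d * b) \<odot>\<^bsub>V\<^esub> v"
    using V.smult_assoc[of h k v] class_const_commute[of z d] by (simp add: z(1) y(2) z(2)[unfolded z(1)] V_const_const)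
  then show ?case
    by (intro exI[of _ "z * y"] exI[of _ "d * b"])
      (simp add: z(1,3) y(1,3) hecke_class_mult model.act_mult mult_ac)
qed

definition "gen = tensor (hecke q) A V \<one>\<^bsub>hecke q\<^esub> v"

lemma gen_closed: "gen \<in> carrier M"
  unfolding gen_def by (rule tensor_closed) simp_all

lemma smult_gen:
  assumes "a \<in> carrier A" "a \<odot>\<^bsub>V\<^esub> v = hecke_const q b \<odot>\<^bsub>V\<^esub> v"
  shows "a \<odot>\<^bsub>M\<^esub> gen = hecke_const q b \<odot>\<^bsub>M\<^esub> gen"
proof -
  have "c \<odot>\<^bsub>M\<^esub> gen = tensor (hecke q) A V \<one>\<^bsub>hecke q\<^esub> (c \<odot>\<^bsub>V\<^esub> v)" if "c \<in> carrier A" for c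
    using that smult_tensor[of c "\<one>\<^bsub>hecke q\<^esub>" v] tensor_balanced[of "\<one>\<^bsub>hecke q\<^esub>" c v] A_subset
    by (auto simp: gen_def)
  then show ?thesis using assms by simp
qed

sublocale M: standard_vector q t M gen
proof (intro standard_vector.intro standard_vector_axioms.intro special_module.intro
    special_weight_axioms hecke_module.intro left_module_induced)
  show "gen \<in> weight_space q M t"
    using gen_closed smult_gen[OF A_mem(2) V_X] by (simp add: weight_space_def)
  show "hecke_T q N2 \<odot>\<^bsub>M\<^esub> gen = hecke_const q q \<odot>\<^bsub>M\<^esub> gen"
    by (rule smult_gen[OF A_mem(3) V_T])
qed

lemma J_surj: "range M.J = carrier M"
proof (rule submodule_with_generator[of v])
  show "tensor (hecke q) A V \<one>\<^bsub>hecke q\<^esub> v \<in> range M.J"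
    using M.basis_J(1) unfolding gen_def[symmetric] by (rule range_eqI)
  show "\<exists>a\<in>carrier A. x = a \<odot>\<^bsub>V\<^esub> v" if "x \<in> carrier V" for x
    using coef[OF that] by blast
qed (rule v_closed M.co.submodule_range)+

text \<open>The inverse of \<open>J\<close> comes from the universal property, applied to the pairing of \<open>h\<close> with
  the multiple \<open>c v\<close> given by the action of \<open>h\<close> on \<open>(c, 0, 0, 0)\<close> in the model.\<close>

lemma J_inj: "inj M.J"
proof -
  define f where "f h x = model.act (SOME z. hecke_class q z = h) (coef x, 0, 0, 0)" for h x
  have f_class: "f (hecke_class q z) x = model.act z (coef x, 0, 0, 0)" for z x
  proof -
    have "hecke_class q (SOME y. hecke_class q y = hecke_class q z) = hecke_class q z"
      by (rule someI[of "\<lambda>y. hecke_class q y = hecke_class q z" z]) simp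
    then show ?thesis
      unfolding f_def by (rule act_cong)
  qed
  obtain e where e_add: "\<And>x y. \<lbrakk>x \<in> carrier M; y \<in> carrier M\<rbrakk> \<Longrightarrow> e (x \<oplus>\<^bsub>M\<^esub> y) = e x + e y"
    and e_tensor: "\<And>h x. \<lbrakk>h \<in> carrier (hecke q); x \<in> carrier V\<rbrakk> \<Longrightarrow> e (tensor (hecke q) A V h x) = f h x"
  proof (rule induced_universal[of f])
    show "f (h \<oplus>\<^bsub>hecke q\<^esub> k) x = f h x + f k x"
      if "h \<in> carrier (hecke q)" "k \<in> carrier (hecke q)" "x \<in> carrier V" for h k x
      using that by (auto simp: carrier_hecke hecke_class_add[symmetric] f_class model.act_add)
    show "f h (x \<oplus>\<^bsub>V\<^esub> y) = f h x + f h y"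
      if "h \<in> carrier (hecke q)" "x \<in> carrier V" "y \<in> carrier V" for h x y
      using that by (auto simp: carrier_hecke f_class coef_add model.act_right_add[symmetric])
    show "f (h \<otimes>\<^bsub>hecke q\<^esub> a) x = f h (a \<odot>\<^bsub>V\<^esub> x)"
      if "h \<in> carrier (hecke q)" "a \<in> carrier A" "x \<in> carrier V" for h a x
    proof -
      from that(1) obtain y where y: "h = hecke_class q y" by (auto simp: carrier_hecke)
      from parabolic_on_model[OF that(2)] obtain z b where z: "a = hecke_class q z" "a \<odot>\<^bsub>V\<^esub> v = hecke_const q b \<odot>\<^bsub>V\<^esub> v"
        "\<And>c. model.act z (c, 0, 0, 0) = (b * c, 0, 0, 0)"
        by blast
      have "a \<odot>\<^bsub>V\<^esub> x = hecke_const q (coef x * b) \<odot>\<^bsub>V\<^esub> v"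
        using class_const_commute[of z "coef x"] that(2) coef[OF that(3)] z(1,2) V_const_const by metis
      then show ?thesis
        by (simp add: y z(1,3) hecke_class_mult[symmetric] f_class model.act_mult coef_const mult.commute)
    qed
  qed blast
  have e_zero: "e \<zero>\<^bsub>M\<^esub> = 0"
    using e_add[of "\<zero>\<^bsub>M\<^esub>" "\<zero>\<^bsub>M\<^esub>"] by simp
  have e_diff: "e (x \<ominus>\<^bsub>M\<^esub> y) = e x - e y" if "x \<in> carrier M" "y \<in> carrier M" for x y
    using e_add[of "x \<ominus>\<^bsub>M\<^esub> y" y] that by (simp add: M.M.minus_eq M.M.a_assoc M.M.l_neg)
  have e_smult: "e (hecke_class q y \<odot>\<^bsub>M\<^esub> x) = model.act y (e x)" if "x \<in> carrier M" for x y
    using that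
  proof (induction rule: induced_induct)
    case zero
    then show ?case by (simp add: M.smult_zero_right e_zero model.act_right_zero)
  next
    case (tensor h x)
    then obtain z where z: "h = hecke_class q z" by (auto simp: carrier_hecke)
    have "f (hecke_class q y \<otimes>\<^bsub>hecke q\<^esub> h) x = model.act y (f h x)"
      by (simp only: z hecke_class_mult[symmetric] f_class model.act_mult)
    then show ?case
      using tensor by (simp add: smult_tensor e_tensor)
  next
    case (diff x z)
    then have "hecke_class q y \<odot>\<^bsub>M\<^esub> (x \<ominus>\<^bsub>M\<^esub> z) = hecke_class q y \<odot>\<^bsub>M\<^esub> x \<ominus>\<^bsub>M\<^esub> hecke_class q y \<odot>\<^bsub>M\<^esub> z"
      by (simp add: M.M.minus_eq M.smult_r_distr M.smult_minus)
    then show ?case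
      using diff by (simp add: e_diff) (metis add_diff_cancel_right' diff_add_cancel model.act_right_add)
  qed
  have e_ops: "e (hecke_const q a \<odot>\<^bsub>M\<^esub> x) = scale4 a (e x)" "e (hecke_T q i \<odot>\<^bsub>M\<^esub> x) = gen4 (T i) (e x)"
    if "x \<in> carrier M" for x a i
    unfolding hecke_const_def hecke_T_def e_smult[OF that] model.act_const model.act_generator by simp_all
  have "v = hecke_const q 1 \<odot>\<^bsub>V\<^esub> v"
    using V.smult_one[OF v_closed] by (simp add: hecke_const_def hecke_class_one)
  then have "coef v = 1" using coef_const by metis
  then have gen: "e gen = (1, 0, 0, 0)"
    using f_class[of 1 v] model.act_const[of 1] by (simp add: gen_def e_tensor hecke_class_one)
  have w: "e M.w = (0, 1, 0, 0)"
    by (simp add: M.w_def e_ops gen)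
  have n: "e M.n = (0, 0, 1, 0)"
    by (simp add: M.n_def M.lin_def e_add e_ops gen w)
  have m: "e M.m = (0, 0, 0, 1)"
    by (simp add: M.m_def e_add e_ops n)
  have "e (M.J c) = c" for c
    by (cases c) (simp add: M.J.simps M.lin_def e_add e_ops gen w n m)
  then show ?thesis by (metis injI)
qed

end

section \<open>The two-dimensional quotient\<close>

text \<open>A coordinate map is determined by the image of the first basis vector, which generates the
  model. Hence the coordinates of a quotient are the map \<open>J\<close> of the image of \<open>u\<close>.\<close>

lemma (in special_weight) standard_from_coordinates:
  assumes "coordinates scale4 gen4 q L J"
  shows "standard_vector q t L (J (1, 0, 0, 0))"
    and "standard_vector.J q L (J (1, 0, 0, 0)) = J"
proof -
  interpret J: coordinates scale4 gen4 q L J by fact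
  let ?u = "J (1, 0, 0, 0)"
  have X: "hecke_X q \<mu> \<odot>\<^bsub>L\<^esub> ?u = hecke_const q (t \<mu>) \<odot>\<^bsub>L\<^esub> ?u" for \<mu>
    by (simp add: J.J_X[symmetric] J.J_scale[symmetric])
  have T: "hecke_T q N2 \<odot>\<^bsub>L\<^esub> ?u = hecke_const q q \<odot>\<^bsub>L\<^esub> ?u"
    by (simp add: J.J_T[symmetric] J.J_scale[symmetric])
  show st: "standard_vector q t L ?u"
    by (intro standard_vector.intro standard_vector_axioms.intro special_module.intro
        special_weight_axioms J.L.hecke_module_axioms)
      (simp_all add: weight_space_def X T)
  interpret s: standard_vector q t L ?u by (rule st)
  have w: "s.w = J (0, 1, 0, 0)"
    by (simp add: s.w_def J.J_T[symmetric])
  have n: "s.n = J (0, 0, 1, 0)"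
    by (simp add: s.n_def s.lin_def w J.J_T[symmetric] J.J_scale[symmetric] J.J_add[symmetric])
  have m: "s.m = J (0, 0, 0, 1)"
    by (simp add: s.m_def n J.J_T[symmetric] J.J_scale[symmetric] J.J_add[symmetric])
  show "s.J = J"
  proof
    fix c show "s.J c = J c"
      by (cases c) (simp add: s.J.simps s.lin_def w n m J.J_scale[symmetric] J.J_add[symmetric])
  qed
qed

lemma (in special_weight) top_module_from_coordinates:
  assumes J: "coordinates scale4 gen4 q L J" and "range J = carrier L"
    and kernel: "\<And>\<alpha> \<beta> \<gamma> \<delta>. J (\<alpha>, \<beta>, \<gamma>, \<delta>) = \<zero>\<^bsub>L\<^esub> \<longleftrightarrow> \<alpha> = 0 \<and> \<beta> = 0"
  shows "top_module q t L (J (1, 0, 0, 0))"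
proof -
  interpret s: standard_vector q t L "J (1, 0, 0, 0)"
    by (rule standard_from_coordinates(1)[OF J])
  show ?thesis
    by (intro top_module.intro top_module_axioms.intro s.standard_vector_axioms)
      (use assms in \<open>auto simp: standard_from_coordinates(2)[OF J] s.low23_def\<close>)
qed

lemma a_r_coset_carrier_update [simp]: "N +>\<^bsub>L\<lparr>carrier := C\<rparr>\<^esub> x = N +>\<^bsub>L\<^esub> x"
  by (simp add: a_r_coset_def')

text \<open>The induced module in the only form in which it is used from here on: a copy of the model.\<close>

locale free_standard = standard_vector q t L u
  for q t and L :: "(hecke_elt, 'b) module" and u +
  assumes J_surj: "range J = carrier L" and J_inj: "inj J"
begin

definition "low2 = {(0, 0, \<gamma>, 0) | \<gamma> :: complex. True}"

lemma J_zero_iff: "J c = \<zero>\<^bsub>L\<^esub> \<longleftrightarrow> c = 0"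
  using J_inj co.J_zero by (metis injD)

lemma J_image_iff: "J c \<in> J ` U \<longleftrightarrow> c \<in> U"
  using J_inj by (auto dest: injD)

text \<open>The four-dimensional model has the weights \<open>t\<close> (twice), \<open>s\<^sub>2 t\<close> and \<open>s\<^sub>1 s\<^sub>2 t\<close>. A single lattice element
  separates one of the last two from the others: \<open>\<omega>\<^sub>1\<close> for \<open>s\<^sub>1 s\<^sub>2 t\<close>, and \<open>s\<^sub>1 \<omega>\<^sub>1\<close> for \<open>s\<^sub>2 t\<close>.\<close>

lemma weight_spaces: "weight_space q L t12 = J ` low3" "weight_space q L t2 = J ` low2"
proof -
  have eq: "J c \<in> weight_space q L s \<longleftrightarrow> (\<forall>\<mu>. gen4 (X \<mu>) c = scale4 (s \<mu>) c)" for c s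
    unfolding weight_space_def
    by (simp add: co.J_X[symmetric] scal_J inj_eq[OF J_inj] del: split_paired_All)
  have ws: "weight_space q L s = J ` U" if "\<And>c. (\<forall>\<mu>. gen4 (X \<mu>) c = scale4 (s \<mu>) c) \<longleftrightarrow> c \<in> U" for s U
  proof
    show "weight_space q L s \<subseteq> J ` U"
    proof
      fix x assume x: "x \<in> weight_space q L s"
      then have "x \<in> range J"
        unfolding J_surj by (rule weight_spaceD(1))
      then obtain c where "x = J c" by blast
      with x show "x \<in> J ` U" using eq that by simp
    qed
    show "J ` U \<subseteq> weight_space q L s"
      by (rule image_subsetI) (simp only: eq that)
  qed
  show "weight_space q L t12 = J ` low3"
  proof (rule ws)
    fix c show "(\<forall>\<mu>. gen4 (X \<mu>) c = scale4 (t12 \<mu>) c) \<longleftrightarrow> c \<in> low3"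
    proof
      assume "\<forall>\<mu>. gen4 (X \<mu>) c = scale4 (t12 \<mu>) c"
      from spec[OF this, of "(1, 0)"] show "c \<in> low3" by (cases c) (auto simp: low3_def)
    qed (auto simp: low3_def)
  qed
  show "weight_space q L t2 = J ` low2"
  proof (rule ws)
    fix c show "(\<forall>\<mu>. gen4 (X \<mu>) c = scale4 (t2 \<mu>) c) \<longleftrightarrow> c \<in> low2"
    proof
      assume "\<forall>\<mu>. gen4 (X \<mu>) c = scale4 (t2 \<mu>) c"
      from spec[OF this, of "(- 1, 1)"] show "c \<in> low2" by (cases c) (auto simp: low2_def)
    qed (auto simp: low2_def)
  qed
qed

text \<open>The first quotient has coordinates \<open>J1\<close>. There \<open>m\<close> has become zero, so the image of the
  line of \<open>n\<close> is the image of the span of \<open>n\<close> and \<open>m\<close>.\<close>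

abbreviation "Q1 \<equiv> quotient_module L (J ` low3)"
definition "J1 c = J ` low3 +>\<^bsub>L\<^esub> J c"

lemma J1: "coordinates scale4 gen4 q Q1 J1"
  unfolding J1_def by (rule co.coordinates_quotient[OF submodule_low3])

lemma J1_surj: "range J1 = carrier Q1"
  unfolding quotient_module(2)[OF left_module_axioms submodule_low3] J1_def J_surj[symmetric]
  by auto

lemma J1_zero_iff: "J1 c = \<zero>\<^bsub>Q1\<^esub> \<longleftrightarrow> c \<in> low3"
  using quotient_module(6)[OF left_module_axioms submodule_low3, of "J c"]
  by (simp add: quotient_module(5)[OF left_module_axioms submodule_low3] J1_def J_image_iff)

lemma J1_low2: "J1 ` low2 = J1 ` low23"
proof -
  interpret J1: coordinates scale4 gen4 q Q1 J1 by (rule J1)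
  have eq: "J1 (0, 0, \<gamma>, \<delta>) = J1 (0, 0, \<gamma>, 0)" for \<gamma> \<delta>
    using J1.J_eq_iff[of "(0, 0, \<gamma>, \<delta>)" "(0, 0, \<gamma>, 0)"] J1_zero_iff[of "(0, 0, 0, \<delta>)"]
    by (simp add: low3_def)
  show ?thesis
  proof
    show "J1 ` low2 \<subseteq> J1 ` low23"
      by (rule image_mono) (auto simp: low2_def low23_def)
    show "J1 ` low23 \<subseteq> J1 ` low2"
    proof (rule image_subsetI)
      fix c assume "c \<in> low23"
      then obtain \<gamma> \<delta> where "c = (0, 0, \<gamma>, \<delta>)" by (auto simp: low23_def)
      then have "J1 c = J1 (0, 0, \<gamma>, 0)" using eq[of \<gamma> \<delta>] by simp
      moreover have "(0, 0, \<gamma>, 0) \<in> low2" by (simp add: low2_def)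
      ultimately show "J1 c \<in> J1 ` low2" by (metis imageI)
    qed
  qed
qed

lemma submodule_J1_low2: "submodule (J1 ` low2) (hecke q) Q1"
proof -
  interpret s: standard_vector q t Q1 "J1 (1, 0, 0, 0)"
    by (rule standard_from_coordinates(1)[OF J1])
  show ?thesis
    using s.submodule_low23
    by (simp add: standard_from_coordinates(2)[OF J1] J1_low2 s.low23_def low23_def)
qed

lemma top_module_Q2: "\<exists>x. top_module q t (quotient_module Q1 (J1 ` low2)) x"
proof -
  interpret J1: coordinates scale4 gen4 q Q1 J1 by (rule J1)
  note quot = quotient_module[OF J1.L.left_module_axioms submodule_J1_low2]
  let ?Q2 = "quotient_module Q1 (J1 ` low2)" and ?J2 = "\<lambda>c. J1 ` low2 +>\<^bsub>Q1\<^esub> J1 c"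
  have "top_module q t ?Q2 (?J2 (1, 0, 0, 0))"
  proof (rule top_module_from_coordinates)
  show "coordinates scale4 gen4 q ?Q2 ?J2"
    by (rule J1.coordinates_quotient[OF submodule_J1_low2])
  show "range ?J2 = carrier ?Q2"
    unfolding quot(2) J1_surj[symmetric] by auto
  show "?J2 (\<alpha>, \<beta>, \<gamma>, \<delta>) = \<zero>\<^bsub>?Q2\<^esub> \<longleftrightarrow> \<alpha> = 0 \<and> \<beta> = 0" for \<alpha> \<beta> \<gamma> \<delta>
  proof -
    have "?J2 (\<alpha>, \<beta>, \<gamma>, \<delta>) = \<zero>\<^bsub>?Q2\<^esub> \<longleftrightarrow> J1 (\<alpha>, \<beta>, \<gamma>, \<delta>) \<in> J1 ` low23"
      unfolding quot(5) quot(6)[OF J1.J_closed] by (simp only: J1_low2)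
    also have "\<dots> \<longleftrightarrow> (\<exists>c\<in>low23. (\<alpha>, \<beta>, \<gamma>, \<delta>) - c \<in> low3)"
      by (simp only: image_iff J1.J_eq_iff J1_zero_iff)
    also have "\<dots> \<longleftrightarrow> \<alpha> = 0 \<and> \<beta> = 0"
      by (auto simp: low23_def low3_def zero_prod_def)
    finally show ?thesis .
  qed
  qed
  then show ?thesis by blast
qed

lemma weight_filtration:
  "let M_1 = quotient_module L (weight_space q L t12);
       K = (\<lambda>m. weight_space q L t12 +>\<^bsub>L\<^esub> m) ` weight_space q L t2
   in submodule (weight_space q L t12) (hecke q) L \<and> submodule K (hecke q) M_1 \<and>
      complex_dimension q (quotient_module M_1 K) 2 \<and>
      irreducible_module (hecke q) (quotient_module M_1 K)"
proof -
  obtain x where x: "top_module q t (quotient_module Q1 (J1 ` low2)) x"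
    using top_module_Q2 by blast
  have K: "(\<lambda>m. J ` low3 +>\<^bsub>L\<^esub> m) ` J ` low2 = J1 ` low2"
    by (simp add: image_image J1_def)
  show ?thesis
    unfolding weight_spaces K Let_def
    using submodule_low3 submodule_J1_low2 top_module.dimension_top[OF x] top_module.irreducible_top[OF x]
    by blast
qed

end

section \<open>Composition factors\<close>

lemma module_isomorphic_trans:
  assumes "module_isomorphic R L L'" "module_isomorphic R L' L''"
  shows "module_isomorphic R L L''"
proof -
  obtain f where f: "bij_betw f (carrier L) (carrier L')"
    "\<And>x y. x \<in> carrier L \<Longrightarrow> y \<in> carrier L \<Longrightarrow> f (x \<oplus>\<^bsub>L\<^esub> y) = f x \<oplus>\<^bsub>L'\<^esub> f y"
    "\<And>a x. a \<in> carrier R \<Longrightarrow> x \<in> carrier L \<Longrightarrow> f (a \<odot>\<^bsub>L\<^esub> x) = a \<odot>\<^bsub>L'\<^esub> f x"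
    using assms(1) unfolding module_isomorphic_def by blast
  obtain h where h: "bij_betw h (carrier L') (carrier L'')"
    "\<And>x y. x \<in> carrier L' \<Longrightarrow> y \<in> carrier L' \<Longrightarrow> h (x \<oplus>\<^bsub>L'\<^esub> y) = h x \<oplus>\<^bsub>L''\<^esub> h y"
    "\<And>a x. a \<in> carrier R \<Longrightarrow> x \<in> carrier L' \<Longrightarrow> h (a \<odot>\<^bsub>L'\<^esub> x) = a \<odot>\<^bsub>L''\<^esub> h x"
    using assms(2) unfolding module_isomorphic_def by blast
  have "f x \<in> carrier L'" if "x \<in> carrier L" for x
    using f(1) that by (auto simp: bij_betw_def)
  then show ?thesis
    unfolding module_isomorphic_def
    by (intro exI[of _ "h \<circ> f"]) (auto simp: bij_betw_trans[OF f(1) h(1)] f h)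
qed

context special_module
begin

text \<open>Used for the two one-dimensional factors of the composition series. The last equation transports
  the action of the generators from \<open>x\<close> to its coset.\<close>

lemma quotient_line:
  assumes N: "submodule N (hecke q) L" and N': "submodule N' (hecke q) L" and sub: "N \<subseteq> N'"
    and x: "x \<in> N'" "x \<notin> N" and span: "\<And>y. y \<in> N' \<Longrightarrow> \<exists>a. \<exists>z\<in>N. y = z \<oplus>\<^bsub>L\<^esub> scal a x"
  defines "Q \<equiv> quotient_module (L\<lparr>carrier := N'\<rparr>) N"
  shows "special_module q t Q" and "irreducible_module (hecke q) Q"
    and "N +>\<^bsub>L\<^esub> x \<in> carrier Q" "N +>\<^bsub>L\<^esub> x \<noteq> \<zero>\<^bsub>Q\<^esub>"
    and "carrier Q = range (\<lambda>a. hecke_const q a \<odot>\<^bsub>Q\<^esub> (N +>\<^bsub>L\<^esub> x))"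
    and "\<And>h. hecke_class q h \<odot>\<^bsub>Q\<^esub> (N +>\<^bsub>L\<^esub> x) = N +>\<^bsub>L\<^esub> (hecke_class q h \<odot>\<^bsub>L\<^esub> x)"
proof -
  note L' = left_module_submodule[OF N']
  note quot = quotient_module[OF L' submodule_of_submodule[OF N N' sub], folded Q_def, simplified]
  interpret Q: special_module q t Q
    by (intro special_module.intro special_weight_axioms hecke_module.intro quot(1))
  show "special_module q t Q" by (rule Q.special_module_axioms)
  show mem: "N +>\<^bsub>L\<^esub> x \<in> carrier Q" unfolding quot(2) using x by blast
  show nz: "N +>\<^bsub>L\<^esub> x \<noteq> \<zero>\<^bsub>Q\<^esub>" using quot(5,6) x by simp
  show smult: "hecke_class q h \<odot>\<^bsub>Q\<^esub> (N +>\<^bsub>L\<^esub> x) = N +>\<^bsub>L\<^esub> (hecke_class q h \<odot>\<^bsub>L\<^esub> x)" for h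
    using quot(4) x by simp
  have "N +>\<^bsub>L\<^esub> y \<in> range (\<lambda>a. hecke_const q a \<odot>\<^bsub>Q\<^esub> (N +>\<^bsub>L\<^esub> x))" if y: "y \<in> N'" for y
  proof -
    obtain a z where z: "z \<in> N" "y = z \<oplus>\<^bsub>L\<^esub> scal a x"
      using span[OF y] by blast
    have ax: "scal a x \<in> N'"
      using submodule_memD(5)[OF N' _ x(1)] by (simp add: hecke_const_def)
    have "N +>\<^bsub>L\<^esub> y = (N +>\<^bsub>L\<^esub> z) \<oplus>\<^bsub>Q\<^esub> (N +>\<^bsub>L\<^esub> scal a x)"
      using quot(3)[of z "scal a x"] z ax sub by auto
    also have "N +>\<^bsub>L\<^esub> z = \<zero>\<^bsub>Q\<^esub>"
      using quot(5,6) z(1) sub by auto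
    also have "N +>\<^bsub>L\<^esub> scal a x = hecke_const q a \<odot>\<^bsub>Q\<^esub> (N +>\<^bsub>L\<^esub> x)"
      using smult by (simp add: hecke_const_def)
    finally show ?thesis using mem by simp
  qed
  then show carrier: "carrier Q = range (\<lambda>a. hecke_const q a \<odot>\<^bsub>Q\<^esub> (N +>\<^bsub>L\<^esub> x))"
    unfolding quot(2) using mem Q.op_closed(1) by (auto simp: quot(2))
  show "irreducible_module (hecke q) Q"
    by (rule Q.irreducible_line[OF mem nz carrier])
qed

fun line_gen :: "(lattice \<Rightarrow> complex) \<Rightarrow> generator \<Rightarrow> complex \<Rightarrow> complex" where
  "line_gen s (T i) c = q * c"
| "line_gen s (X \<mu>) c = s \<mu> * c"

lemma line_coordinates:
  assumes "x \<in> weight_space q L s" "\<And>i. TT i x = scal q x"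
  shows "coordinates (*) (line_gen s) q L (\<lambda>a. scal a x)"
proof
  fix g and a b c :: complex
  show "line_gen s g (a + b) = line_gen s g a + line_gen s g b" "line_gen s g (a * c) = a * line_gen s g c"
    by (cases g; simp add: algebra_simps)+
qed (use weight_spaceD[OF assms(1)] assms(2) in \<open>auto simp: algebra_simps scal_add scal_scal op_scal\<close>)

end

lemma lines_isomorphic:
  assumes "special_module q t L" "special_module q t L'"
    and x: "x \<in> weight_space q L s" "\<And>i. hecke_T q i \<odot>\<^bsub>L\<^esub> x = hecke_const q q \<odot>\<^bsub>L\<^esub> x" "x \<noteq> \<zero>\<^bsub>L\<^esub>"
      "range (\<lambda>a. hecke_const q a \<odot>\<^bsub>L\<^esub> x) = carrier L"
    and x': "x' \<in> weight_space q L' s" "\<And>i. hecke_T q i \<odot>\<^bsub>L'\<^esub> x' = hecke_const q q \<odot>\<^bsub>L'\<^esub> x'"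
      "x' \<noteq> \<zero>\<^bsub>L'\<^esub>" "range (\<lambda>a. hecke_const q a \<odot>\<^bsub>L'\<^esub> x') = carrier L'"
  shows "module_isomorphic (hecke q) L L'"
proof -
  interpret L: special_module q t L by fact
  interpret L': special_module q t L' by fact
  interpret J: coordinates "(*)" "L.line_gen s" q L "\<lambda>a. hecke_const q a \<odot>\<^bsub>L\<^esub> x"
    by (rule L.line_coordinates[OF x(1,2)])
  show ?thesis
    by (rule J.isomorphic_if_same_kernel[OF L'.line_coordinates[OF x'(1,2)] x(4) x'(4)])
      (use x x' L.weight_spaceD L'.weight_spaceD in \<open>simp add: L.scal_eq_zero_iff L'.scal_eq_zero_iff\<close>)
qed

lemma tops_isomorphic:
  assumes "top_module q t L x" "top_module q t L' x'"
  shows "module_isomorphic (hecke q) L L'"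
proof -
  interpret L: top_module q t L x by fact
  interpret L': top_module q t L' x' by fact
  show ?thesis
  proof (rule L.co.isomorphic_if_same_kernel[OF L'.co.coordinates_axioms L.J_surj L'.J_surj])
    show "L.J c = \<zero>\<^bsub>L\<^esub> \<longleftrightarrow> L'.J c = \<zero>\<^bsub>L'\<^esub>" for c
      by (cases c) (simp add: L.kernel_J L'.kernel_J)
  qed
qed

text \<open>The vectors that identify a simple module as a composition factor of the module induced from
  \<open>t\<close>: a vector of weight \<open>t\<close> makes it a quotient of the induced module, one of weight \<open>s\<^sub>2 t\<close> makes
  it one-dimensional.\<close>

definition (in special_module) good_vector :: "'b \<Rightarrow> bool" where
  "good_vector x \<longleftrightarrow> x \<noteq> \<zero>\<^bsub>L\<^esub> \<and> TT N2 x = scal q x \<and>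
     (x \<in> weight_space q L t \<or> x \<in> weight_space q L t2 \<and> TT N1 x = scal q x)"

context special_module
begin

text \<open>In a simple module the submodule of \<open>n\<close> and \<open>m\<close> is zero or everything. It cannot contain \<open>u\<close>,
  whose weight \<open>t\<close> differs from those of \<open>n\<close> and \<open>m\<close>; so it is zero, and \<open>u\<close> generates a top module.\<close>

lemma simple_top:
  assumes irr: "irreducible_module (hecke q) L" and u: "u \<noteq> \<zero>\<^bsub>L\<^esub>" "TT N2 u = scal q u" "u \<in> weight_space q L t"
  shows "top_module q t L u"
proof -
  interpret standard_vector q t L u
    by unfold_locales (rule u)+
  have simple: "N = {\<zero>\<^bsub>L\<^esub>} \<or> N = carrier L" if "submodule N (hecke q) L" for N
    using irr that unfolding irreducible_module_def by blast
  have "u \<notin> J ` low23"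
  proof
    assume "u \<in> J ` low23"
    then obtain \<gamma> \<delta> where uJ: "u = J (0, 0, \<gamma>, \<delta>)" by (auto simp: low23_def)
    \<comment> \<open>\<open>\<omega>\<^sub>1\<close> separates the weight of \<open>m\<close> from those of \<open>u\<close> and \<open>n\<close>, then \<open>s\<^sub>1 \<omega>\<^sub>1\<close> those of \<open>u\<close> and \<open>n\<close>.
      The factor \<open>\<iota> / 2\<close> is the inverse of \<open>- 2 \<iota>\<close>.\<close>
    have \<delta>: "J (0, 0, 0, \<delta>) = \<zero>\<^bsub>L\<^esub>"
    proof -
      have "J (0, 0, \<iota> * \<gamma>, - \<iota> * \<delta>) = J (0, 0, \<iota> * \<gamma>, \<iota> * \<delta>)"
        using X_u[of "(1, 0)"] scal_basis(1)[of \<iota>] co.J_X[of "(1, 0)" "(0, 0, \<gamma>, \<delta>)"]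
          scal_J[of \<iota> "(0, 0, \<gamma>, \<delta>)"] by (simp add: uJ[symmetric])
      then have "J (0, 0, 0, - 2 * \<iota> * \<delta>) = \<zero>\<^bsub>L\<^esub>"
        by (simp add: co.J_eq_iff zero_prod_def mult_ac)
      then show ?thesis
        using scal_J[of "\<iota> / 2" "(0, 0, 0, - 2 * \<iota> * \<delta>)"] by simp
    qed
    then have uJ': "u = J (0, 0, \<gamma>, 0)"
      using J_add[of "(0, 0, \<gamma>, 0)" "(0, 0, 0, \<delta>)"] uJ by simp
    have "J (0, 0, - \<iota> * \<gamma>, 0) = J (0, 0, \<iota> * \<gamma>, 0)"
      using X_u[of "(- 1, 1)"] scal_basis(1)[of \<iota>] co.J_X[of "(- 1, 1)" "(0, 0, \<gamma>, 0)"]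
        scal_J[of \<iota> "(0, 0, \<gamma>, 0)"] by (simp add: uJ'[symmetric])
    then have "J (0, 0, - 2 * \<iota> * \<gamma>, 0) = \<zero>\<^bsub>L\<^esub>"
      by (simp add: co.J_eq_iff zero_prod_def mult_ac)
    then have "J (0, 0, \<gamma>, 0) = \<zero>\<^bsub>L\<^esub>"
      using scal_J[of "\<iota> / 2" "(0, 0, - 2 * \<iota> * \<gamma>, 0)"] by simp
    then show False using u(1) uJ' by simp
  qed
  then have "J ` low23 = {\<zero>\<^bsub>L\<^esub>}"
    using simple[OF submodule_low23] basis_closed(1) by blast
  moreover have "range J \<noteq> {\<zero>\<^bsub>L\<^esub>}"
    using basis_J(1) u(1) by blast
  then have "range J = carrier L"
    using simple[OF co.submodule_range] by blast
  ultimately show ?thesis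
    by unfold_locales (use u in auto)
qed

lemma simple_line:
  assumes irr: "irreducible_module (hecke q) L" and x: "x \<noteq> \<zero>\<^bsub>L\<^esub>" "x \<in> weight_space q L s" "\<And>i. TT i x = scal q x"
  shows "range (\<lambda>a. scal a x) = carrier L"
proof -
  interpret co: coordinates "(*)" "line_gen s" q L "\<lambda>a. scal a x"
    by (rule line_coordinates[OF x(2,3)])
  have "scal 1 x = x"
    using weight_spaceD(1)[OF x(2)] by simp
  then have "range (\<lambda>a. scal a x) \<noteq> {\<zero>\<^bsub>L\<^esub>}"
    using x(1) by (metis rangeI singletonD)
  then show ?thesis
    using irr co.submodule_range unfolding irreducible_module_def by blast
qed

end

context free_standard
begin

text \<open>Zero, the line of \<open>m\<close>, the plane of \<open>n\<close> and \<open>m\<close>, and everything. The factors are simple of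
  dimensions one, one and two.\<close>

definition "series = [{\<zero>\<^bsub>L\<^esub>}, J ` low3, J ` low23, carrier L]"

abbreviation "factor i \<equiv> quotient_module (L\<lparr>carrier := series ! Suc i\<rparr>) (series ! i)"

lemma bottom_factor: "irreducible_module (hecke q) (factor 0)"
proof -
  have "irreducible_module (hecke q) (quotient_module (L\<lparr>carrier := J ` low3\<rparr>) {\<zero>\<^bsub>L\<^esub>})"
  proof (rule quotient_line(2)[OF submodule_zero submodule_low3, of m])
    show "{\<zero>\<^bsub>L\<^esub>} \<subseteq> J ` low3" using submodule_memD(2)[OF submodule_low3] by simp
    show "m \<in> J ` low3" unfolding basis_J(4) by (auto simp: low3_def)
    show "m \<notin> {\<zero>\<^bsub>L\<^esub>}" unfolding basis_J(4) by (simp add: J_zero_iff zero_prod_def)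
    show "\<exists>a. \<exists>z\<in>{\<zero>\<^bsub>L\<^esub>}. y = z \<oplus>\<^bsub>L\<^esub> scal a m" if "y \<in> J ` low3" for y
      using that by (auto simp: low3_def scal_basis)
  qed
  then show ?thesis by (simp add: series_def)
qed

lemma middle_line:
  shows "special_module q t (factor 1)" and "irreducible_module (hecke q) (factor 1)"
    and "J ` low3 +>\<^bsub>L\<^esub> n \<in> carrier (factor 1)" "J ` low3 +>\<^bsub>L\<^esub> n \<noteq> \<zero>\<^bsub>factor 1\<^esub>"
    and "carrier (factor 1) = range (\<lambda>a. hecke_const q a \<odot>\<^bsub>factor 1\<^esub> (J ` low3 +>\<^bsub>L\<^esub> n))"
    and "\<And>h. hecke_class q h \<odot>\<^bsub>factor 1\<^esub> (J ` low3 +>\<^bsub>L\<^esub> n) = J ` low3 +>\<^bsub>L\<^esub> (hecke_class q h \<odot>\<^bsub>L\<^esub> n)"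
proof -
  have series: "series ! Suc 1 = J ` low23" "series ! 1 = J ` low3" by (simp_all add: series_def)
  have sub: "J ` low3 \<subseteq> J ` low23" by (auto simp: low3_def low23_def)
  have n: "n \<in> J ` low23" "n \<notin> J ` low3"
    unfolding basis_J(3) J_image_iff by (simp_all add: low3_def low23_def)
  have span: "\<exists>a. \<exists>z\<in>J ` low3. y = z \<oplus>\<^bsub>L\<^esub> scal a n" if "y \<in> J ` low23" for y
  proof -
    from that obtain \<gamma> \<delta> where "y = J (0, 0, \<gamma>, \<delta>)" by (auto simp: low23_def)
    then have "y = J (0, 0, 0, \<delta>) \<oplus>\<^bsub>L\<^esub> scal \<gamma> n" by (simp add: scal_basis J_add)
    moreover have "J (0, 0, 0, \<delta>) \<in> J ` low3" by (auto simp: low3_def)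
    ultimately show ?thesis by blast
  qed
  note * = quotient_line[OF submodule_low3 submodule_low23 sub n span]
  show "special_module q t (factor 1)" "irreducible_module (hecke q) (factor 1)"
    "J ` low3 +>\<^bsub>L\<^esub> n \<in> carrier (factor 1)" "J ` low3 +>\<^bsub>L\<^esub> n \<noteq> \<zero>\<^bsub>factor 1\<^esub>"
    "carrier (factor 1) = range (\<lambda>a. hecke_const q a \<odot>\<^bsub>factor 1\<^esub> (J ` low3 +>\<^bsub>L\<^esub> n))"
    "\<And>h. hecke_class q h \<odot>\<^bsub>factor 1\<^esub> (J ` low3 +>\<^bsub>L\<^esub> n) = J ` low3 +>\<^bsub>L\<^esub> (hecke_class q h \<odot>\<^bsub>L\<^esub> n)"
    unfolding series by (rule *; assumption)+
qed

lemma top_factor: "\<exists>x. top_module q t (factor 2) x"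
proof -
  note quot = quotient_module[OF left_module_axioms submodule_low23]
  have "top_module q t (quotient_module L (J ` low23)) (J ` low23 +>\<^bsub>L\<^esub> J (1, 0, 0, 0))"
  proof (rule top_module_from_coordinates)
    show "coordinates scale4 gen4 q (quotient_module L (J ` low23)) (\<lambda>c. J ` low23 +>\<^bsub>L\<^esub> J c)"
      by (rule co.coordinates_quotient[OF submodule_low23])
    show "range (\<lambda>c. J ` low23 +>\<^bsub>L\<^esub> J c) = carrier (quotient_module L (J ` low23))"
      unfolding quot(2) J_surj[symmetric] by auto
    show "J ` low23 +>\<^bsub>L\<^esub> J (\<alpha>, \<beta>, \<gamma>, \<delta>) = \<zero>\<^bsub>quotient_module L (J ` low23)\<^esub> \<longleftrightarrow> \<alpha> = 0 \<and> \<beta> = 0" for \<alpha> \<beta> \<gamma> \<delta>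
      unfolding quot(5) quot(6)[OF J_closed] J_image_iff by (simp add: low23_def)
  qed
  moreover have "factor 2 = quotient_module L (J ` low23)"
    by (simp add: series_def)
  ultimately show ?thesis by metis
qed

lemma composition_series: "composition_series (hecke q) L series"
proof -
  obtain y where "top_module q t (factor 2) y" using top_factor by blast
  then have top: "irreducible_module (hecke q) (factor 2)"
    by (rule top_module.irreducible_top)
  have "irreducible_module (hecke q) (factor i)" "series ! i \<subseteq> series ! Suc i" if "i < 3" for i
  proof -
    have "i = 0 \<or> i = 1 \<or> i = 2" using that by auto
    then show "irreducible_module (hecke q) (factor i)"
      by (elim disjE) (simp_all only: bottom_factor middle_line(2) top)
    from \<open>i = 0 \<or> i = 1 \<or> i = 2\<close> show "series ! i \<subseteq> series ! Suc i"
      using submodule_memD(2)[OF submodule_low3] by (auto simp: series_def low3_def low23_def)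
  qed
  then show ?thesis
    unfolding composition_series_def
    using submodule_zero submodule_low3 submodule_low23 submodule_carrier
    by (simp add: series_def)
qed

text \<open>The first kind of good vector leads to the top factor, the second kind to the factor in the
  middle, the line of \<open>n\<close> modulo the line of \<open>m\<close>.\<close>

lemma composition_factor_if_good_vector:
  assumes S: "left_module (hecke q) S" "module_isomorphic (hecke q) S L'"
    and L': "special_module q t L'" "irreducible_module (hecke q) L'" "special_module.good_vector q t L' x"
  shows "composition_factor (hecke q) S L"
proof -
  interpret L': special_module q t L' by fact
  have "\<exists>i<3. module_isomorphic (hecke q) L' (factor i)"
  proof (cases "x \<in> weight_space q L' t")
    case True
    obtain y where "top_module q t (factor 2) y" using top_factor by blast
    moreover have "top_module q t L' x"
      using L'.simple_top[OF L'(2)] L'(3) True by (simp add: L'.good_vector_def)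
    ultimately have "module_isomorphic (hecke q) L' (factor 2)"
      by (intro tops_isomorphic)
    then show ?thesis by (intro exI[of _ 2]) simp
  next
    case False
    then have x: "x \<noteq> \<zero>\<^bsub>L'\<^esub>" "x \<in> weight_space q L' t2"
      "hecke_T q i \<odot>\<^bsub>L'\<^esub> x = hecke_const q q \<odot>\<^bsub>L'\<^esub> x" for i
      using L'(3) by (cases i; simp add: L'.good_vector_def)+
    let ?n = "J ` low3 +>\<^bsub>L\<^esub> n"
    have n: "?n \<in> weight_space q (factor 1) t2"
      "hecke_T q i \<odot>\<^bsub>factor 1\<^esub> ?n = hecke_const q q \<odot>\<^bsub>factor 1\<^esub> ?n" for i
    proof -
      have eq: "hecke_class q h \<odot>\<^bsub>factor 1\<^esub> ?n = hecke_const q b \<odot>\<^bsub>factor 1\<^esub> ?n"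
        if "J ` low3 +>\<^bsub>L\<^esub> (hecke_class q h \<odot>\<^bsub>L\<^esub> n) = J ` low3 +>\<^bsub>L\<^esub> scal b n" for h b
        using that middle_line(6) by (simp add: hecke_const_def)
      show "?n \<in> weight_space q (factor 1) t2"
        using middle_line(3) eq weight_spaceD(2)[OF n_weight]
        by (simp add: weight_space_def hecke_X_def del: One_nat_def)
      \<comment> \<open>\<open>T\<^sub>1 n = q n + m\<close>, and \<open>m\<close> is zero modulo its own line.\<close>
      have "J1 (0, 0, q, 1) = J1 (0, 0, q, 0)"
      proof -
        interpret J1: coordinates scale4 gen4 q Q1 J1 by (rule J1)
        show ?thesis
          using J1_zero_iff[of "(0, 0, 0, 1)"] by (simp add: J1.J_eq_iff low3_def)
      qed
      then show "hecke_T q i \<odot>\<^bsub>factor 1\<^esub> ?n = hecke_const q q \<odot>\<^bsub>factor 1\<^esub> ?n"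
        unfolding hecke_T_def
        by (intro eq, fold hecke_T_def) (cases i; simp add: T1_n T2_n scal_basis J1_def)
    qed
    have "module_isomorphic (hecke q) L' (factor 1)"
      by (rule lines_isomorphic[OF L'(1) middle_line(1) x(2,3,1) L'.simple_line[OF L'(2) x]
            n middle_line(4) middle_line(5)[symmetric]])
    then show ?thesis by (intro exI[of _ 1]) simp
  qed
  then obtain i where i: "i < 3" "module_isomorphic (hecke q) L' (factor i)" by blast
  then have "module_isomorphic (hecke q) S (factor i)"
    using module_isomorphic_trans[OF S(2)] by blast
  moreover have "Suc i < length series" using i by (simp add: series_def)
  ultimately show ?thesis
    unfolding composition_factor_def using S(1) composition_series by blast
qed

end

section \<open>Good vectors in simple modules\<close>

context special_module
begin

lemma special_module_longest: "special_module q (\<lambda>\<mu>. t (- \<mu>)) L"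
  by (intro special_module.intro special_weight_longest hecke_module_axioms)

abbreviation has_good_vector :: bool where
  "has_good_vector \<equiv> (\<exists>x. good_vector x \<or> special_module.good_vector q (\<lambda>\<mu>. t (- \<mu>)) L x)"

lemma good_vector_longest:
  "special_module.good_vector q (\<lambda>\<mu>. t (- \<mu>)) L x \<longleftrightarrow> x \<noteq> \<zero>\<^bsub>L\<^esub> \<and> TT N2 x = scal q x \<and>
     (x \<in> weight_space q L (\<lambda>\<mu>. t (- \<mu>)) \<or> x \<in> weight_space q L t12 \<and> TT N1 x = scal q x)"
  unfolding special_module.good_vector_def[OF special_module_longest] longest_weights ..

lemma has_good_vector_longest:
  "special_module.has_good_vector q (\<lambda>\<mu>. t (- \<mu>)) L \<longleftrightarrow> has_good_vector"
  by auto

lemma intertwiner_zero: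
  assumes "x \<in> carrier L" "TT i x \<oplus>\<^bsub>L\<^esub> scal (- q) x = \<zero>\<^bsub>L\<^esub>"
  shows "TT i x = scal q x"
proof -
  have "TT i x = TT i x \<oplus>\<^bsub>L\<^esub> scal (- q + q) x"
    using assms(1) by simp
  also have "\<dots> = (TT i x \<oplus>\<^bsub>L\<^esub> scal (- q) x) \<oplus>\<^bsub>L\<^esub> scal q x"
    using assms(1) by (simp only: scal_add M.a_assoc op_closed)
  finally show ?thesis using assms by simp
qed

text \<open>Intertwining operators lead from \<open>s\<^sub>2 t\<close> to \<open>s\<^sub>1 s\<^sub>2 t\<close> and on to \<open>w\<^sub>0 t\<close>. Each image is an eigenvector
  of the generator that was used last. Where the next operator vanishes, the vector is an eigenvector
  of the other generator too and hence good; a nonzero vector that arrives at \<open>w\<^sub>0 t\<close> is good.\<close>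

lemma good_vector_from_t2:
  assumes x: "x \<noteq> \<zero>\<^bsub>L\<^esub>" "x \<in> weight_space q L t2" "TT N2 x = scal q x"
  shows has_good_vector
proof -
  let ?y = "TT N1 x \<oplus>\<^bsub>L\<^esub> scal (- q) x"
  let ?z = "TT N2 ?y \<oplus>\<^bsub>L\<^esub> scal (- q) ?y"
  have xL: "x \<in> carrier L" by (rule weight_spaceD(1)[OF x(2)])
  show ?thesis
  proof (cases "?y = \<zero>\<^bsub>L\<^esub>")
    case True
    then have "good_vector x"
      using x intertwiner_zero[OF xL] by (simp add: good_vector_def)
    then show ?thesis by blast
  next
    case y: False
    have y_weight: "?y \<in> weight_space q L t12" and y_T: "TT N1 ?y = scal q ?y"
      using intertwiner[OF torus(2) weights_root(1) x(2)] by simp_all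
    show ?thesis
    proof (cases "?z = \<zero>\<^bsub>L\<^esub>")
      case True
      then have "special_module.good_vector q (\<lambda>\<mu>. t (- \<mu>)) L ?y"
        unfolding good_vector_longest
        using y y_weight y_T intertwiner_zero[OF weight_spaceD(1)[OF y_weight] True] by blast
      then show ?thesis by blast
    next
      case z: False
      have "?z \<in> weight_space q L (\<lambda>\<mu>. t (- \<mu>))" "TT N2 ?z = scal q ?z"
        using intertwiner[OF torus(3) weights_root(5) y_weight] by simp_all
      then have "special_module.good_vector q (\<lambda>\<mu>. t (- \<mu>)) L ?z"
        unfolding good_vector_longest using z by blast
      then show ?thesis by blast
    qed
  qed
qed

lemma good_vector_from_orbit:
  assumes x: "x \<noteq> \<zero>\<^bsub>L\<^esub>" "x \<in> weight_space q L t \<or> x \<in> weight_space q L t2"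
  shows has_good_vector
proof -
  let ?y = "TT N2 x \<oplus>\<^bsub>L\<^esub> scal (- q) x"
  have xL: "x \<in> carrier L" using x(2) weight_spaceD(1) by blast
  show ?thesis
  proof (cases "?y = \<zero>\<^bsub>L\<^esub>")
    case True
    have T: "TT N2 x = scal q x" by (rule intertwiner_zero[OF xL True])
    from x(2) show ?thesis
    proof
      assume "x \<in> weight_space q L t"
      then have "good_vector x" using x(1) T by (simp add: good_vector_def)
      then show ?thesis by blast
    next
      assume "x \<in> weight_space q L t2"
      then show ?thesis using good_vector_from_t2 x(1) T by blast
    qed
  next
    case y: False
    from x(2) show ?thesis
    proof
      assume "x \<in> weight_space q L t"
      then have "?y \<in> weight_space q L t2" "TT N2 ?y = scal q ?y"
        using intertwiner[OF torus(1) weights_root(3)] by simp_all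
      then show ?thesis by (rule good_vector_from_t2[OF y])
    next
      assume "x \<in> weight_space q L t2"
      then have "?y \<in> weight_space q L t" "TT N2 ?y = scal q ?y"
        using intertwiner[OF torus(2) weights_root(4)] by simp_all
      then have "good_vector ?y" using y by (simp add: good_vector_def)
      then show ?thesis by blast
    qed
  qed
qed

text \<open>With \<open>a = X\<^sup>\<omega>\<^sup>1\<close> and \<open>b = X\<^sup>s\<^sup>1\<^sup>\<omega>\<^sup>1\<close>, the operators \<open>a + 1/a\<close> and \<open>b + 1/b\<close>. Their sum and
  their product are invariant under the Weyl group, hence central; at \<open>t\<close> both take the value zero.\<close>

definition "opA x = XX (1, 0) x \<oplus>\<^bsub>L\<^esub> XX (- 1, 0) x"
definition "opB x = XX (- 1, 1) x \<oplus>\<^bsub>L\<^esub> XX (1, - 1) x"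

definition central_zero :: "'b set" where
  "central_zero = {x \<in> carrier L. opA x \<oplus>\<^bsub>L\<^esub> opB x = \<zero>\<^bsub>L\<^esub> \<and> opA (opB x) = \<zero>\<^bsub>L\<^esub>}"

lemma opAB_closed [simp]: "x \<in> carrier L \<Longrightarrow> opA x \<in> carrier L" "x \<in> carrier L \<Longrightarrow> opB x \<in> carrier L"
  by (simp_all add: opA_def opB_def)

lemma add_swap:
  "\<lbrakk>x \<in> carrier L; y \<in> carrier L; x' \<in> carrier L; y' \<in> carrier L\<rbrakk> \<Longrightarrow>
    (x \<oplus>\<^bsub>L\<^esub> y) \<oplus>\<^bsub>L\<^esub> (x' \<oplus>\<^bsub>L\<^esub> y') = (x \<oplus>\<^bsub>L\<^esub> x') \<oplus>\<^bsub>L\<^esub> (y \<oplus>\<^bsub>L\<^esub> y')"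
  by (simp add: M.a_ac)

lemma opAB_add:
  assumes "x \<in> carrier L" "y \<in> carrier L"
  shows "opA (x \<oplus>\<^bsub>L\<^esub> y) = opA x \<oplus>\<^bsub>L\<^esub> opA y" "opB (x \<oplus>\<^bsub>L\<^esub> y) = opB x \<oplus>\<^bsub>L\<^esub> opB y"
  using assms by (simp_all add: opA_def opB_def op_add add_swap)

lemma opAB_scal:
  assumes "x \<in> carrier L"
  shows "opA (scal a x) = scal a (opA x)" "opB (scal a x) = scal a (opB x)"
  using assms by (simp_all add: opA_def opB_def op_add op_scal)

lemma opAB_XX:
  assumes "x \<in> carrier L"
  shows "opA (XX \<mu> x) = XX \<mu> (opA x)" "opB (XX \<mu> x) = XX \<mu> (opB x)"
  using assms by (simp_all add: opA_def opB_def op_add XX_XX add.commute)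

lemma opAB_commute: "x \<in> carrier L \<Longrightarrow> opA (opB x) = opB (opA x)"
  by (simp add: opB_def opAB_add opAB_XX)

lemma opAB_zero [simp]: "opA \<zero>\<^bsub>L\<^esub> = \<zero>\<^bsub>L\<^esub>" "opB \<zero>\<^bsub>L\<^esub> = \<zero>\<^bsub>L\<^esub>"
  by (simp_all add: opA_def opB_def)

lemma opAB_T2:
  assumes x: "x \<in> carrier L"
  shows "opA (TT N2 x) = TT N2 (opA x)" "opB (TT N2 x) = TT N2 (opB x)"
proof -
  show "opA (TT N2 x) = TT N2 (opA x)"
    using x by (simp add: opA_def bernstein_N2 op_add)
  have "opB (TT N2 x) = (TT N2 (XX (1, - 1) x) \<oplus>\<^bsub>L\<^esub> scal (2 * q) (XX (- 1, 1) x)) \<oplus>\<^bsub>L\<^esub>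
      (TT N2 (XX (- 1, 1) x) \<oplus>\<^bsub>L\<^esub> scal (- 2 * q) (XX (- 1, 1) x))"
    unfolding opB_def bernstein_N2(2,4)[OF x] ..
  also have "\<dots> = (TT N2 (XX (1, - 1) x) \<oplus>\<^bsub>L\<^esub> TT N2 (XX (- 1, 1) x)) \<oplus>\<^bsub>L\<^esub>
      (scal (2 * q) (XX (- 1, 1) x) \<oplus>\<^bsub>L\<^esub> scal (- 2 * q) (XX (- 1, 1) x))"
    using x by (intro add_swap) simp_all
  also have "scal (2 * q) (XX (- 1, 1) x) \<oplus>\<^bsub>L\<^esub> scal (- 2 * q) (XX (- 1, 1) x) = \<zero>\<^bsub>L\<^esub>"
    using x scal_add[of "XX (- 1, 1) x" "2 * q" "- 2 * q"] by simp
  finally show "opB (TT N2 x) = TT N2 (opB x)"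
    using x by (simp add: opB_def op_add M.a_comm)
qed

text \<open>\<open>T\<^sub>1\<close> exchanges the two operators up to the correction \<open>D = 2q (a - 1/b)\<close>, which cancels in
  the sum and in the product.\<close>

lemma opAB_T1:
  assumes x: "x \<in> carrier L"
  defines "D \<equiv> scal (2 * q) (XX (1, 0) x) \<oplus>\<^bsub>L\<^esub> scal (- 2 * q) (XX (1, - 1) x)"
  shows "opA (TT N1 x) = TT N1 (opB x) \<oplus>\<^bsub>L\<^esub> D" "opB (TT N1 x) = TT N1 (opA x) \<oplus>\<^bsub>L\<^esub> scal (- 1) D"
proof -
  show "opA (TT N1 x) = TT N1 (opB x) \<oplus>\<^bsub>L\<^esub> D"
    unfolding opA_def opB_def D_def bernstein_N1(1,3)[OF x] using x by (simp add: op_add add_swap)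
  show "opB (TT N1 x) = TT N1 (opA x) \<oplus>\<^bsub>L\<^esub> scal (- 1) D"
    unfolding opA_def opB_def D_def bernstein_N1(2,4)[OF x] using x
    by (simp add: op_add add_swap scal_scal)
qed

lemma sum_T1:
  assumes x: "x \<in> carrier L"
  shows "opA (TT N1 x) \<oplus>\<^bsub>L\<^esub> opB (TT N1 x) = TT N1 (opA x \<oplus>\<^bsub>L\<^esub> opB x)"
proof -
  define D where "D = scal (2 * q) (XX (1, 0) x) \<oplus>\<^bsub>L\<^esub> scal (- 2 * q) (XX (1, - 1) x)"
  have D: "D \<in> carrier L" using x by (simp add: D_def)
  have "opA (TT N1 x) \<oplus>\<^bsub>L\<^esub> opB (TT N1 x) = (TT N1 (opB x) \<oplus>\<^bsub>L\<^esub> TT N1 (opA x)) \<oplus>\<^bsub>L\<^esub> (D \<oplus>\<^bsub>L\<^esub> scal (- 1) D)"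
    unfolding opAB_T1[OF x, folded D_def] using x D by (intro add_swap) simp_all
  also have "D \<oplus>\<^bsub>L\<^esub> scal (- 1) D = \<zero>\<^bsub>L\<^esub>"
    using D scal_add[of D 1 "- 1"] by simp
  finally show ?thesis using x by (simp add: op_add M.a_comm)
qed

lemma prod_T1:
  assumes x: "x \<in> carrier L"
  shows "opA (opB (TT N1 x)) = TT N1 (opA (opB x))"
proof -
  define D where "D y = scal (2 * q) (XX (1, 0) y) \<oplus>\<^bsub>L\<^esub> scal (- 2 * q) (XX (1, - 1) y)" for y
  have D: "D y \<in> carrier L" if "y \<in> carrier L" for y using that by (simp add: D_def)
  have D_A: "opA (D x) = D (opA x)"
    using x by (simp add: D_def opAB_add opAB_scal opAB_XX)
  have "opA (opB (TT N1 x)) = opA (TT N1 (opA x)) \<oplus>\<^bsub>L\<^esub> scal (- 1) (opA (D x))"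
    unfolding opAB_T1(2)[OF x, folded D_def] using x D[OF x] by (simp add: opAB_add opAB_scal)
  also have "opA (TT N1 (opA x)) = TT N1 (opB (opA x)) \<oplus>\<^bsub>L\<^esub> D (opA x)"
    by (rule opAB_T1(1)[of "opA x", folded D_def]) (simp add: x)
  also have "(TT N1 (opB (opA x)) \<oplus>\<^bsub>L\<^esub> D (opA x)) \<oplus>\<^bsub>L\<^esub> scal (- 1) (opA (D x)) =
      TT N1 (opB (opA x)) \<oplus>\<^bsub>L\<^esub> (D (opA x) \<oplus>\<^bsub>L\<^esub> scal (- 1) (D (opA x)))"
    using x D[of "opA x"] by (simp add: D_A M.a_assoc)
  also have "D (opA x) \<oplus>\<^bsub>L\<^esub> scal (- 1) (D (opA x)) = \<zero>\<^bsub>L\<^esub>"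
    using D[of "opA x"] x scal_add[of "D (opA x)" 1 "- 1"] by simp
  finally show ?thesis using x by (simp add: opAB_commute)
qed

lemma submodule_central_zero: "submodule central_zero (hecke q) L"
proof (rule submodule_hecke)
  show "x \<oplus>\<^bsub>L\<^esub> y \<in> central_zero" if "x \<in> central_zero" "y \<in> central_zero" for x y
    using that add_swap[of "opA x" "opA y" "opB x" "opB y"] by (simp add: central_zero_def opAB_add)
  show "scal a x \<in> central_zero" if "x \<in> central_zero" for a x
    using that by (simp add: central_zero_def opAB_scal op_add(1)[symmetric])
  show "XX \<mu> x \<in> central_zero" if "x \<in> central_zero" for \<mu> x
    using that by (simp add: central_zero_def opAB_XX op_add(3)[symmetric])
  show "TT i x \<in> central_zero" if "x \<in> central_zero" for i x
  proof (cases i)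
    case N1
    then show ?thesis using that by (simp add: central_zero_def sum_T1 prod_T1)
  next
    case N2
    then show ?thesis using that by (simp add: central_zero_def opAB_T2 op_add(2)[symmetric])
  qed
qed (auto simp: central_zero_def)

lemma weight_vector_central_zero:
  assumes "x \<in> weight_space q L t"
  shows "x \<in> central_zero"
proof -
  have x: "x \<in> carrier L" by (rule weight_spaceD(1)[OF assms])
  have "opA x = \<zero>\<^bsub>L\<^esub>" "opB x = \<zero>\<^bsub>L\<^esub>"
    using x scal_add[OF x, of \<iota> "- \<iota>"]
    by (simp_all add: opA_def opB_def weight_spaceD(2)[OF assms])
  then show ?thesis using x by (simp add: central_zero_def)
qed

text \<open>\<open>X\<^sup>\<mu>\<close> squares to \<open>-1\<close> on \<open>x\<close>, so one of \<open>x\<close> and \<open>(X\<^sup>\<mu> - \<iota>) x\<close> is an eigenvector. The last conclusion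
  serves to carry properties of \<open>x\<close> over to \<open>y\<close>.\<close>

lemma eigenvector:
  assumes x: "x \<in> carrier L" "x \<noteq> \<zero>\<^bsub>L\<^esub>" and zero: "XX \<mu> x \<oplus>\<^bsub>L\<^esub> XX (- \<mu>) x = \<zero>\<^bsub>L\<^esub>"
  obtains a y where "a = \<iota> \<or> a = - \<iota>" "y \<in> carrier L" "y \<noteq> \<zero>\<^bsub>L\<^esub>" "XX \<mu> y = scal a y"
    "y = x \<or> y = XX \<mu> x \<oplus>\<^bsub>L\<^esub> scal (- \<iota>) x"
proof -
  let ?y = "XX \<mu> x \<oplus>\<^bsub>L\<^esub> scal (- \<iota>) x"
  have "XX \<mu> (XX \<mu> x) \<oplus>\<^bsub>L\<^esub> x = XX \<mu> (XX \<mu> x \<oplus>\<^bsub>L\<^esub> XX (- \<mu>) x)"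
    using x by (simp add: op_add XX_XX[of x \<mu> "- \<mu>"] XX_zero)
  then have "XX \<mu> (XX \<mu> x) \<oplus>\<^bsub>L\<^esub> x = \<zero>\<^bsub>L\<^esub>"
    by (simp add: zero)
  then have square: "XX \<mu> (XX \<mu> x) = scal (- 1) x"
    using x by (simp add: scal_minus_one M.minus_equality)
  show thesis
  proof (cases "?y = \<zero>\<^bsub>L\<^esub>")
    case True
    have "XX \<mu> x = XX \<mu> x \<oplus>\<^bsub>L\<^esub> scal (- \<iota> + \<iota>) x"
      using x by simp
    also have "\<dots> = ?y \<oplus>\<^bsub>L\<^esub> scal \<iota> x"
      using x by (simp only: scal_add M.a_assoc op_closed)
    finally have "XX \<mu> x = scal \<iota> x" using x True by simp
    then show ?thesis using that[of \<iota> x] x by simp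
  next
    case False
    have "XX \<mu> ?y = scal (- \<iota>) ?y"
      using x by (simp add: op_add op_scal scal_scal square M.a_comm)
    then show ?thesis using that[of "- \<iota>" ?y] x False by simp
  qed
qed

text \<open>The two operators have sum and product zero, so each of them squares to zero and some nonzero
  vector is killed by both. On such vectors \<open>a\<^sup>2 = b\<^sup>2 = -1\<close>, and a common eigenvector of \<open>a\<close> and \<open>b\<close> has
  one of the four weights in the orbit of \<open>t\<close>.\<close>

lemma has_good_vector_if_central_zero:
  assumes zero: "carrier L = central_zero" and nontrivial: "carrier L \<noteq> {\<zero>\<^bsub>L\<^esub>}"
  shows has_good_vector
proof -
  have sum: "opA x \<oplus>\<^bsub>L\<^esub> opB x = \<zero>\<^bsub>L\<^esub>" and prod: "opA (opB x) = \<zero>\<^bsub>L\<^esub>" if "x \<in> carrier L" for x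
  proof -
    have "x \<in> central_zero" unfolding zero[symmetric] by (rule that)
    then show "opA x \<oplus>\<^bsub>L\<^esub> opB x = \<zero>\<^bsub>L\<^esub>" "opA (opB x) = \<zero>\<^bsub>L\<^esub>"
      by (simp_all add: central_zero_def)
  qed
  obtain x where x: "x \<in> carrier L" "x \<noteq> \<zero>\<^bsub>L\<^esub>"
    using nontrivial M.zero_closed by blast
  have "\<exists>y \<in> carrier L. y \<noteq> \<zero>\<^bsub>L\<^esub> \<and> opA y = \<zero>\<^bsub>L\<^esub> \<and> opB y = \<zero>\<^bsub>L\<^esub>"
  proof (cases "opA x = \<zero>\<^bsub>L\<^esub>")
    case True
    then show ?thesis using sum[OF x(1)] x by auto
  next
    case False
    have "opB (opA x) = \<zero>\<^bsub>L\<^esub>"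
      using prod[OF x(1)] x(1) by (simp add: opAB_commute)
    then show ?thesis using sum[of "opA x"] x(1) False by auto
  qed
  then obtain y where y: "y \<in> carrier L" "y \<noteq> \<zero>\<^bsub>L\<^esub>" "opA y = \<zero>\<^bsub>L\<^esub>" "opB y = \<zero>\<^bsub>L\<^esub>"
    by blast
  obtain a z where a: "a = \<iota> \<or> a = - \<iota>" and z: "z \<in> carrier L" "z \<noteq> \<zero>\<^bsub>L\<^esub>" "XX (1, 0) z = scal a z"
    and z_y: "z = y \<or> z = XX (1, 0) y \<oplus>\<^bsub>L\<^esub> scal (- \<iota>) y"
    using eigenvector[OF y(1,2), of "(1, 0)"] y(3) unfolding opA_def by auto
  have "opB z = \<zero>\<^bsub>L\<^esub>"
    using z_y y by (auto simp: opAB_add opAB_XX opAB_scal)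
  then obtain b s where b: "b = \<iota> \<or> b = - \<iota>" and s: "s \<in> carrier L" "s \<noteq> \<zero>\<^bsub>L\<^esub>" "XX (- 1, 1) s = scal b s"
    and s_z: "s = z \<or> s = XX (- 1, 1) z \<oplus>\<^bsub>L\<^esub> scal (- \<iota>) z"
    using eigenvector[OF z(1,2), of "(- 1, 1)"] unfolding opB_def by auto
  have "XX (1, 0) (XX (- 1, 1) z) = scal a (XX (- 1, 1) z)"
    using z XX_XX[of z "(1, 0)" "(- 1, 1)"] XX_XX[of z "(- 1, 1)" "(1, 0)"] by (simp add: op_scal)
  then have s_a: "XX (1, 0) s = scal a s"
    using s_z z by (auto simp: op_add op_scal scal_scal mult.commute)
  interpret neg: special_module q "\<lambda>\<mu>. t (- \<mu>)" L by (rule special_module_longest)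
  have neg_orbit: has_good_vector
    if "s \<in> weight_space q L (\<lambda>\<mu>. t (- \<mu>)) \<or> s \<in> weight_space q L t12"
    using neg.good_vector_from_orbit[OF s(2)] that
    unfolding longest_weights has_good_vector_longest by blast
  from a b consider "a = \<iota>" "b = \<iota>" | "a = \<iota>" "b = - \<iota>" | "a = - \<iota>" "b = \<iota>" | "a = - \<iota>" "b = - \<iota>"
    by blast
  then show ?thesis
  proof cases
    case 1
    then have "s \<in> weight_space q L t"
      using s s_a by (intro weight_from_basis) simp_all
    then show ?thesis using good_vector_from_orbit[OF s(2)] by blast
  next
    case 2
    then have "s \<in> weight_space q L t2"
      using s s_a by (intro weight_from_basis) simp_all
    then show ?thesis using good_vector_from_orbit[OF s(2)] by blast
  next
    case 3
    then have "s \<in> weight_space q L t12"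
      using s s_a by (intro weight_from_basis) simp_all
    then show ?thesis using neg_orbit by blast
  next
    case 4
    then have "s \<in> weight_space q L (\<lambda>\<mu>. t (- \<mu>))"
      using s s_a by (intro weight_from_basis) (simp_all add: torus_minus)
    then show ?thesis using neg_orbit by blast
  qed
qed

lemma central_zero_quotient:
  assumes zero: "carrier L = central_zero"
    and N: "submodule N (hecke q) L" "submodule N' (hecke q) L" "N \<subseteq> N'"
  defines "Q \<equiv> quotient_module (L\<lparr>carrier := N'\<rparr>) N"
  shows "special_module q t Q" and "carrier Q = special_module.central_zero q Q"
proof -
  note quot = quotient_module[OF left_module_submodule[OF N(2)] submodule_of_submodule[OF N(1,2,3)],
      folded Q_def, simplified]
  interpret Q: special_module q t Q
    by (intro special_module.intro special_weight_axioms hecke_module.intro quot(1))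
  show "special_module q t Q" by (rule Q.special_module_axioms)
  have "N +>\<^bsub>L\<^esub> x \<in> Q.central_zero" if x: "x \<in> N'" for x
  proof -
    have X: "XX \<mu> y \<in> N'" if "y \<in> N'" for \<mu> y
      using submodule_memD(5)[OF N(2) _ that] by (simp add: hecke_X_def)
    note add = submodule_memD(3)[OF N(2)]
    have Q_X: "hecke_X q \<mu> \<odot>\<^bsub>Q\<^esub> (N +>\<^bsub>L\<^esub> y) = N +>\<^bsub>L\<^esub> XX \<mu> y" if "y \<in> N'" for \<mu> y
      using quot(4)[of "hecke_X q \<mu>" y] that by (simp add: hecke_X_def)
    have mem: "opA y \<in> N'" "opB y \<in> N'" if "y \<in> N'" for y
      using X add that by (simp_all add: opA_def opB_def)
    have ops: "Q.opA (N +>\<^bsub>L\<^esub> y) = N +>\<^bsub>L\<^esub> opA y" "Q.opB (N +>\<^bsub>L\<^esub> y) = N +>\<^bsub>L\<^esub> opB y" if "y \<in> N'" for y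
      using X that by (simp_all add: Q.opA_def Q.opB_def opA_def opB_def Q_X quot(3))
    have "N +>\<^bsub>L\<^esub> \<zero>\<^bsub>L\<^esub> = \<zero>\<^bsub>Q\<^esub>"
      using quot(5,6) submodule_memD(2)[OF N(1)] submodule_memD(2)[OF N(2)] by simp
    moreover have "x \<in> central_zero"
      using x submodule_memD(1)[OF N(2)] zero by blast
    ultimately show ?thesis
      using x mem by (simp add: Q.central_zero_def central_zero_def ops quot(2) quot(3)[symmetric])
        (simp add: quot(3))
  qed
  then show "carrier Q = Q.central_zero"
    unfolding quot(2) by (auto simp: Q.central_zero_def quot(2))
qed

end

section \<open>The theorem\<close>

text \<open>A central element acts on the principal series as it acts on its generator, which has weight
  \<open>t\<close>. In this way the factors of the principal series are reached without a basis of it.\<close>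

lemma (in special_weight) principal_series_central_zero:
  assumes C: "left_module (hecke_poly_subring q) C" "complex_basis q C [c]"
    and c: "\<And>\<mu>. hecke_X q \<mu> \<odot>\<^bsub>C\<^esub> c = hecke_const q (t \<mu>) \<odot>\<^bsub>C\<^esub> c"
  defines "P \<equiv> induced_module (hecke q) (hecke_poly_subring q) C"
  shows "special_module q t P" and "carrier P = special_module.central_zero q P"
proof -
  let ?A = "hecke_poly_subring q"
  have carrier_A: "carrier ?A = range (hecke_poly q)" by (simp add: hecke_poly_subring_def)
  interpret C: left_module ?A C by (rule C(1))
  interpret induced "hecke q" ?A C
    by (intro induced.intro induced_axioms.intro ring_hecke hecke_poly_subring_subset)
      (auto intro: C.smult_closed)
  have const: "hecke_const q a \<in> carrier ?A" for a
    unfolding carrier_A by (rule hecke_const_in_range)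
  have X: "hecke_X q \<mu> \<in> carrier ?A" for \<mu>
    unfolding carrier_A by (rule hecke_X_in_range)
  note basis = complex_basis_single[OF C(1) const C(2)]
  interpret P: special_module q t P
    unfolding P_def by (intro special_module.intro special_weight_axioms hecke_module.intro left_module_induced)
  show "special_module q t P" by (rule P.special_module_axioms)
  let ?g = "tensor (hecke q) ?A C \<one>\<^bsub>hecke q\<^esub> c"
  have smult: "a \<odot>\<^bsub>P\<^esub> ?g = tensor (hecke q) ?A C \<one>\<^bsub>hecke q\<^esub> (a \<odot>\<^bsub>C\<^esub> c)" if "a \<in> carrier ?A" for a
    using that basis(1) smult_tensor[of a "\<one>\<^bsub>hecke q\<^esub>" c] tensor_balanced[of "\<one>\<^bsub>hecke q\<^esub>" a c] A_subset
    unfolding P_def by auto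
  have g: "?g \<in> carrier P"
    unfolding P_def by (rule tensor_closed) (simp_all add: basis(1))
  have "?g \<in> weight_space q P t"
    using g by (simp add: weight_space_def smult[OF X] smult[OF const] c)
  then have "?g \<in> P.central_zero"
    by (rule P.weight_vector_central_zero)
  then show "carrier P = P.central_zero"
    using submodule_with_generator[OF basis(1) _ P.submodule_central_zero[unfolded P_def]]
      ex1_implies_ex[OF basis(2)] const unfolding P_def by blast
qed

theorem proposition19:
  fixes q :: complex
    and t :: "lattice \<Rightarrow> complex"
    and V :: "(hecke_elt, 'v) module" and v :: 'v
    and V' :: "(hecke_elt, 'w) module" and v' :: 'w
    and C :: "(hecke_elt, 'c) module" and c :: 'c
    and M :: "(hecke_elt, (hecke_elt \<times> 'v \<Rightarrow>\<^sub>0 int) set) module"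
    and N :: "(hecke_elt, (hecke_elt \<times> 'w \<Rightarrow>\<^sub>0 int) set) module"
    and P :: "(hecke_elt, (hecke_elt \<times> 'c \<Rightarrow>\<^sub>0 int) set) module"
    and S :: "(hecke_elt, 's) module"
  assumes q: "q ^ 2 = -1"
    and t: "t \<in> torus" "restricts_to t 1 (q ^ 2)"
    and V: "left_module (hecke_parabolic q N2) V" "complex_basis q V [v]"
      "hecke_T q N2 \<odot>\<^bsub>V\<^esub> v = hecke_const q q \<odot>\<^bsub>V\<^esub> v"
      "\<And>\<mu>. hecke_X q \<mu> \<odot>\<^bsub>V\<^esub> v = hecke_const q (t \<mu>) \<odot>\<^bsub>V\<^esub> v"
    and V': "left_module (hecke_parabolic q N2) V'" "complex_basis q V' [v']"
      "hecke_T q N2 \<odot>\<^bsub>V'\<^esub> v' = hecke_const q (- inverse q) \<odot>\<^bsub>V'\<^esub> v'"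
      "\<And>\<mu>. hecke_X q \<mu> \<odot>\<^bsub>V'\<^esub> v' = hecke_const q (weyl_act longest_element t \<mu>) \<odot>\<^bsub>V'\<^esub> v'"
    and C: "left_module (hecke_poly_subring q) C" "complex_basis q C [c]"
      "\<And>\<mu>. hecke_X q \<mu> \<odot>\<^bsub>C\<^esub> c = hecke_const q (t \<mu>) \<odot>\<^bsub>C\<^esub> c"
    and M: "M = induced_module (hecke q) (hecke_parabolic q N2) V"
    and N: "N = induced_module (hecke q) (hecke_parabolic q N2) V'"
    and P: "P = induced_module (hecke q) (hecke_poly_subring q) C"
  shows
    "(let t2 = weyl_act (reflection N2) t;
          t12 = weyl_act (reflection N1 \<circ> reflection N2) t;
          M_1 = quotient_module M (weight_space q M t12);
          K = (\<lambda>m. weight_space q M t12 +>\<^bsub>M\<^esub> m) ` weight_space q M t2;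
          N_1 = quotient_module N (weight_space q N t2);
          L = (\<lambda>m. weight_space q N t2 +>\<^bsub>N\<^esub> m) ` weight_space q N t12
      in submodule (weight_space q M t12) (hecke q) M \<and>
         submodule K (hecke q) M_1 \<and>
         complex_dimension q (quotient_module M_1 K) 2 \<and>
         irreducible_module (hecke q) (quotient_module M_1 K) \<and>
         submodule (weight_space q N t2) (hecke q) N \<and>
         submodule L (hecke q) N_1 \<and>
         complex_dimension q (quotient_module N_1 L) 2 \<and>
         irreducible_module (hecke q) (quotient_module N_1 L)) \<and>
     (composition_factor (hecke q) S P \<longrightarrow>
        composition_factor (hecke q) S M \<or> composition_factor (hecke q) S N)"
proof -
  interpret special_weight q t by unfold_locales (fact q t)+
  let ?t' = "\<lambda>\<mu>. t (- \<mu>)"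
  interpret M: induced_weight_module q t V v
    by (intro induced_weight_module.intro induced_weight_module_axioms.intro special_weight_axioms V)
  interpret neg: special_weight q ?t' by (rule special_weight_longest)
  interpret N: induced_weight_module q ?t' V' v'
    by (intro induced_weight_module.intro induced_weight_module_axioms.intro neg.special_weight_axioms)
      (use V' in \<open>simp_all add: inverse_q weyl_act_longest\<close>)
  interpret M: free_standard q t M M.gen
    unfolding M by unfold_locales (rule M.J_surj M.J_inj)+
  interpret N: free_standard q ?t' N N.gen
    unfolding N by unfold_locales (rule N.J_surj N.J_inj)+
  have weights: "weyl_act (reflection N2) t = t2" "weyl_act (reflection N1 \<circ> reflection N2) t = t12"
    by (simp_all add: weyl_act_reflection weyl_act_reflection2)
  note parts = M.weight_filtration[unfolded Let_def] N.weight_filtration[unfolded Let_def longest_weights]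
  have "composition_factor (hecke q) S M \<or> composition_factor (hecke q) S N"
    if S: "composition_factor (hecke q) S P"
  proof -
    obtain Ns i where S_left: "left_module (hecke q) S" and Ns: "composition_series (hecke q) P Ns"
      and i: "Suc i < length Ns"
      and iso: "module_isomorphic (hecke q) S (quotient_module (P\<lparr>carrier := Ns ! Suc i\<rparr>) (Ns ! i))"
      using S unfolding composition_factor_def by blast
    let ?Q = "quotient_module (P\<lparr>carrier := Ns ! Suc i\<rparr>) (Ns ! i)"
    have sub: "submodule (Ns ! i) (hecke q) P" "submodule (Ns ! Suc i) (hecke q) P"
      "Ns ! i \<subseteq> Ns ! Suc i" and irr: "irreducible_module (hecke q) ?Q"
      using Ns i unfolding composition_series_def by auto
    interpret P: special_module q t P
      unfolding P by (rule principal_series_central_zero(1)[OF C])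
    have "carrier P = P.central_zero"
      using principal_series_central_zero(2)[OF C] unfolding P .
    note quot = P.central_zero_quotient[OF this sub]
    interpret Q: special_module q t ?Q by (rule quot(1))
    have "carrier ?Q \<noteq> {\<zero>\<^bsub>?Q\<^esub>}"
      using irr by (simp add: irreducible_module_def)
    then obtain x where "Q.good_vector x \<or> special_module.good_vector q ?t' ?Q x"
      using Q.has_good_vector_if_central_zero[OF quot(2)] by blast
    then show ?thesis
      using M.composition_factor_if_good_vector[OF S_left iso quot(1) irr]
        N.composition_factor_if_good_vector[OF S_left iso Q.special_module_longest irr] by blast
  qed
  then show ?thesis
    unfolding Let_def weights using parts by blast
qed

end
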